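(* Let $G\in\mathbf{B}^+(\mathcal H)$. The mapping $\tau_G$ possesses the following properties (throughout, $X\in\mathbf{B}^+(\mathcal H)$). (1) $\tau_G(\mu_G(X))=\tau_G(X)$ for all $X\in\mathbf{B}^+(\mathcal H)$; therefore $\tau_G(\mu_G^{[n]}(X))=\tau_G(X)$ for all natural $n$. (2) $\tau_G(X):G=0$ for all $X\in\mathbf{B}^+(\mathcal H)$. (3) $\tau_G(X)\le X$ for all $X\in\mathbf{B}^+(\mathcal H)$, and $\tau_G(X)=X\iff X:G=0\iff\mathrm{ran}\,X^{1/2}\cap\mathrm{ran}\,G^{1/2}=\{0\}$. (4) $\tau_G(X)=\tau_G(\tau_G(X))$ for an arbitrary $X\in\mathbf{B}^+(\mathcal H)$. (5) Define the subspace $\mathfrak M=\mathcal H\ominus\mathrm{clos}\{f\in\mathcal H:(G+X)^{1/2}f\in\mathrm{ran}\,G^{1/2}\}$; then $\tau_G(X)=(G+X)^{1/2}P_{\mathfrak M}(G+X)^{1/2}$. (6) Define the contraction $\mathcal T=(G+X)^{-1/2}X^{1/2}$ and the subspace $\mathfrak L=\ker(I-\mathcal T^*\mathcal T)$; then $\mathfrak L=\mathcal H\ominus\mathrm{clos}\{g\in\mathcal H: X^{1/2}g\in\mathrm{ran}\,G^{1/2}\}$ and $\tau_G(X)=X^{1/2}P_{\mathfrak L}X^{1/2}$; in particular, if $X$ is positive definite, then $\mathfrak L=X^{1/2}\ker G$. (7) If $XG=GX$, then $\tau_G(X)=X^{1/2}P_{\mathfrak N}X^{1/2}$, where $\mathfrak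 N=\ker G\cap\overline{\mathrm{ran}}\,X$. (8) $\tau_G(G)=0$. (9) If $\mathrm{ran}\,X^{1/2}\subseteq\mathrm{ran}\,G^{1/2}$, then $\tau_G(X)=0$; in particular, $\tau_G(X:G)=0$ for every $X\in\mathbf{B}^+(\mathcal H)$. (10) If $\mathrm{ran}\,X^{1/2}=\mathrm{ran}\,G^{\alpha}$, $\alpha<1/2$, then $\tau_G(X)=0$. (11) $\tau_G(\lambda G+X)=\tau_{\eta G}(X)=\tau_G(X)$ for all $\lambda>0$ and $\eta>0$. (12) $\tau_G(\xi X)=\xi\,\tau_G(X)$, $\xi>0$. (13) If $\mathrm{ran}\,G_1^{1/2}=\mathrm{ran}\,G_2^{1/2}$ (with $G_1,G_2\in\mathbf{B}^+(\mathcal H)$), then $\tau_{G_1}(X)=\tau_{G_2}(X)=\tau_{G_1}(G_2+X)=\tau_{G_2}(G_1+X)$ for all $X\in\mathbf{B}^+(\mathcal H)$. (14) If $\mathrm{ran}\,G_1^{1/2}\subseteq\mathrm{ran}\,G_2^{1/2}$ (with $G_1,G_2\in\mathbf{B}^+(\mathcal H)$), then $\tau_{G_1}(X)\ge\tau_{G_2}(X)$ for all $X\in\mathbf{B}^+(\mathcal H)$. (15) If $\tau_G(X)\in\mathbf{B}^+_0(\mathcal H)$, then $X\in\mathbf{B}^+_0(\mathcal H)$ and $X^2:G=0$. (16) The following conditions are equivalent: (i) $\tau_G(X)\in\mathbf{B}^+_0(\mathcal H)$; (ii) $X\in\mathbf{B}^+_0(\mathcal H)$ and $\mathrm{ran}\,(G+X)^{1/2}\cap\mathrm{clos}\{(G+X)^{-1/2}\mathrm{ran}\,G^{1/2}\}=\{0\}$;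 (iii) $X\in\mathbf{B}^+_0(\mathcal H)$ and for each converging sequence $\{y_n\}\subset\mathrm{ran}\,G^{1/2}$ such that $\lim_{n\to\infty}y_n\in\mathrm{ran}\,X$ it follows that the sequence $\{(G+X)^{-1/2}y_n\}$ is diverging; (iv) $X\in\mathbf{B}^+_0(\mathcal H)$ and $\mathrm{ran}\,X^{1/2}\cap\mathrm{clos}\{X^{-1/2}(\mathrm{ran}\,X^{1/2}\cap\mathrm{ran}\,G^{1/2})\}=\{0\}$; (v) $X\in\mathbf{B}^+_0(\mathcal H)$ and for each converging sequence $\{z_n\}\subset\mathrm{ran}\,X^{1/2}\cap\mathrm{ran}\,G^{1/2}$ such that $\lim_{n\to\infty}z_n\in\mathrm{ran}\,X$ it follows that the sequence $\{X^{-1/2}z_n\}$ is diverging. (17) If $X$ is a compact operator, then $\tau_G(X)$ is a compact operator as well; moreover, if $X$ belongs to the Schatten–von Neumann class $S_p$ ($p\ge1$), then $\tau_G(X)\in S_p$.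
   Context: $\mathcal H$ is a complex Hilbert space; $\mathbf{B}^+(\mathcal H)$ is the cone of all bounded nonnegative self-adjoint operators in $\mathcal H$, and $\mathbf{B}^+_0(\mathcal H)$ is the subset of those with trivial kernel. An operator $X$ is positive definite if $(Xf,f)\ge m\|f\|^2$ for all $f$ and some $m>0$. $\overline{\mathrm{ran}}\,X$ denotes the closure of $\mathrm{ran}\,X$, $\mathrm{clos}$ denotes closure, and $P_{\mathcal K}$ is the orthogonal projection onto a closed subspace $\mathcal K$. For $A\in\mathbf{B}^+(\mathcal H)$, $A^{-1/2}$ is the Moore–Penrose pseudo-inverse of $A^{1/2}$: for $y\in\mathrm{ran}\,A^{1/2}$, $A^{-1/2}y$ is the unique $x\in\overline{\mathrm{ran}}\,A$ with $A^{1/2}x=y$. For $X,G\in\mathbf{B}^+(\mathcal H)$ the parallel sum $X:G\in\mathbf{B}^+(\mathcal H)$ is the operator with quadratic form $((X:G)h,h)=\inf\{(Xf,f)+(Gg,g): f,g\in\mathcal H,\ h=f+g\}$. The mapping $\mu_G:\mathbf{B}^+(\mathcal H)\to\mathbf{B}^+(\mathcal H)$ is $\mu_G(X)=X-X:G$, and $\mu_G^{[n]}$ is its $n$-th iterate. Since $0\le\mu_G(X)\le X$, the sequence $\{\mu_G^{[n]}(X)\}$ is non-increasing, and $\tau_G:\mathbf{B}^+(\mathcal H)\to\mathbf{B}^+(\mathcal H)$ is defined by the strong limit $\tau_G(X)=\text{s-}\lim_{n\to\infty}\mu_G^{[n]}(X)$.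
   Formalization: In (16)(iii) and (v) the limit in ran X is required to be nonzero (the zero sequence would otherwise refute both conditions always); in (10), G^0 is the projection onto the closure of ran G, since with G^0=I the claim fails for G=0, X=I. *)

theory Defs
  imports "HOL-Analysis.Analysis" "HOL-Computational_Algebra.Polynomial"
begin

(* A complex Hilbert space is a complete real inner product space together with a complex
   scalar multiplication extending *\<^sub>R and a complex inner product (linear in the
   first argument) whose real part is the real inner product.  Positivity and
   norm x = sqrt (Re (cinner x x)) are then inherited from real_inner. *)
class chilbert_space = real_inner + complete_space +
  fixes scaleC :: "complex \<Rightarrow> 'a \<Rightarrow> 'a"  (infixr \<open>*\<^sub>C\<close> 75)
    and cinner :: "'a \<Rightarrow> 'a \<Rightarrow> complex"
  assumes scaleC_add_right: "c *\<^sub>C (x + y) = c *\<^sub>C x + c *\<^sub>C y"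
    and scaleC_add_left: "(c + d) *\<^sub>C x = c *\<^sub>C x + d *\<^sub>C x"
    and scaleC_scaleC: "c *\<^sub>C (d *\<^sub>C x) = (c * d) *\<^sub>C x"
    and scaleR_scaleC: "r *\<^sub>R x = complex_of_real r *\<^sub>C x"
    and cinner_commute: "cinner x y = cnj (cinner y x)"
    and cinner_add_left: "cinner (x + y) z = cinner x z + cinner y z"
    and cinner_scaleC_left: "cinner (c *\<^sub>C x) y = c * cinner x y"
    and inner_Re_cinner: "inner x y = Re (cinner x y)"

instantiation complex :: chilbert_space
begin
definition scaleC_complex :: "complex \<Rightarrow> complex \<Rightarrow> complex"
  where "scaleC_complex c x = c * x"
definition cinner_complex :: "complex \<Rightarrow> complex \<Rightarrow> complex"
  where "cinner_complex x y = x * cnj y"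
instance
proof
  fix c d x y z :: complex and r :: real
  show "c *\<^sub>C (x + y) = c *\<^sub>C x + c *\<^sub>C y" "(c + d) *\<^sub>C x = c *\<^sub>C x + d *\<^sub>C x"
    "c *\<^sub>C (d *\<^sub>C x) = (c * d) *\<^sub>C x" "r *\<^sub>R x = complex_of_real r *\<^sub>C x"
    by (auto simp: scaleC_complex_def algebra_simps scaleR_conv_of_real)
  show "cinner x y = cnj (cinner y x)" "cinner (x + y) z = cinner x z + cinner y z"
    "cinner (c *\<^sub>C x) y = c * cinner x y" "inner x y = Re (cinner x y)"
    by (auto simp: scaleC_complex_def cinner_complex_def inner_complex_def algebra_simps)
qed
end

(* Bounded operators on H are the real bounded linear maps 'a \<Rightarrow>\<^sub>L 'a that
   commute with complex scalars. *)
definition clinear_op :: "('a::chilbert_space \<Rightarrow>\<^sub>L 'a) \<Rightarrow> bool"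
  where "clinear_op A \<longleftrightarrow> (\<forall>c x. A (c *\<^sub>C x) = c *\<^sub>C A x)"

definition qform :: "('a::chilbert_space \<Rightarrow>\<^sub>L 'a) \<Rightarrow> 'a \<Rightarrow> real"
  where "qform A f = Re (cinner (A f) f)"

definition Bplus :: "('a::chilbert_space \<Rightarrow>\<^sub>L 'a) set"
  where "Bplus = {A. clinear_op A \<and> (\<forall>x y. cinner (A x) y = cinner x (A y)) \<and> (\<forall>x. 0 \<le> qform A x)}"

definition ker :: "('a::chilbert_space \<Rightarrow>\<^sub>L 'a) \<Rightarrow> 'a set"
  where "ker A = {x. A x = 0}"

definition Bplus0 :: "('a::chilbert_space \<Rightarrow>\<^sub>L 'a) set"
  where "Bplus0 = {A \<in> Bplus. ker A = {0}}"

definition op_le :: "('a::chilbert_space \<Rightarrow>\<^sub>L 'a) \<Rightarrow> ('a \<Rightarrow>\<^sub>L 'a) \<Rightarrow> bool"  (infix \<open>\<preceq>\<close> 50)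
  where "A \<preceq> B \<longleftrightarrow> (\<forall>x. qform A x \<le> qform B x)"

definition positive_definite :: "('a::chilbert_space \<Rightarrow>\<^sub>L 'a) \<Rightarrow> bool"
  where "positive_definite A \<longleftrightarrow> (\<exists>m>0. \<forall>f. qform A f \<ge> m * (norm f)\<^sup>2)"

definition ocomp :: "'a::chilbert_space set \<Rightarrow> 'a set"
  where "ocomp S = {x. \<forall>y\<in>S. cinner x y = 0}"

(* Meant for closed complex subspaces K only. *)
definition proj :: "'a::chilbert_space set \<Rightarrow> ('a \<Rightarrow>\<^sub>L 'a)"
  where "proj K = (THE P :: 'a \<Rightarrow>\<^sub>L 'a. \<forall>x. P x \<in> K \<and> x - P x \<in> ocomp K)"

definition cadjoint :: "('a::chilbert_space \<Rightarrow>\<^sub>L 'a) \<Rightarrow> ('a \<Rightarrow>\<^sub>L 'a)"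
  where "cadjoint T = (THE S :: 'a \<Rightarrow>\<^sub>L 'a. \<forall>x y. cinner (T x) y = cinner x (S y))"

definition sqrt_op :: "('a::chilbert_space \<Rightarrow>\<^sub>L 'a) \<Rightarrow> ('a \<Rightarrow>\<^sub>L 'a)"
  where "sqrt_op A = (THE B. B \<in> Bplus \<and> B o\<^sub>L B = A)"

(* The pseudo-inverse of A^{1/2}; only meaningful for y in range (sqrt_op A). *)
definition inv_sqrt :: "('a::chilbert_space \<Rightarrow>\<^sub>L 'a) \<Rightarrow> 'a \<Rightarrow> 'a"
  where "inv_sqrt A y = (THE x. x \<in> closure (range A) \<and> sqrt_op A x = y)"

definition poly_op :: "real poly \<Rightarrow> ('a::chilbert_space \<Rightarrow>\<^sub>L 'a) \<Rightarrow> ('a \<Rightarrow>\<^sub>L 'a)"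
  where "poly_op p A = (\<Sum>i\<le>degree p. coeff p i *\<^sub>R (((o\<^sub>L) A ^^ i) id_blinfun))"

(* Continuous functional calculus for A in Bplus, whose spectrum lies in {0..norm A}:
   f(A) is the norm limit of p_n(A) whenever the polynomials p_n converge to f uniformly
   on {0..norm A}. *)
definition fun_calc :: "(real \<Rightarrow> real) \<Rightarrow> ('a::chilbert_space \<Rightarrow>\<^sub>L 'a) \<Rightarrow> ('a \<Rightarrow>\<^sub>L 'a)"
  where "fun_calc f A = (THE B. \<forall>p::nat \<Rightarrow> real poly.
    uniform_limit {0..norm A} (\<lambda>n. poly (p n)) f sequentially
      \<longrightarrow> (\<lambda>n. poly_op (p n) A) \<longlonglongrightarrow> B)"

(* The range of A^a for an arbitrary real exponent a.  For a > 0, A^a is given by the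
   functional calculus.  As for A^{-1/2}, a negative power A^{-b} is the Moore-Penrose
   pseudo-inverse of A^b, defined on ran A^b; consistently, A^0 is the orthogonal projection
   onto clos (ran A) (not the identity, unless A has trivial kernel). *)
definition ran_powr :: "('a::chilbert_space \<Rightarrow>\<^sub>L 'a) \<Rightarrow> real \<Rightarrow> 'a set"
  where "ran_powr A a =
   (if a > 0 then range (fun_calc (\<lambda>t. t powr a) A)
    else if a = 0 then range (proj (closure (range A)))
    else (\<lambda>y. THE x. x \<in> closure (range A) \<and> fun_calc (\<lambda>t. t powr (- a)) A x = y)
           ` range (fun_calc (\<lambda>t. t powr (- a)) A))"

definition par_sum :: "('a::chilbert_space \<Rightarrow>\<^sub>L 'a) \<Rightarrow> ('a \<Rightarrow>\<^sub>L 'a) \<Rightarrow> ('a \<Rightarrow>\<^sub>L 'a)"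
  where "par_sum X G = (THE P. P \<in> Bplus \<and>
    (\<forall>h. qform P h = Inf {qform X f + qform G g | f g. h = f + g}))"

definition mu :: "('a::chilbert_space \<Rightarrow>\<^sub>L 'a) \<Rightarrow> ('a \<Rightarrow>\<^sub>L 'a) \<Rightarrow> ('a \<Rightarrow>\<^sub>L 'a)"
  where "mu G X = X - par_sum X G"

definition tau :: "('a::chilbert_space \<Rightarrow>\<^sub>L 'a) \<Rightarrow> ('a \<Rightarrow>\<^sub>L 'a) \<Rightarrow> ('a \<Rightarrow>\<^sub>L 'a)"
  where "tau G X = (THE T :: 'a \<Rightarrow>\<^sub>L 'a. \<forall>f. (\<lambda>n. (mu G ^^ n) X f) \<longlonglongrightarrow> T f)"

definition contr :: "('a::chilbert_space \<Rightarrow>\<^sub>L 'a) \<Rightarrow> ('a \<Rightarrow>\<^sub>L 'a) \<Rightarrow> ('a \<Rightarrow>\<^sub>L 'a)"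
  where "contr G X = Blinfun (\<lambda>f. inv_sqrt (G + X) (sqrt_op X f))"

definition compact_op :: "('a::chilbert_space \<Rightarrow>\<^sub>L 'a) \<Rightarrow> bool"
  where "compact_op T \<longleftrightarrow> clinear_op T \<and> compact (closure (T ` cball 0 1))"

(* T is compact and the p-th powers of its singular values, i.e. of the positive eigenvalues
   of |T| = (T* T)^{1/2} counted with their (finite) complex multiplicities, are summable. *)
definition schatten :: "real \<Rightarrow> ('a::chilbert_space \<Rightarrow>\<^sub>L 'a) \<Rightarrow> bool"
  where "schatten p T \<longleftrightarrow> compact_op T \<and>
    (\<lambda>s. real (vector_space.dim scaleC {x. sqrt_op (cadjoint T o\<^sub>L T) x = s *\<^sub>R x}) * s powr p)
      summable_on {0<..}"

end

theory Submission
  imports Defs "HOL-Computational_Algebra.Fundamental_Theorem_Algebra"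
begin

text \<open>
  The proof passes to the coordinates of the sum \<open>S = G + X\<close>. Since \<open>X\<close> lies below \<open>S\<close>, Douglas
  factorization gives \<open>sqrt X = sqrt S T\<close> with a contraction \<open>T\<close>, and \<open>K = T T*\<close> turns both
  operators into functions of one: \<open>X = sqrt S K sqrt S\<close> and \<open>G = sqrt S (1 - K) sqrt S\<close> (\<open>X_coordinates\<close>,
  \<open>G_coordinates\<close>). In these coordinates the parallel sum is given by the scalar formula
  \<open>a b / (a + b)\<close>, applied through the functional calculus of \<open>K\<close> (\<open>par_sum_coordinates\<close>).
  Hence the iterates of \<open>mu G\<close> are \<open>sqrt S f\<^sub>n(K) sqrt S\<close>, where \<open>f\<^sub>0(t) = t\<close> and
  \<open>f\<^sub>n\<^sub>+\<^sub>1 = f\<^sub>n\<^sup>2 / (f\<^sub>n + 1 - t)\<close>. As \<open>f\<^sub>n(1) = 1\<close> and \<open>0 \<le> f\<^sub>n(t) \<le> t\<^sup>n\<^sup>+\<^sup>1\<close> on the unit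
  interval, \<open>f\<^sub>n(K)\<close> tends strongly to the orthogonal projection onto \<open>ker (1 - K)\<close>, and
  \<open>tau G X = sqrt S P sqrt S\<close> with that projection \<open>P\<close> (\<open>tau_coordinates\<close>).

  Because the range of \<open>sqrt G\<close> is the range of \<open>sqrt S sqrt (1 - K)\<close>, the space \<open>ker (1 - K)\<close> is the
  orthogonal complement of the vectors that \<open>sqrt S\<close> maps into the range of \<open>sqrt G\<close>
  (\<open>ker_Kop_eq\<close>). Moving the projection through \<open>T\<close> yields the formula that carries the rest
  (\<open>tau_eq_form\<close>): \<open>tau G X = sqrt X P sqrt X\<close>, where \<open>P\<close> projects onto the complement of
  \<open>{g. sqrt X g \<in> range (sqrt G)}\<close>. It depends on \<open>G\<close> only through the range of \<open>sqrt G\<close>, and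
  larger ranges give smaller operators. It also shows that the ranges of \<open>sqrt (tau G X)\<close> and
  \<open>sqrt G\<close> meet only in \<open>0\<close>, hence that \<open>tau G X\<close> and \<open>G\<close> have zero parallel sum. The formula in
  terms of \<open>S\<close> and the formula in terms of \<open>X\<close>, the latter applied to \<open>S\<close> itself, agree, so
  \<open>tau G (G + X) = tau G X\<close>. The criteria for injectivity of \<open>tau G X\<close> all translate one condition on
  an injective \<open>X\<close>: only for \<open>f = 0\<close> does \<open>sqrt X f\<close> lie in the closure of
  \<open>{g. sqrt X g \<in> range (sqrt G)}\<close>.

  Two points need more. If \<open>sqrt X\<close> has the range of a power \<open>G\<^sup>a\<close> with \<open>0 < a < 1/2\<close>, uniform
  boundedness turns the equality of ranges into a factorization \<open>G\<^sup>a = sqrt X Y\<close>, and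
  \<open>sqrt G = G\<^sup>a G\<^sup>b\<close> with \<open>b = 1/2 - a > 0\<close> shows that the projection in the formula vanishes
  (\<open>tau_eq_0_of_factor\<close>); for \<open>a \<le> 0\<close> the projection onto the closure of the range of \<open>G\<close> takes
  the place of \<open>G\<^sup>a\<close>. For compact \<open>X\<close> only \<open>tau G X \<le> X\<close> is used: the powers of the eigenvalues of
  a dominated operator are summed by Jensen's inequality in an eigenbasis of \<open>X\<close>
  (\<open>powr_sum_le_trace\<close>).

  Square roots, projections, adjoints and the functional calculus are built with the real inner
  product. Complex linearity comes afterwards: for projections and adjoints from uniqueness, for
  square roots and the functional calculus because they commute with everything that commutes with
  the given operator, in particular with complex scalars.
\<close>

class real_hilbert = real_inner + complete_space

instance real_hilbert \<subseteq> banach ..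
instance chilbert_space \<subseteq> real_hilbert ..

section \<open>Real Hilbert spaces: Riesz representation, adjoints and factorization\<close>

text \<open>The functional is represented by the limit of a minimizing sequence of \<open>norm k ^ 2 - 2 * \<phi> k\<close>
  over \<open>K\<close>; the parallelogram identity makes such a sequence Cauchy. Working on a subspace, not
  necessarily closed, covers orthogonal projections, adjoints and Douglas factorization at once.\<close>

lemma riesz_on_subspace:
  fixes K :: "'a::real_hilbert set" and \<phi> :: "'a \<Rightarrow> real"
  assumes K: "subspace K" and c: "0 \<le> c"
    and add: "\<And>x y. x \<in> K \<Longrightarrow> y \<in> K \<Longrightarrow> \<phi> (x + y) = \<phi> x + \<phi> y"
    and scale: "\<And>a x. x \<in> K \<Longrightarrow> \<phi> (a *\<^sub>R x) = a * \<phi> x"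
    and bound: "\<And>x. x \<in> K \<Longrightarrow> \<bar>\<phi> x\<bar> \<le> c * norm x"
  obtains z where "z \<in> closure K" "norm z \<le> c" "\<And>x. x \<in> K \<Longrightarrow> \<phi> x = x \<bullet> z"
proof -
  define J where "J k = (norm k)\<^sup>2 - 2 * \<phi> k" for k
  define d where "d = Inf (J ` K)"
  have K0: "0 \<in> K" using K by (simp add: subspace_0)
  have lower: "- c\<^sup>2 \<le> J k" if "k \<in> K" for k
  proof -
    have "0 \<le> (norm k - c)\<^sup>2" by simp
    then have "- c\<^sup>2 \<le> (norm k)\<^sup>2 - 2 * (c * norm k)" by (simp add: power2_diff algebra_simps)
    also have "\<dots> \<le> J k" using bound[OF that] by (simp add: J_def)
    finally show ?thesis .
  qed
  have bdd: "bdd_below (J ` K)" using lower by (auto simp: bdd_below_def)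
  have d_le: "d \<le> J k" if "k \<in> K" for k
    unfolding d_def using bdd that by (rule cINF_lower)
  have "\<exists>k\<in>K. J k < d + 1 / real (Suc n)" for n
    using cInf_lessD[of "J ` K" "d + 1 / real (Suc n)"] K0 d_def by auto
  then obtain k where k: "\<And>n. k n \<in> K" "\<And>n. J (k n) < d + 1 / real (Suc n)" by metis
  have para: "(norm (a - b))\<^sup>2 \<le> 2 * (J a - d) + 2 * (J b - d)" if "a \<in> K" "b \<in> K" for a b
  proof -
    have ab: "a + b \<in> K" using K that by (simp add: subspace_add)
    then have h: "(1/2) *\<^sub>R (a + b) \<in> K" using K by (rule subspace_scale[rotated])
    have "J ((1/2) *\<^sub>R (a + b)) = (norm (a + b))\<^sup>2 / 4 - (\<phi> a + \<phi> b)"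
      using scale[OF ab, of "1/2"] add[OF that] by (simp add: J_def power_mult_distrib power_divide)
    also have "\<dots> = (J a + J b) / 2 - (norm (a - b))\<^sup>2 / 4"
      by (simp add: J_def power2_norm_eq_inner inner_add inner_diff inner_commute field_simps)
    finally show ?thesis using d_le[OF h] by (simp add: field_simps)
  qed
  have "Cauchy k"
  proof (rule metric_CauchyI)
    fix e :: real assume "0 < e"
    then obtain N where N: "4 / e\<^sup>2 < real (Suc N)"
      by (metis less_Suc_eq of_nat_less_iff order.strict_trans reals_Archimedean2)
    then have N': "4 / real (Suc N) < e\<^sup>2" using \<open>0 < e\<close> by (simp add: field_simps)
    have J': "J (k m) - d \<le> 1 / real (Suc N)" if "m \<ge> N" for m
    proof -
      have "1 / real (Suc m) \<le> 1 / real (Suc N)" using that by (intro divide_left_mono) auto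
      then show ?thesis using k(2)[of m] by linarith
    qed
    have "dist (k m) (k n) < e" if "m \<ge> N" "n \<ge> N" for m n
    proof -
      have "(norm (k m - k n))\<^sup>2 \<le> 4 / real (Suc N)"
        using para[OF k(1) k(1), of m n] J'[OF that(1)] J'[OF that(2)] by simp
      then have "(norm (k m - k n))\<^sup>2 < e\<^sup>2" using N' by linarith
      then show ?thesis using \<open>0 < e\<close> by (simp add: dist_norm power_less_imp_less_base)
    qed
    then show "\<exists>M. \<forall>m\<ge>M. \<forall>n\<ge>M. dist (k m) (k n) < e" by blast
  qed
  then obtain z where z: "k \<longlonglongrightarrow> z" using Cauchy_convergent convergent_def by blast
  have zK: "z \<in> closure K" unfolding closure_sequential using k(1) z by blast
  have rep: "\<phi> h = h \<bullet> z" if h: "h \<in> K" for h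
  proof -
    have q: "0 \<le> 2 * t * (z \<bullet> h - \<phi> h) + t\<^sup>2 * (norm h)\<^sup>2" for t
    proof (rule LIMSEQ_le[where X="\<lambda>n. - (1 / real (Suc n))"])
      show "(\<lambda>n. - (1 / real (Suc n))) \<longlonglongrightarrow> 0"
        using tendsto_minus[OF LIMSEQ_inverse_real_of_nat] by (simp add: inverse_eq_divide)
      show "(\<lambda>n. 2 * t * (k n \<bullet> h - \<phi> h) + t\<^sup>2 * (norm h)\<^sup>2)
          \<longlonglongrightarrow> 2 * t * (z \<bullet> h - \<phi> h) + t\<^sup>2 * (norm h)\<^sup>2"
        by (intro tendsto_intros z)
      have "- (1 / real (Suc n)) \<le> 2 * t * (k n \<bullet> h - \<phi> h) + t\<^sup>2 * (norm h)\<^sup>2" for n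
      proof -
        have th: "t *\<^sub>R h \<in> K" using K h by (simp add: subspace_scale)
        then have "d \<le> J (k n + t *\<^sub>R h)" using K k(1) by (intro d_le) (simp add: subspace_add)
        also have "\<dots> = J (k n) + (2 * t * (k n \<bullet> h - \<phi> h) + t\<^sup>2 * (norm h)\<^sup>2)"
          unfolding J_def add[OF k(1) th] scale[OF h] power2_norm_eq_inner
          by (simp add: inner_add inner_commute power2_eq_square algebra_simps)
        finally show ?thesis using k(2)[of n] by linarith
      qed
      then show "\<exists>N. \<forall>n\<ge>N. - (1 / real (Suc n)) \<le> 2 * t * (k n \<bullet> h - \<phi> h) + t\<^sup>2 * (norm h)\<^sup>2"
        by blast
    qed
    define a where "a = z \<bullet> h - \<phi> h"
    have "a = 0"
    proof (cases "norm h = 0")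
      case True
      then have "h = 0" by simp
      moreover have "\<phi> h = 0" using scale[OF h, of 0] \<open>h = 0\<close> by simp
      ultimately show ?thesis by (simp add: a_def)
    next
      case False
      \<comment> \<open>The minimum of the quadratic in \<open>t\<close> is at \<open>t = - a / (norm h)\<^sup>2\<close>.\<close>
      have "0 \<le> 2 * (- a / (norm h)\<^sup>2) * a + (- a / (norm h)\<^sup>2)\<^sup>2 * (norm h)\<^sup>2"
        using q unfolding a_def by blast
      also have "\<dots> = - (a\<^sup>2 / (norm h)\<^sup>2)" using False by (simp add: field_simps power2_eq_square)
      finally show ?thesis using False by (simp add: divide_le_0_iff)
    qed
    then show ?thesis by (simp add: a_def inner_commute)
  qed
  have "norm z \<le> c"
  proof -
    have "(\<lambda>n. k n \<bullet> z) \<longlonglongrightarrow> z \<bullet> z" "(\<lambda>n. c * norm (k n)) \<longlonglongrightarrow> c * norm z"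
      by (intro tendsto_intros z)+
    moreover have "k n \<bullet> z \<le> c * norm (k n)" for n
      using bound[OF k(1), of n] rep[OF k(1), of n] by linarith
    ultimately have "z \<bullet> z \<le> c * norm z" by (intro LIMSEQ_le) blast+
    then have "norm z * norm z \<le> c * norm z" by (simp add: power2_norm_eq_inner[symmetric] power2_eq_square)
    then show ?thesis using c mult_right_le_imp_le[of "norm z" "norm z" c] by (cases "z = 0") auto
  qed
  then show thesis using that zK rep by blast
qed

lemma subspace_closure:
  fixes K :: "'a::real_normed_vector set"
  assumes "subspace K"
  shows "subspace (closure K)"
proof -
  have "x + y \<in> closure K" if xy: "x \<in> closure K" "y \<in> closure K" for x y
  proof -
    obtain u v where "\<And>n. u n \<in> K" "u \<longlonglongrightarrow> x" "\<And>n. v n \<in> K" "v \<longlonglongrightarrow> y"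
      using xy by (auto simp: closure_sequential)
    then show ?thesis unfolding closure_sequential
      using assms by (intro exI[of _ "\<lambda>n. u n + v n"]) (auto simp: subspace_add intro: tendsto_add)
  qed
  moreover have "c *\<^sub>R x \<in> closure K" if x: "x \<in> closure K" for c x
  proof -
    obtain u where "\<And>n. u n \<in> K" "u \<longlonglongrightarrow> x" using x by (auto simp: closure_sequential)
    then show ?thesis unfolding closure_sequential
      using assms by (intro exI[of _ "\<lambda>n. c *\<^sub>R u n"]) (auto simp: subspace_scale intro: tendsto_intros)
  qed
  moreover have "0 \<in> closure K" using assms closure_subset subspace_0 by blast
  ultimately show ?thesis by (simp add: subspace_def)
qed

lemma ex_orthogonal_decomposition:
  fixes K :: "'a::real_hilbert set"
  assumes "subspace K" "closed K"
  shows "\<exists>p\<in>K. \<forall>y\<in>K. (x - p) \<bullet> y = 0"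
proof -
  obtain z where "z \<in> closure K" "\<And>y. y \<in> K \<Longrightarrow> y \<bullet> x = y \<bullet> z"
  proof (rule riesz_on_subspace[OF assms(1) norm_ge_zero[of x], where \<phi>="\<lambda>y. y \<bullet> x"])
    show "\<bar>y \<bullet> x\<bar> \<le> norm x * norm y" for y
      using Cauchy_Schwarz_ineq2[of y x] by (simp add: mult.commute)
  qed (auto simp: inner_add)
  then show ?thesis using assms(2) by (auto simp: inner_diff inner_commute intro!: bexI[of _ z])
qed

text \<open>The bipolar form of density: the residual of \<open>x\<close> after projection onto \<open>closure K\<close> is
  orthogonal to \<open>K\<close>, hence to \<open>x\<close>.\<close>

lemma in_closure_of_orthogonal:
  fixes K :: "'a::real_hilbert set"
  assumes K: "subspace K" and x: "\<And>y. (\<And>k. k \<in> K \<Longrightarrow> k \<bullet> y = 0) \<Longrightarrow> x \<bullet> y = 0"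
  shows "x \<in> closure K"
proof -
  have "subspace (closure K)" using K by (rule subspace_closure)
  then obtain p where p: "p \<in> closure K" "\<And>y. y \<in> closure K \<Longrightarrow> (x - p) \<bullet> y = 0"
    using ex_orthogonal_decomposition[of "closure K" x] by auto
  then have "x \<bullet> (x - p) = 0" using closure_subset[of K] by (intro x) (auto simp: inner_commute)
  moreover have "p \<bullet> (x - p) = 0" using p by (simp add: inner_commute)
  ultimately have "(x - p) \<bullet> (x - p) = 0" by (simp add: inner_diff_left)
  then show ?thesis using p(1) by simp
qed

lemma orthogonal_closure:
  fixes K :: "'a::real_inner set"
  assumes "\<And>k. k \<in> K \<Longrightarrow> k \<bullet> y = 0" "x \<in> closure K"
  shows "x \<bullet> y = 0"
proof -
  have "closed {k. k \<bullet> y = 0}" by (intro closed_Collect_eq continuous_intros)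
  then have "closure K \<subseteq> {k. k \<bullet> y = 0}" using assms(1) by (intro closure_minimal) auto
  then show ?thesis using assms(2) by auto
qed

text \<open>For fixed \<open>y\<close> the functional \<open>B f \<mapsto> A f \<bullet> y\<close> is well defined and bounded on \<open>range B\<close>, and
  \<open>T y\<close> represents it; \<open>B = id_blinfun\<close> gives the adjoint of \<open>A\<close>. Values in the closure of \<open>range B\<close>
  make \<open>T\<close> unique, hence linear.\<close>

lemma ex_transpose_factor:
  fixes A B :: "'a::real_hilbert \<Rightarrow>\<^sub>L 'a"
  assumes c: "0 \<le> c" and le: "\<And>f. norm (A f) \<le> c * norm (B f)"
  obtains T :: "'a \<Rightarrow>\<^sub>L 'a" where "\<And>f y. A f \<bullet> y = B f \<bullet> T y" "norm T \<le> c"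
    "\<And>y. T y \<in> closure (range B)"
proof -
  have sub: "subspace (range B)"
    by (intro linear_subspace_image) (auto intro: bounded_linear.linear blinfun.bounded_linear_right)
  have wd: "A f = A g" if "B f = B g" for f g
    using le[of "f - g"] that by (simp add: blinfun.diff_right)
  have "\<exists>z. z \<in> closure (range B) \<and> norm z \<le> c * norm y \<and> (\<forall>f. A f \<bullet> y = B f \<bullet> z)" for y
  proof -
    define g where "g b = (SOME f. B f = b)" for b
    have g: "A (g (B f)) = A f" for f
    proof -
      have "B (g (B f)) = B f" unfolding g_def by (rule someI) simp
      then show ?thesis by (rule wd)
    qed
    obtain z where z: "z \<in> closure (range B)" "norm z \<le> c * norm y"
      "\<And>x. x \<in> range B \<Longrightarrow> A (g x) \<bullet> y = x \<bullet> z"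
    proof (rule riesz_on_subspace[OF sub, where \<phi>="\<lambda>b. A (g b) \<bullet> y" and c="c * norm y"])
      show "0 \<le> c * norm y" using c by simp
      show "A (g (x + x')) \<bullet> y = A (g x) \<bullet> y + A (g x') \<bullet> y"
        if "x \<in> range B" "x' \<in> range B" for x x'
        using that g by (auto simp: blinfun.add_right[symmetric] inner_add) (simp add: blinfun.add_right inner_add)
      show "A (g (a *\<^sub>R x)) \<bullet> y = a * (A (g x) \<bullet> y)" if "x \<in> range B" for a x
        using that g by (auto simp: blinfun.scaleR_right[symmetric]) (simp add: blinfun.scaleR_right)
      show "\<bar>A (g x) \<bullet> y\<bar> \<le> c * norm y * norm x" if x: "x \<in> range B" for x
      proof -
        obtain f where f: "x = B f" using x by auto
        have "\<bar>A f \<bullet> y\<bar> \<le> norm (A f) * norm y" by (rule Cauchy_Schwarz_ineq2)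
        also have "\<dots> \<le> c * norm (B f) * norm y" using le[of f] by (intro mult_right_mono) auto
        finally show ?thesis using f g by (simp add: mult_ac)
      qed
    qed blast
    have "A f \<bullet> y = B f \<bullet> z" for f using z(3)[of "B f"] g[of f] by simp
    then show ?thesis using z(1,2) by (intro exI[of _ z]) simp
  qed
  then obtain t where t: "\<And>y. t y \<in> closure (range B)" "\<And>y. norm (t y) \<le> c * norm y"
    "\<And>f y. A f \<bullet> y = B f \<bullet> t y" by metis
  have subc: "subspace (closure (range B))" using sub by (rule subspace_closure)
  have uniq: "u = v" if "u \<in> closure (range B)" "v \<in> closure (range B)" "\<And>f. B f \<bullet> u = B f \<bullet> v" for u v
  proof -
    have "u - v \<in> closure (range B)" using subc that by (simp add: subspace_diff)
    moreover have "k \<bullet> (u - v) = 0" if "k \<in> range B" for k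
      using that \<open>\<And>f. B f \<bullet> u = B f \<bullet> v\<close> by (auto simp: inner_diff)
    ultimately have "(u - v) \<bullet> (u - v) = 0" using orthogonal_closure by blast
    then show ?thesis by simp
  qed
  have "bounded_linear t"
  proof (rule bounded_linear_intro[where K=c])
    show "t (x + y) = t x + t y" for x y
      using subc t by (intro uniq) (auto simp: subspace_add inner_add simp flip: t(3))
    show "t (a *\<^sub>R x) = a *\<^sub>R t x" for a x
      using subc t by (intro uniq) (auto simp: subspace_scale simp flip: t(3))
    show "norm (t x) \<le> norm x * c" for x using t(2) by (simp add: mult.commute)
  qed
  then have "blinfun_apply (Blinfun t) = t" by (rule bounded_linear_Blinfun_apply)
  then show thesis using t c by (intro that[of "Blinfun t"]) (auto intro: norm_blinfun_bound)
qed

definition adj :: "('a::real_hilbert \<Rightarrow>\<^sub>L 'a) \<Rightarrow> ('a \<Rightarrow>\<^sub>L 'a)"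
  where "adj T = (THE S :: 'a \<Rightarrow>\<^sub>L 'a. \<forall>x y. T x \<bullet> y = x \<bullet> S y)"

lemma inner_ext: "(\<And>x. x \<bullet> u = x \<bullet> v) \<Longrightarrow> u = v" for u v :: "'a::real_inner"
  using inner_eq_zero_iff[of "u - v"] by (simp add: inner_diff_right)

lemma adj_eqI:
  fixes T S :: "'a::real_hilbert \<Rightarrow>\<^sub>L 'a"
  assumes "\<And>x y. T x \<bullet> y = x \<bullet> S y"
  shows "adj T = S"
  unfolding adj_def
proof (rule the_equality)
  show "S' = S" if "\<forall>x y. T x \<bullet> y = x \<bullet> S' y" for S' :: "'a \<Rightarrow>\<^sub>L 'a"
  proof (rule blinfun_eqI, rule inner_ext)
    show "x \<bullet> S' y = x \<bullet> S y" for x y using assms[of x y] that by simp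
  qed
qed (use assms in auto)

lemma inner_adj: "T x \<bullet> y = x \<bullet> adj T y" for T :: "'a::real_hilbert \<Rightarrow>\<^sub>L 'a"
proof -
  obtain S :: "'a \<Rightarrow>\<^sub>L 'a" where "\<And>f y. T f \<bullet> y = id_blinfun f \<bullet> S y"
    by (rule ex_transpose_factor[of "norm T" T id_blinfun]) (auto simp: norm_blinfun)
  then have S: "T f \<bullet> y = f \<bullet> S y" for f y by simp
  then have "adj T = S" by (rule adj_eqI)
  then show ?thesis using S by simp
qed

lemma inner_adj': "adj T x \<bullet> y = x \<bullet> T y"
  using inner_adj[of T y x] by (simp add: inner_commute)

lemma adj_adj [simp]: "adj (adj T) = T" for T :: "'a::real_hilbert \<Rightarrow>\<^sub>L 'a"
  by (intro adj_eqI inner_adj')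

text \<open>Douglas factorization. the vector \<open>T y\<close> represents the functional \<open>adj B f \<mapsto> adj A f \<bullet> y\<close>,
  which is well defined and bounded because \<open>adj B\<close> dominates \<open>adj A\<close>.\<close>

lemma douglas:
  fixes A B :: "'a::real_hilbert \<Rightarrow>\<^sub>L 'a"
  assumes "0 \<le> c" and "\<And>f. norm (adj A f) \<le> c * norm (adj B f)"
  obtains T where "A = B o\<^sub>L T" "norm T \<le> c" "\<And>y. T y \<in> closure (range (adj B))"
proof -
  obtain T :: "'a \<Rightarrow>\<^sub>L 'a" where T: "\<And>f y. adj A f \<bullet> y = adj B f \<bullet> T y" "norm T \<le> c"
    "\<And>y. T y \<in> closure (range (adj B))"
    by (rule ex_transpose_factor[OF assms]) blast
  have "A y = B (T y)" for y
  proof (rule inner_ext)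
    show "x \<bullet> A y = x \<bullet> B (T y)" for x
      using T(1)[of x y] by (simp only: inner_adj')
  qed
  then have "A = B o\<^sub>L T" by (intro blinfun_eqI) simp
  then show thesis using T by (intro that)
qed

section \<open>Symmetric and positive operators\<close>

definition symop :: "('a::real_inner \<Rightarrow>\<^sub>L 'a) \<Rightarrow> bool"
  where "symop A \<longleftrightarrow> (\<forall>x y. A x \<bullet> y = x \<bullet> A y)"

definition posop :: "('a::real_inner \<Rightarrow>\<^sub>L 'a) \<Rightarrow> bool"
  where "posop A \<longleftrightarrow> symop A \<and> (\<forall>x. 0 \<le> A x \<bullet> x)"

lemma symopD: "symop A \<Longrightarrow> A x \<bullet> y = x \<bullet> A y"
  by (simp add: symop_def)

lemma symop_adj: "symop A \<longleftrightarrow> adj A = A"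
proof
  show "adj A = A" if "symop A" using that by (intro adj_eqI) (simp add: symop_def)
  show "symop A" if "adj A = A" using inner_adj[of A] that by (simp add: symop_def)
qed

lemma posop_symop: "posop A \<Longrightarrow> symop A" and posop_nonneg: "posop A \<Longrightarrow> 0 \<le> A x \<bullet> x"
  by (auto simp: posop_def)

lemma symop_arith:
  "symop id_blinfun" "symop 0" "symop A \<Longrightarrow> symop B \<Longrightarrow> symop (A + B)"
  "symop A \<Longrightarrow> symop B \<Longrightarrow> symop (A - B)" "symop A \<Longrightarrow> symop (c *\<^sub>R A)"
  "symop A \<Longrightarrow> symop B \<Longrightarrow> A o\<^sub>L B = B o\<^sub>L A \<Longrightarrow> symop (A o\<^sub>L B)"
proof -
  show "symop (A o\<^sub>L B)" if "symop A" "symop B" "A o\<^sub>L B = B o\<^sub>L A"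
  proof -
    have "A (B x) = B (A x)" for x using that(3) by (metis blinfun_apply_blinfun_compose)
    then show ?thesis using that(1,2) by (simp add: symop_def)
  qed
qed (auto simp: symop_def blinfun.bilinear_simps inner_add inner_diff)

lemma posop_arith:
  "posop id_blinfun" "posop 0" "posop A \<Longrightarrow> posop B \<Longrightarrow> posop (A + B)"
  "posop A \<Longrightarrow> 0 \<le> c \<Longrightarrow> posop (c *\<^sub>R A)"
  by (auto simp: posop_def symop_arith blinfun.bilinear_simps inner_add)

lemma posop_sandwich:
  assumes "posop A" "symop B"
  shows "posop (B o\<^sub>L A o\<^sub>L B)"
proof -
  have "(B o\<^sub>L A o\<^sub>L B) x \<bullet> y = A (B x) \<bullet> B y" for x y
    using assms(2) by (simp add: symop_def)
  moreover have "x \<bullet> (B o\<^sub>L A o\<^sub>L B) y = B x \<bullet> A (B y)" for x y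
    using assms(2) by (simp add: symop_def)
  ultimately show ?thesis
    using symopD[OF posop_symop[OF assms(1)]] posop_nonneg[OF assms(1)]
    unfolding posop_def symop_def by simp
qed

lemma posop_square: "symop B \<Longrightarrow> posop (B o\<^sub>L B)"
  using symop_arith(6)[of B B] symopD[of B "B x" x for x] by (simp add: posop_def)

lemma form_Cauchy_Schwarz:
  assumes "posop A"
  shows "(A x \<bullet> y)\<^sup>2 \<le> (A x \<bullet> x) * (A y \<bullet> y)"
proof -
  have q: "0 \<le> A y \<bullet> y * t\<^sup>2 + 2 * (A x \<bullet> y) * t + A x \<bullet> x" for t
  proof -
    have "A y \<bullet> x = A x \<bullet> y" using posop_symop[OF assms] by (metis inner_commute symop_def)
    then have "A (x + t *\<^sub>R y) \<bullet> (x + t *\<^sub>R y) = A y \<bullet> y * t\<^sup>2 + 2 * (A x \<bullet> y) * t + A x \<bullet> x"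
      by (simp add: blinfun.bilinear_simps inner_add power2_eq_square algebra_simps)
    then show ?thesis using posop_nonneg[OF assms] by metis
  qed
  show ?thesis
  proof (cases "A y \<bullet> y = 0")
    case True
    have "A x \<bullet> y = 0"
    proof (rule ccontr)
      assume ne: "A x \<bullet> y \<noteq> 0"
      then show False using q[of "(- A x \<bullet> x - 1) / (2 * (A x \<bullet> y))"] True by (simp add: field_simps)
    qed
    then show ?thesis using True by simp
  next
    case False
    then have pos: "0 < A y \<bullet> y" using posop_nonneg[OF assms, of y] by linarith
    have "0 \<le> A y \<bullet> y * (- (A x \<bullet> y) / (A y \<bullet> y))\<^sup>2 + 2 * (A x \<bullet> y) * (- (A x \<bullet> y) / (A y \<bullet> y)) + A x \<bullet> x"
      by (rule q)
    also have "\<dots> = A x \<bullet> x - (A x \<bullet> y)\<^sup>2 / (A y \<bullet> y)"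
      using False by (simp add: field_simps power2_eq_square)
    finally show ?thesis using pos by (simp add: field_simps)
  qed
qed

text \<open>The form Cauchy-Schwarz inequality with \<open>y = A x\<close>: a positive operator is controlled
  by any upper bound \<open>m\<close> of its form.\<close>

lemma posop_norm_sq_le:
  assumes "posop A" and m: "\<And>x. A x \<bullet> x \<le> m * (norm x)\<^sup>2"
  shows "(norm (A x))\<^sup>2 \<le> m * (A x \<bullet> x)"
proof (cases "A x = 0")
  case False
  have "((norm (A x))\<^sup>2)\<^sup>2 \<le> (A x \<bullet> x) * (A (A x) \<bullet> A x)"
    using form_Cauchy_Schwarz[OF assms(1), of x "A x"] by (simp add: power2_norm_eq_inner)
  also have "\<dots> \<le> (A x \<bullet> x) * (m * (norm (A x))\<^sup>2)"
    using m posop_nonneg[OF assms(1)] by (intro mult_left_mono) auto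
  finally have "(norm (A x))\<^sup>2 * (norm (A x))\<^sup>2 \<le> (m * (A x \<bullet> x)) * (norm (A x))\<^sup>2"
    by (simp add: power2_eq_square mult_ac)
  moreover have "0 < (norm (A x))\<^sup>2" using False by simp
  ultimately show ?thesis using mult_right_le_imp_le by blast
qed simp

lemma inner_le_norm_op: "A x \<bullet> x \<le> norm A * (norm x)\<^sup>2" for A :: "'a::real_inner \<Rightarrow>\<^sub>L 'a"
proof -
  have "A x \<bullet> x \<le> norm (A x) * norm x" by (rule norm_cauchy_schwarz)
  also have "\<dots> \<le> norm A * norm x * norm x" using norm_blinfun[of A x] by (intro mult_right_mono) auto
  finally show ?thesis by (simp add: power2_eq_square mult_ac)
qed

lemma posop_zero_form: "posop A \<Longrightarrow> A x \<bullet> x = 0 \<Longrightarrow> A x = 0"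
  using posop_norm_sq_le[of A "norm A" x] inner_le_norm_op[of A] by auto

lemma posop_norm_le:
  assumes "posop A" "\<And>x. A x \<bullet> x \<le> m * (norm x)\<^sup>2" "0 \<le> m"
  shows "norm A \<le> m"
proof (rule norm_blinfun_bound[OF assms(3)])
  fix x
  have "(norm (A x))\<^sup>2 \<le> m * (m * (norm x)\<^sup>2)"
    using posop_norm_sq_le[OF assms(1,2)] mult_left_mono[OF assms(2,3)] order_trans by blast
  then have "(norm (A x))\<^sup>2 \<le> (m * norm x)\<^sup>2" by (simp add: power2_eq_square mult_ac)
  then show "norm (A x) \<le> m * norm x" 
    by (rule power2_le_imp_le) (use assms(3) in simp)
qed

lemma closure_range_symop_iff:
  fixes A :: "'a::real_hilbert \<Rightarrow>\<^sub>L 'a"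
  assumes "symop A"
  shows "x \<in> closure (range A) \<longleftrightarrow> (\<forall>y. A y = 0 \<longrightarrow> x \<bullet> y = 0)"
proof
  assume x: "x \<in> closure (range A)"
  show "\<forall>y. A y = 0 \<longrightarrow> x \<bullet> y = 0"
  proof (intro allI impI)
    fix y assume "A y = 0"
    then have "k \<bullet> y = 0" if "k \<in> range A" for k
      using that assms by (auto simp: symopD)
    then show "x \<bullet> y = 0" using x by (rule orthogonal_closure)
  qed
next
  assume *: "\<forall>y. A y = 0 \<longrightarrow> x \<bullet> y = 0"
  show "x \<in> closure (range A)"
  proof (rule in_closure_of_orthogonal)
    show "subspace (range A)"
      by (intro linear_subspace_image) (auto intro: bounded_linear.linear blinfun.bounded_linear_right)
    fix y assume "\<And>k. k \<in> range A \<Longrightarrow> k \<bullet> y = 0"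
    then have "z \<bullet> A y = 0" for z using symopD[OF assms, of z y] by simp
    then have "A y = 0" by (metis inner_eq_zero_iff)
    then show "x \<bullet> y = 0" using * by blast
  qed
qed

section \<open>The positive square root\<close>

lemma compose_assoc: "(A o\<^sub>L B) o\<^sub>L C = A o\<^sub>L (B o\<^sub>L C)"
  by (rule blinfun_eqI) simp

lemmas compose_tendsto = bounded_bilinear.tendsto[OF bounded_bilinear_blinfun_compose]
lemmas compose_bilinear =
  bounded_bilinear.add_left[OF bounded_bilinear_blinfun_compose]
  bounded_bilinear.add_right[OF bounded_bilinear_blinfun_compose]
  bounded_bilinear.diff_left[OF bounded_bilinear_blinfun_compose]
  bounded_bilinear.diff_right[OF bounded_bilinear_blinfun_compose]
  bounded_bilinear.scaleR_left[OF bounded_bilinear_blinfun_compose]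
  bounded_bilinear.scaleR_right[OF bounded_bilinear_blinfun_compose]
  bounded_bilinear.zero_left[OF bounded_bilinear_blinfun_compose]
  bounded_bilinear.zero_right[OF bounded_bilinear_blinfun_compose]

text \<open>The operator \<open>Y = 1 - sqrt (1 - B)\<close> as the limit of \<open>Y \<mapsto> (B + Y Y) / 2\<close>. The same recursion for
  the number \<open>norm B\<close> majorizes the increments in norm; being increasing and bounded by \<open>1\<close> it
  converges, so the operators converge in norm.\<close>

lemma ex_sqrt_contraction:
  fixes B :: "'a::real_hilbert \<Rightarrow>\<^sub>L 'a"
  assumes sym: "symop B" and B1: "norm B \<le> 1"
  obtains Y :: "'a \<Rightarrow>\<^sub>L 'a" where "symop Y" "norm Y \<le> 1" "2 *\<^sub>R Y = B + (Y o\<^sub>L Y)"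
    "\<And>C. C o\<^sub>L B = B o\<^sub>L C \<Longrightarrow> C o\<^sub>L Y = Y o\<^sub>L C"
proof -
  define Y where "Y = rec_nat (0::'a \<Rightarrow>\<^sub>L 'a) (\<lambda>_ Z. (1/2) *\<^sub>R (B + (Z o\<^sub>L Z)))"
  define y where "y = rec_nat (0::real) (\<lambda>_ z. (1/2) * (norm B + z * z))"
  have Y0: "Y 0 = 0" and YS: "Y (Suc n) = (1/2) *\<^sub>R (B + (Y n o\<^sub>L Y n))" for n
    by (simp_all add: Y_def)
  have y0: "y 0 = 0" and yS: "y (Suc n) = (1/2) * (norm B + y n * y n)" for n
    by (simp_all add: y_def)
  have y_range: "0 \<le> y n \<and> y n \<le> 1" for n
  proof (induction n)
    case (Suc n)
    then have "y n * y n \<le> 1 * 1" by (intro mult_mono) auto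
    then show ?case using B1 by (simp add: yS)
  qed (simp add: y0)
  have comm: "C o\<^sub>L Y n = Y n o\<^sub>L C" if C: "C o\<^sub>L B = B o\<^sub>L C" for C n
  proof (induction n)
    case (Suc n)
    have "C o\<^sub>L (Y n o\<^sub>L Y n) = (Y n o\<^sub>L Y n) o\<^sub>L C" using Suc by (metis compose_assoc)
    then show ?case
      using C by (simp add: YS compose_bilinear)
  qed (simp add: Y0)
  have normY: "norm (Y n) \<le> y n" for n
  proof (induction n)
    case (Suc n)
    have "norm (B + (Y n o\<^sub>L Y n)) \<le> norm B + norm (Y n) * norm (Y n)"
      using norm_triangle_ineq norm_blinfun_compose by (meson add_left_mono order_trans)
    also have "\<dots> \<le> norm B + y n * y n" using Suc y_range by (intro add_left_mono mult_mono) auto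
    finally show ?case by (simp add: YS yS)
  qed (simp add: Y0 y0)
  have YY: "Y m o\<^sub>L Y n = Y n o\<^sub>L Y m" for m n
    using comm comm[of B] by metis
  have step: "norm (Y (Suc n) - Y n) \<le> y (Suc n) - y n" for n
  proof (induction n)
    case 0
    then show ?case by (simp add: YS yS Y0 y0)
  next
    case (Suc n)
    have "Y (Suc (Suc n)) - Y (Suc n) = (1/2) *\<^sub>R ((Y (Suc n) o\<^sub>L Y (Suc n)) - (Y n o\<^sub>L Y n))"
      unfolding YS[of "Suc n"] YS[of n] scaleR_diff_right[symmetric] by simp
    also have "(Y (Suc n) o\<^sub>L Y (Suc n)) - (Y n o\<^sub>L Y n) = (Y (Suc n) + Y n) o\<^sub>L (Y (Suc n) - Y n)"
      using YY[of n "Suc n"]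
      by (simp add: compose_bilinear)
    finally have "norm (Y (Suc (Suc n)) - Y (Suc n)) = (1/2) * norm ((Y (Suc n) + Y n) o\<^sub>L (Y (Suc n) - Y n))"
      by simp
    also have "\<dots> \<le> (1/2) * (norm (Y (Suc n) + Y n) * norm (Y (Suc n) - Y n))"
      by (intro mult_left_mono norm_blinfun_compose) simp
    also have "\<dots> \<le> (1/2) * ((y (Suc n) + y n) * (y (Suc n) - y n))"
      using Suc normY[of n] normY[of "Suc n"] norm_triangle_ineq[of "Y (Suc n)" "Y n"] y_range[of n] y_range[of "Suc n"]
      by (intro mult_left_mono mult_mono) auto
    also have "\<dots> = y (Suc (Suc n)) - y (Suc n)"
      unfolding yS[of "Suc n"] yS[of n] by (simp add: algebra_simps)
    finally show ?case .
  qed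
  have "incseq y"
  proof (rule incseq_SucI)
    show "y n \<le> y (Suc n)" for n using step[of n] norm_ge_zero[of "Y (Suc n) - Y n"] by linarith
  qed
  then obtain l where "y \<longlonglongrightarrow> l" using incseq_convergent y_range by blast
  then have "Cauchy y" by (simp add: LIMSEQ_imp_Cauchy)
  have mono: "norm (Y m - Y n) \<le> y m - y n" if "n \<le> m" for m n
    using that
  proof (induction rule: dec_induct)
    case (step k)
    then show ?case using \<open>\<And>n. norm (Y (Suc n) - Y n) \<le> y (Suc n) - y n\<close>[of k]
        norm_triangle_ineq[of "Y (Suc k) - Y k" "Y k - Y n"] by simp
  qed simp
  have "Cauchy Y"
  proof (rule metric_CauchyI)
    fix e :: real assume "0 < e"
    then obtain M where M: "\<And>m n. m \<ge> M \<Longrightarrow> n \<ge> M \<Longrightarrow> dist (y m) (y n) < e"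
      using \<open>Cauchy y\<close> metric_CauchyD by blast
    have "dist (Y m) (Y n) < e" if "m \<ge> M" "n \<ge> M" for m n
      using M[OF that] mono[of n m] mono[of m n]
      by (cases "n \<le> m") (auto simp: dist_norm norm_minus_commute)
    then show "\<exists>M. \<forall>m\<ge>M. \<forall>n\<ge>M. dist (Y m) (Y n) < e" by blast
  qed
  then obtain Z where Z: "Y \<longlonglongrightarrow> Z" using Cauchy_convergent convergent_def by blast
  show thesis
  proof (rule that)
    have symY: "symop (Y n)" for n
    proof (induction n)
      case (Suc n) then show ?case using sym by (auto simp: YS intro!: symop_arith)
    qed (simp add: Y0 symop_arith)
    show "symop Z" unfolding symop_def
    proof (intro allI)
      fix u v
      have "(\<lambda>n. Y n u \<bullet> v) \<longlonglongrightarrow> Z u \<bullet> v" "(\<lambda>n. u \<bullet> Y n v) \<longlonglongrightarrow> u \<bullet> Z v"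
        by (intro tendsto_intros Z)+
      moreover have "Y n u \<bullet> v = u \<bullet> Y n v" for n using symY by (simp add: symop_def)
      ultimately show "Z u \<bullet> v = u \<bullet> Z v" by (simp add: LIMSEQ_unique)
    qed
    have "(\<lambda>n. norm (Y n)) \<longlonglongrightarrow> norm Z" by (intro tendsto_intros Z)
    moreover have "norm (Y n) \<le> 1" for n using normY[of n] y_range[of n] by linarith
    ultimately show "norm Z \<le> 1" by (intro LIMSEQ_le_const2) auto
    have "(\<lambda>n. Y (Suc n)) \<longlonglongrightarrow> Z" using Z by (rule LIMSEQ_Suc)
    moreover have "(\<lambda>n. Y (Suc n)) \<longlonglongrightarrow> (1/2) *\<^sub>R (B + (Z o\<^sub>L Z))"
      unfolding YS by (intro tendsto_intros compose_tendsto Z)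
    ultimately have "Z = (1/2) *\<^sub>R (B + (Z o\<^sub>L Z))" by (rule LIMSEQ_unique)
    then have "2 *\<^sub>R Z = 2 *\<^sub>R ((1/2) *\<^sub>R (B + (Z o\<^sub>L Z)))" by (rule arg_cong)
    then show "2 *\<^sub>R Z = B + (Z o\<^sub>L Z)" by simp
    fix C assume "C o\<^sub>L B = B o\<^sub>L C"
    then have "C o\<^sub>L Y n = Y n o\<^sub>L C" for n by (rule comm)
    moreover have "(\<lambda>n. C o\<^sub>L Y n) \<longlonglongrightarrow> (C o\<^sub>L Z)" "(\<lambda>n. Y n o\<^sub>L C) \<longlonglongrightarrow> (Z o\<^sub>L C)"
      by (intro compose_tendsto Z tendsto_const)+
    ultimately show "C o\<^sub>L Z = Z o\<^sub>L C" by (simp add: LIMSEQ_unique)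
  qed
qed

lemma compose_id [simp]: "A o\<^sub>L id_blinfun = A" "id_blinfun o\<^sub>L A = A"
  by (auto intro: blinfun_eqI)

text \<open>Commuting with everything that commutes with \<open>A\<close> is what makes the root unique and
  complex linear, and products of commuting positive operators positive.\<close>

lemma ex_posop_sqrt:
  fixes A :: "'a::real_hilbert \<Rightarrow>\<^sub>L 'a"
  assumes "posop A"
  obtains B where "posop B" "B o\<^sub>L B = A" "\<And>C. C o\<^sub>L A = A o\<^sub>L C \<Longrightarrow> C o\<^sub>L B = B o\<^sub>L C"
proof -
  \<comment> \<open>After division by \<open>m\<close> the form of \<open>A\<close> is at most that of the identity; adding \<open>1\<close> avoids \<open>m = 0\<close>.\<close>
  define m where "m = norm A + 1"
  have m: "0 < m" by (simp add: m_def add_nonneg_pos)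
  define D where "D = id_blinfun - (1/m) *\<^sub>R A"
  have Dx: "D x \<bullet> x = (norm x)\<^sup>2 - (1/m) * (A x \<bullet> x)" for x
    by (simp add: D_def blinfun.bilinear_simps inner_diff power2_norm_eq_inner)
  have A_le: "A x \<bullet> x \<le> m * (norm x)\<^sup>2" for x
    using inner_le_norm_op[of A x] by (simp add: m_def algebra_simps add_increasing)
  have D: "posop D" unfolding posop_def
  proof (intro conjI allI)
    show "symop D" unfolding D_def using posop_symop[OF assms] by (intro symop_arith)
    show "0 \<le> D x \<bullet> x" for x using A_le[of x] m by (simp add: Dx field_simps)
  qed
  have "norm D \<le> 1"
  proof (rule posop_norm_le[OF D])
    show "D x \<bullet> x \<le> 1 * (norm x)\<^sup>2" for x using posop_nonneg[OF assms, of x] m by (simp add: Dx)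
  qed simp
  then obtain Y where Y: "symop Y" "norm Y \<le> 1" "2 *\<^sub>R Y = D + (Y o\<^sub>L Y)"
    "\<And>C. C o\<^sub>L D = D o\<^sub>L C \<Longrightarrow> C o\<^sub>L Y = Y o\<^sub>L C"
    using ex_sqrt_contraction[OF posop_symop[OF D]] by metis
  define B where "B = sqrt m *\<^sub>R (id_blinfun - Y)"
  show thesis
  proof
    show "posop B" unfolding posop_def
    proof (intro conjI allI)
      show "symop B" unfolding B_def using Y(1) by (intro symop_arith)
      have "Y x \<bullet> x \<le> x \<bullet> x" for x
        using inner_le_norm_op[of Y x] mult_right_mono[OF Y(2), of "(norm x)\<^sup>2"]
        by (simp add: power2_norm_eq_inner)
      then show "0 \<le> B x \<bullet> x" for x
        using m by (simp add: B_def blinfun.bilinear_simps inner_diff)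
    qed
    have "(id_blinfun - Y) o\<^sub>L (id_blinfun - Y) = id_blinfun - 2 *\<^sub>R Y + (Y o\<^sub>L Y)"
      by (simp add: compose_bilinear scaleR_2)
    also have "\<dots> = (1/m) *\<^sub>R A" unfolding Y(3) by (simp add: D_def)
    finally have sq: "(id_blinfun - Y) o\<^sub>L (id_blinfun - Y) = (1/m) *\<^sub>R A" .
    have "B o\<^sub>L B = (sqrt m * sqrt m) *\<^sub>R ((id_blinfun - Y) o\<^sub>L (id_blinfun - Y))"
      by (rule blinfun_eqI) (simp add: B_def blinfun.bilinear_simps scaleR_diff_right)
    then show "B o\<^sub>L B = A" unfolding sq using m by simp
    fix C assume "C o\<^sub>L A = A o\<^sub>L C"
    then have "C o\<^sub>L D = D o\<^sub>L C" by (simp add: D_def compose_bilinear)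
    then have "C o\<^sub>L Y = Y o\<^sub>L C" by (rule Y(4))
    then show "C o\<^sub>L B = B o\<^sub>L C" by (simp add: B_def compose_bilinear)
  qed
qed

lemma posop_sqrt_unique_of_commute:
  assumes B: "posop B" and C: "posop C" and eq: "B o\<^sub>L B = C o\<^sub>L C" and com: "B o\<^sub>L C = C o\<^sub>L B"
  shows "B = C"
proof (rule blinfun_eqI)
  fix x
  define y where "y = B x - C x"
  have eqx: "B (B x) = C (C x)" and comx: "B (C x) = C (B x)"
    using eq com by (metis blinfun_apply_blinfun_compose)+
  \<comment> \<open>\<open>(B + C) (B - C) = B B - C C\<close> for commuting operators.\<close>
  have "B y + C y = 0"
    using eqx comx by (simp add: y_def blinfun.bilinear_simps)
  then have "B y \<bullet> y + C y \<bullet> y = 0" by (metis inner_add_left inner_zero_left)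
  then have "B y \<bullet> y = 0" "C y \<bullet> y = 0"
    using posop_nonneg[OF B, of y] posop_nonneg[OF C, of y] by linarith+
  then have "B y = 0" "C y = 0" using B C by (simp_all add: posop_zero_form)
  moreover have "y \<bullet> y = x \<bullet> (B y - C y)"
    unfolding y_def[of] using symopD[OF posop_symop[OF B], of x y] symopD[OF posop_symop[OF C], of x y]
    by (simp add: y_def inner_diff)
  ultimately show "B x = C x" by (simp add: y_def)
qed

lemma posop_sqrt_unique:
  fixes B C :: "'a::real_hilbert \<Rightarrow>\<^sub>L 'a"
  assumes "posop B" "posop C" "B o\<^sub>L B = C o\<^sub>L C"
  shows "B = C"
proof -
  have "posop (B o\<^sub>L B)" using assms(1) by (simp add: posop_square posop_symop)
  then obtain D where D: "posop D" "D o\<^sub>L D = B o\<^sub>L B"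
    "\<And>E. E o\<^sub>L (B o\<^sub>L B) = (B o\<^sub>L B) o\<^sub>L E \<Longrightarrow> E o\<^sub>L D = D o\<^sub>L E"
    using ex_posop_sqrt by blast
  have "B o\<^sub>L D = D o\<^sub>L B" by (rule D(3)) (simp add: compose_assoc)
  then have "B = D" using posop_sqrt_unique_of_commute[OF assms(1) D(1)] D(2) by simp
  have "C o\<^sub>L D = D o\<^sub>L C" by (rule D(3)) (simp add: assms(3) compose_assoc)
  then have "C = D" using posop_sqrt_unique_of_commute[OF assms(2) D(1)] D(2) assms(3) by simp
  then show ?thesis using \<open>B = D\<close> by simp
qed

lemma posop_compose:
  fixes A B :: "'a::real_hilbert \<Rightarrow>\<^sub>L 'a"
  assumes A: "posop A" and B: "posop B" and com: "A o\<^sub>L B = B o\<^sub>L A"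
  shows "posop (A o\<^sub>L B)"
proof -
  obtain D where D: "posop D" "D o\<^sub>L D = A" "\<And>C. C o\<^sub>L A = A o\<^sub>L C \<Longrightarrow> C o\<^sub>L D = D o\<^sub>L C"
    using ex_posop_sqrt[OF A] by blast
  have "B o\<^sub>L D = D o\<^sub>L B" using com by (intro D(3)) simp
  then have "A o\<^sub>L B = D o\<^sub>L B o\<^sub>L D" unfolding D(2)[symmetric] by (simp add: compose_assoc)
  then show ?thesis using posop_sandwich[OF B posop_symop[OF D(1)]] by simp
qed

section \<open>Polynomials of a positive operator\<close>

lemma poly_op_eq_sum:
  fixes A :: "'a::chilbert_space \<Rightarrow>\<^sub>L 'a"
  assumes "degree p \<le> n"
  shows "poly_op p A = (\<Sum>i\<le>n. coeff p i *\<^sub>R (((o\<^sub>L) A ^^ i) id_blinfun))"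
  unfolding poly_op_def using assms
  by (intro sum.mono_neutral_left) (auto simp: coeff_eq_0)

lemma poly_op_0 [simp]: "poly_op 0 A = 0"
  for A :: "'a::chilbert_space \<Rightarrow>\<^sub>L 'a"
  by (simp add: poly_op_def)

lemma poly_op_pCons [simp]: "poly_op (pCons a p) A = a *\<^sub>R id_blinfun + (A o\<^sub>L poly_op p A)"
  for A :: "'a::chilbert_space \<Rightarrow>\<^sub>L 'a"
proof -
  have "poly_op (pCons a p) A = (\<Sum>i\<le>Suc (degree p). coeff (pCons a p) i *\<^sub>R (((o\<^sub>L) A ^^ i) id_blinfun))"
    by (rule poly_op_eq_sum) (simp add: degree_pCons_le)
  also have "\<dots> = a *\<^sub>R id_blinfun + (\<Sum>i\<le>degree p. coeff p i *\<^sub>R (A o\<^sub>L ((o\<^sub>L) A ^^ i) id_blinfun))"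
    unfolding sum.atMost_Suc_shift by simp
  also have "(\<Sum>i\<le>degree p. coeff p i *\<^sub>R (A o\<^sub>L ((o\<^sub>L) A ^^ i) id_blinfun)) = A o\<^sub>L poly_op p A"
    unfolding poly_op_def bounded_bilinear.sum_right[OF bounded_bilinear_blinfun_compose]
    by (simp add: compose_bilinear)
  finally show ?thesis .
qed

lemma poly_op_add: "poly_op (p + q) A = poly_op p A + poly_op q A"
  for A :: "'a::chilbert_space \<Rightarrow>\<^sub>L 'a"
  by (induction p q rule: poly_induct2) (simp_all add: compose_bilinear algebra_simps)

lemma poly_op_smult: "poly_op (smult c p) A = c *\<^sub>R poly_op p A"
  for A :: "'a::chilbert_space \<Rightarrow>\<^sub>L 'a"
  by (induction p) (simp_all add: compose_bilinear algebra_simps)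

lemma poly_op_diff: "poly_op (p - q) A = poly_op p A - poly_op q A"
  for A :: "'a::chilbert_space \<Rightarrow>\<^sub>L 'a"
  using poly_op_add[of p "smult (-1) q" A] poly_op_smult[of "-1" q A] by simp

lemma poly_op_mult: "poly_op (p * q) A = poly_op p A o\<^sub>L poly_op q A"
  for A :: "'a::chilbert_space \<Rightarrow>\<^sub>L 'a"
  by (induction p) (simp_all add: compose_bilinear poly_op_add poly_op_smult compose_assoc)

lemma poly_op_commute: "C o\<^sub>L A = A o\<^sub>L C \<Longrightarrow> C o\<^sub>L poly_op p A = poly_op p A o\<^sub>L C"
  for A :: "'a::chilbert_space \<Rightarrow>\<^sub>L 'a"
proof (induction p)
  case (pCons a p)
  then have "C o\<^sub>L (A o\<^sub>L poly_op p A) = (A o\<^sub>L poly_op p A) o\<^sub>L C"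
    by (metis compose_assoc)
  then show ?case by (simp add: compose_bilinear)
qed (simp add: compose_bilinear)

lemma poly_op_symop: "symop A \<Longrightarrow> symop (poly_op p A)"
  for A :: "'a::chilbert_space \<Rightarrow>\<^sub>L 'a"
proof (induction p)
  case (pCons a p)
  then show ?case using poly_op_commute[of A A p] by (simp add: symop_arith)
qed (simp add: symop_arith)

lemma poly_op_eigen: "A x = s *\<^sub>R x \<Longrightarrow> poly_op p A x = poly p s *\<^sub>R x"
  for A :: "'a::chilbert_space \<Rightarrow>\<^sub>L 'a"
  by (induction p) (simp_all add: blinfun.bilinear_simps scaleR_add_left)

lemma poly_nonneg_at_limit:
  fixes a b x :: real
  assumes "a < b" "x \<in> {a..b}" and q: "\<And>t. t \<in> {a..b} \<Longrightarrow> t \<noteq> x \<Longrightarrow> 0 \<le> poly q t"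
  shows "0 \<le> poly q x"
proof -
  have "x islimpt {a..b}" using assms(1,2) by (simp add: islimpt_Icc)
  then have "x \<in> closure ({a..b} - {x})" by (simp add: islimpt_in_closure)
  moreover have "closed {t. 0 \<le> poly q t}" by (intro closed_Collect_le continuous_intros)
  then have "closure ({a..b} - {x}) \<subseteq> {t. 0 \<le> poly q t}" using q by (intro closure_minimal) auto
  ultimately show ?thesis by auto
qed

lemma poly_map_of_real_add:
  "poly (map_poly of_real (p + q)) z = poly (map_poly of_real p) z + poly (map_poly of_real q) z"
  for z :: complex
  by (induction p q rule: poly_induct2) (simp_all add: map_poly_pCons algebra_simps)

lemma poly_map_of_real_smult:
  "poly (map_poly of_real (smult c p)) z = of_real c * poly (map_poly of_real p) z"
  for z :: complex
  by (induction p) (simp_all add: map_poly_pCons algebra_simps)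

lemma poly_map_of_real_mult:
  "poly (map_poly of_real (p * q)) z = poly (map_poly of_real p) z * poly (map_poly of_real q) z"
  for z :: complex
  by (induction p)
    (simp_all add: map_poly_pCons poly_map_of_real_add poly_map_of_real_smult algebra_simps)

lemma poly_map_of_real_of_real:
  "poly (map_poly of_real p) (complex_of_real x) = of_real (poly p x)"
  by (induction p) (simp_all add: map_poly_pCons)

text \<open>The remainder modulo the quadratic is a real linear polynomial with a nonreal root, hence zero.\<close>

lemma real_poly_nonreal_root_factor:
  fixes p :: "real poly" and z :: complex
  assumes "poly (map_poly of_real p) z = 0" "Im z \<noteq> 0"
  obtains q where "p = ([:- Re z, 1:] * [:- Re z, 1:] + [:(Im z)\<^sup>2:]) * q"
proof -
  define d where "d = [:- Re z, 1:] * [:- Re z, 1:] + [:(Im z)\<^sup>2:]"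
  have d2: "degree d = 2" "d \<noteq> 0" by (simp_all add: d_def)
  define r where "r = p mod d"
  have "degree r < 2" using degree_mod_less[of d p] d2 by (auto simp: r_def)
  then have r: "r = [:coeff r 0, coeff r 1:]"
    by (intro poly_eqI) (auto simp: coeff_pCons coeff_eq_0 split: nat.split)
  have hom: "poly (map_poly of_real (u * v + w)) z =
      poly (map_poly of_real u) z * poly (map_poly of_real v) z + poly (map_poly of_real w) z"
    for u v w :: "real poly"
    by (simp add: poly_map_of_real_add poly_map_of_real_mult)
  have "poly (map_poly of_real d) z = 0"
    by (simp add: d_def map_poly_pCons complex_eq_iff power2_eq_square algebra_simps)
  moreover have "p = (p div d) * d + r" by (simp add: r_def)
  ultimately have "poly (map_poly of_real r) z = 0"
    using assms(1) hom[of "p div d" d r] by simp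
  then have "of_real (coeff r 0) + z * of_real (coeff r 1) = 0"
    by (subst (asm) r) (simp add: map_poly_pCons)
  then have "coeff r 1 = 0" "coeff r 0 = 0" using assms(2) by (auto simp: complex_eq_iff)
  then have "r = 0" using r by simp
  then have "p = d * (p div d)" by (simp add: r_def mod_eq_0_iff_dvd)
  then show thesis using that unfolding d_def by blast
qed

text \<open>A polynomial that is nonnegative on \<open>{0..m}\<close> is a product of linear and quadratic factors
  each of which is visibly nonnegative there, and commuting positive factors have a positive
  product.\<close>

lemma poly_op_posop:
  fixes A :: "'a::chilbert_space \<Rightarrow>\<^sub>L 'a"
  assumes A: "posop A" and A_le: "norm A \<le> m" and m: "0 < m"
    and p: "\<And>t. t \<in> {0..m} \<Longrightarrow> 0 \<le> poly p t"
  shows "posop (poly_op p A)"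
  using p
proof (induction "degree p" arbitrary: p rule: less_induct)
  case less
  have sA: "symop A" using A by (rule posop_symop)
  have comm: "poly_op u A o\<^sub>L poly_op v A = poly_op v A o\<^sub>L poly_op u A" for u v
    by (metis mult.commute poly_op_mult)
  have prod: "posop (poly_op (u * v) A)" if "posop (poly_op u A)" "posop (poly_op v A)" for u v
    unfolding poly_op_mult using that comm by (rule posop_compose)
  have sq: "posop (poly_op (u * u) A)" for u
    unfolding poly_op_mult using sA by (intro posop_square poly_op_symop)
  have const: "posop (poly_op [:c:] A)" if "0 \<le> c" for c
    using that by (simp add: posop_arith compose_bilinear)
  have lin: "poly_op [:c, d:] A = c *\<^sub>R id_blinfun + d *\<^sub>R A" for c d
    by (simp add: compose_bilinear)
  show ?case
  proof (cases "degree p = 0")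
    case True
    then obtain c where "p = [:c:]" by (rule degree_eq_zeroE)
    then show ?thesis using less.prems[of 0] m by (auto intro!: const simp del: poly_op_pCons)
  next
    case False
    have deg: "degree q < degree p" if "p = d * q" "0 < degree d" for d q
    proof -
      have "d \<noteq> 0" "q \<noteq> 0" using that False by auto
      then show ?thesis using that by (simp add: degree_mult_eq)
    qed
    have "degree (map_poly complex_of_real p) \<noteq> 0"
      using False by (simp add: degree_map_poly)
    then have "\<nexists>a l. a \<noteq> 0 \<and> l = 0 \<and> map_poly complex_of_real p = pCons a l" by auto
    then obtain z where z: "poly (map_poly complex_of_real p) z = 0"
      using fundamental_theorem_of_algebra_alt by blast
    show ?thesis
    proof (cases "Im z = 0")
      case nonreal: False
      define d where "d = [:- Re z, 1:] * [:- Re z, 1:] + [:(Im z)\<^sup>2:]"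
      obtain q where q: "p = d * q"
        using real_poly_nonreal_root_factor[OF z nonreal] unfolding d_def by blast
      have "0 \<le> poly q t" if "t \<in> {0..m}" for t
      proof -
        have "0 < poly d t" unfolding d_def using nonreal
          by (simp add: add_nonneg_pos flip: power2_eq_square)
        then show ?thesis using less.prems[OF that] q by (simp add: zero_le_mult_iff)
      qed
      then have "posop (poly_op q A)" using deg[OF q] by (intro less.hyps) (simp_all add: d_def)
      moreover have "posop (poly_op d A)"
        unfolding d_def poly_op_add by (intro posop_arith(3) sq const) simp
      ultimately show ?thesis unfolding q by (intro prod)
    next
      case True
      define x where "x = Re z"
      have "z = of_real x" using True by (simp add: x_def complex_eq_iff)
      then have "poly p x = 0" using z by (simp add: poly_map_of_real_of_real)
      then obtain q where q: "p = [:- x, 1:] * q" by (metis dvdE poly_eq_0_iff_dvd)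
      have pq: "poly p t = (t - x) * poly q t" for t unfolding q by (simp add: algebra_simps)
      \<comment> \<open>A root outside the open interval has a factor of constant sign; one inside is a double root.\<close>
      consider "x \<le> 0" | "m \<le> x" | "0 < x" "x < m" by linarith
      then show ?thesis
      proof cases
        case 1
        have ne: "0 \<le> poly q t" if "t \<in> {0..m}" "t \<noteq> 0" for t
          using less.prems[OF that(1)] that 1 by (simp add: pq zero_le_mult_iff)
        then have "0 \<le> poly q t" if "t \<in> {0..m}" for t
          using poly_nonneg_at_limit[of 0 m 0 q] m that by (cases "t = 0") auto
        then have "posop (poly_op q A)" using deg[OF q] by (intro less.hyps) simp_all
        moreover have "posop (poly_op [:- x, 1:] A)"
          unfolding lin using A 1 by (intro posop_arith) simp_all
        ultimately show ?thesis unfolding q by (intro prod)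
      next
        case 2
        have q': "p = [:x, -1:] * (- q)" unfolding q by simp
        have ne: "0 \<le> poly (- q) t" if "t \<in> {0..m}" "t \<noteq> m" for t
          using less.prems[OF that(1)] that 2 by (simp add: pq zero_le_mult_iff)
        then have "0 \<le> poly (- q) t" if "t \<in> {0..m}" for t
          using poly_nonneg_at_limit[of 0 m m "- q"] m that by (cases "t = m") auto
        then have "posop (poly_op (- q) A)" using deg[OF q] by (intro less.hyps) simp_all
        moreover have "posop (poly_op [:x, -1:] A)"
          unfolding lin posop_def
        proof (intro conjI allI)
          show "symop (x *\<^sub>R id_blinfun + (-1) *\<^sub>R A)" using sA by (intro symop_arith)
          fix y
          have "A y \<bullet> y \<le> x * (norm y)\<^sup>2"
            using inner_le_norm_op[of A y] mult_right_mono[of "norm A" x "(norm y)\<^sup>2"] A_le 2 by simp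
          then show "0 \<le> (x *\<^sub>R id_blinfun + (-1) *\<^sub>R A) y \<bullet> y"
            by (simp add: blinfun.bilinear_simps inner_diff power2_norm_eq_inner)
        qed
        ultimately show ?thesis unfolding q' by (intro prod)
      next
        case 3
        have r0: "0 \<le> poly q t" if "t \<in> {x..m}" "t \<noteq> x" for t
          using less.prems[of t] that 3 by (simp add: pq zero_le_mult_iff)
        have l0: "0 \<le> poly (- q) t" if "t \<in> {0..x}" "t \<noteq> x" for t
          using less.prems[of t] that 3 by (simp add: pq zero_le_mult_iff)
        have "0 \<le> poly q x" using 3 by (intro poly_nonneg_at_limit[of x m x q, OF _ _ r0]) auto
        moreover have "0 \<le> poly (- q) x" using 3 by (intro poly_nonneg_at_limit[of 0 x x "- q", OF _ _ l0]) auto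
        ultimately have "poly q x = 0" by simp
        then obtain r where r: "q = [:- x, 1:] * r" by (metis dvdE poly_eq_0_iff_dvd)
        have pr: "p = ([:- x, 1:] * [:- x, 1:]) * r" unfolding q r by (simp only: mult.assoc)
        have ne: "0 \<le> poly r t" if "t \<in> {0..m}" "t \<noteq> x" for t
        proof -
          have "poly p t = (t - x)\<^sup>2 * poly r t" unfolding pr by (simp add: power2_eq_square algebra_simps)
          then show ?thesis using less.prems[OF that(1)] that(2) by (simp add: zero_le_mult_iff)
        qed
        then have "0 \<le> poly r t" if "t \<in> {0..m}" for t
          using poly_nonneg_at_limit[of 0 m x r] 3 that by (cases "t = x") auto
        moreover have "degree r < degree p" using deg[OF pr] by (simp add: degree_mult_eq)
        ultimately have "posop (poly_op r A)" by (intro less.hyps)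
        then show ?thesis unfolding pr by (intro prod sq)
      qed
    qed
  qed
qed

text \<open>The polynomial \<open>c\<^sup>2 - p\<^sup>2\<close> is nonnegative on \<open>{0..norm A}\<close>.\<close>

lemma poly_op_norm_le:
  fixes A :: "'a::chilbert_space \<Rightarrow>\<^sub>L 'a"
  assumes A: "posop A" and c: "\<And>t. t \<in> {0..norm A} \<Longrightarrow> \<bar>poly p t\<bar> \<le> c"
  shows "norm (poly_op p A) \<le> c"
proof (cases "A = 0")
  case True
  have "poly_op p A = poly p 0 *\<^sub>R id_blinfun"
    by (cases p) (simp add: True compose_bilinear)
  then have "norm (poly_op p A) \<le> \<bar>poly p 0\<bar> * 1"
    using norm_blinfun_id_le[where 'a='a] by (simp add: mult_left_le)
  then show ?thesis using c[of 0] by simp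
next
  case False
  have c0: "0 \<le> c" using c[of 0] by simp
  have sq: "posop (poly_op ([:c\<^sup>2:] - p * p) A)"
  proof (rule poly_op_posop[OF A order_refl])
    show "0 < norm A" using False by simp
    fix t assume "t \<in> {0..norm A}"
    then have "\<bar>poly p t\<bar>\<^sup>2 \<le> c\<^sup>2" using c by (intro power_mono) auto
    then show "0 \<le> poly ([:c\<^sup>2:] - p * p) t" by (simp add: power2_eq_square)
  qed
  have s: "symop (poly_op p A)" using A by (intro poly_op_symop posop_symop)
  show ?thesis
  proof (rule norm_blinfun_bound[OF c0])
    fix x
    have "0 \<le> poly_op ([:c\<^sup>2:] - p * p) A x \<bullet> x" using sq by (rule posop_nonneg)
    also have "\<dots> = c\<^sup>2 * (x \<bullet> x) - poly_op p A x \<bullet> poly_op p A x"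
      using symopD[OF s, of "poly_op p A x" x]
      by (simp add: poly_op_diff poly_op_mult blinfun.bilinear_simps inner_diff compose_bilinear)
    finally have "(norm (poly_op p A x))\<^sup>2 \<le> (c * norm x)\<^sup>2"
      by (simp add: power2_norm_eq_inner power_mult_distrib)
    then show "norm (poly_op p A x) \<le> c * norm x"
      by (rule power2_le_imp_le) (use c0 in simp)
  qed
qed

section \<open>Continuous functional calculus\<close>

lemma ex_poly_uniform_limit:
  fixes f :: "real \<Rightarrow> real"
  assumes "continuous_on {a..b} f"
  obtains p :: "nat \<Rightarrow> real poly" where "uniform_limit {a..b} (\<lambda>n. poly (p n)) f sequentially"
proof -
  have "\<exists>p. \<forall>x\<in>{a..b}. \<bar>f x - poly p x\<bar> < inverse (real (Suc n))" for n
  proof -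
    obtain g where g: "real_polynomial_function g"
        "\<And>x. x \<in> {a..b} \<Longrightarrow> \<bar>f x - g x\<bar> < inverse (real (Suc n))"
      using Stone_Weierstrass_real_polynomial_function[OF compact_Icc assms, of "inverse (real (Suc n))"]
      by auto
    then obtain c k where "g = (\<lambda>x. \<Sum>i\<le>k. c i * x ^ i)"
      by (auto simp: real_polynomial_function_iff_sum)
    then have "g x = poly (\<Sum>i\<le>k. monom (c i) i) x" for x by (simp add: poly_sum poly_monom)
    then show ?thesis using g(2) by metis
  qed
  then obtain p where p: "\<And>n x. x \<in> {a..b} \<Longrightarrow> \<bar>f x - poly (p n) x\<bar> < inverse (real (Suc n))"
    by metis
  have "uniform_limit {a..b} (\<lambda>n. poly (p n)) f sequentially"
  proof (rule uniform_limitI)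
    fix e :: real assume "0 < e"
    then have "\<forall>\<^sub>F n in sequentially. inverse (real (Suc n)) < e"
      using LIMSEQ_inverse_real_of_nat by (rule order_tendstoD(2)[rotated])
    then show "\<forall>\<^sub>F n in sequentially. \<forall>x\<in>{a..b}. dist (poly (p n) x) (f x) < e"
    proof eventually_elim
      case (elim n)
      then show ?case using p[of _ n] by (force simp: dist_real_def abs_minus_commute)
    qed
  qed
  then show thesis by (rule that)
qed

text \<open>By the norm bound, polynomials with the same uniform limit have the same limit at \<open>A\<close>; this makes
  the functional calculus well defined.\<close>

lemma poly_op_diff_tendsto_0:
  fixes A :: "'a::chilbert_space \<Rightarrow>\<^sub>L 'a"
  assumes A: "posop A"
    and p: "uniform_limit {0..norm A} (\<lambda>n. poly (p n)) f sequentially"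
    and q: "uniform_limit {0..norm A} (\<lambda>n. poly (q n)) f sequentially"
  shows "(\<lambda>n. poly_op (p n) A - poly_op (q n) A) \<longlonglongrightarrow> 0"
proof (rule tendstoI)
  fix e :: real assume "0 < e"
  then have e: "0 < e / 4" by simp
  from uniform_limitD[OF p e] uniform_limitD[OF q e]
  show "\<forall>\<^sub>F n in sequentially. dist (poly_op (p n) A - poly_op (q n) A) 0 < e"
  proof eventually_elim
    case (elim n)
    have "norm (poly_op (p n - q n) A) \<le> e / 2"
    proof (rule poly_op_norm_le[OF A])
      fix t assume t: "t \<in> {0..norm A}"
      have "\<bar>poly (p n) t - f t\<bar> < e / 4" "\<bar>poly (q n) t - f t\<bar> < e / 4"
        using elim t by (auto simp: dist_real_def)
      then show "\<bar>poly (p n - q n) t\<bar> \<le> e / 2" unfolding poly_diff by linarith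
    qed
    then show ?case using \<open>0 < e\<close> by (simp add: poly_op_diff)
  qed
qed

lemma poly_op_Cauchy:
  fixes A :: "'a::chilbert_space \<Rightarrow>\<^sub>L 'a"
  assumes A: "posop A"
    and p: "uniform_limit {0..norm A} (\<lambda>n. poly (p n)) f sequentially"
  shows "Cauchy (\<lambda>n. poly_op (p n) A)"
proof (rule metric_CauchyI)
  fix e :: real assume "0 < e"
  then have "0 < e / 4" by simp
  then obtain N where N: "\<And>n t. n \<ge> N \<Longrightarrow> t \<in> {0..norm A} \<Longrightarrow> dist (poly (p n) t) (f t) < e / 4"
    using uniform_limitD[OF p] unfolding eventually_sequentially by metis
  have "dist (poly_op (p m) A) (poly_op (p n) A) < e" if "m \<ge> N" "n \<ge> N" for m n
  proof -
    have "norm (poly_op (p m - p n) A) \<le> e / 2"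
    proof (rule poly_op_norm_le[OF A])
      fix t assume t: "t \<in> {0..norm A}"
      show "\<bar>poly (p m - p n) t\<bar> \<le> e / 2"
        using N[OF that(1) t] N[OF that(2) t] unfolding dist_real_def poly_diff by linarith
    qed
    then show ?thesis using \<open>0 < e\<close> by (simp add: poly_op_diff dist_norm)
  qed
  then show "\<exists>M. \<forall>m\<ge>M. \<forall>n\<ge>M. dist (poly_op (p m) A) (poly_op (p n) A) < e" by blast
qed

lemma fun_calc_tendsto:
  fixes A :: "'a::chilbert_space \<Rightarrow>\<^sub>L 'a"
  assumes A: "posop A"
    and p: "uniform_limit {0..norm A} (\<lambda>n. poly (p n)) f sequentially"
  shows "(\<lambda>n. poly_op (p n) A) \<longlonglongrightarrow> fun_calc f A"
proof -
  obtain B where B: "(\<lambda>n. poly_op (p n) A) \<longlonglongrightarrow> B"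
    using poly_op_Cauchy[OF A p] Cauchy_convergent convergent_def by blast
  have "fun_calc f A = B"
    unfolding fun_calc_def
  proof (rule the_equality)
    show "\<forall>q. uniform_limit {0..norm A} (\<lambda>n. poly (q n)) f sequentially \<longrightarrow> (\<lambda>n. poly_op (q n) A) \<longlonglongrightarrow> B"
    proof (intro allI impI)
      fix q assume "uniform_limit {0..norm A} (\<lambda>n. poly (q n)) f sequentially"
      from tendsto_add[OF poly_op_diff_tendsto_0[OF A this p] B]
      show "(\<lambda>n. poly_op (q n) A) \<longlonglongrightarrow> B" by simp
    qed
    fix B' assume "\<forall>q. uniform_limit {0..norm A} (\<lambda>n. poly (q n)) f sequentially \<longrightarrow> (\<lambda>n. poly_op (q n) A) \<longlonglongrightarrow> B'"
    then show "B' = B" using p B LIMSEQ_unique by blast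
  qed
  then show ?thesis using B by simp
qed

lemma fun_calc_poly:
  fixes A :: "'a::chilbert_space \<Rightarrow>\<^sub>L 'a"
  assumes A: "posop A"
  shows "fun_calc (poly p) A = poly_op p A"
proof -
  have "(\<lambda>n::nat. poly_op p A) \<longlonglongrightarrow> fun_calc (poly p) A"
    by (rule fun_calc_tendsto[OF A uniform_limit_const])
  then show ?thesis by (simp add: LIMSEQ_const_iff)
qed

lemma fun_calc_cong:
  fixes A :: "'a::chilbert_space \<Rightarrow>\<^sub>L 'a"
  assumes "\<And>t. t \<in> {0..norm A} \<Longrightarrow> f t = g t"
  shows "fun_calc f A = fun_calc g A"
proof -
  have "uniform_limit {0..norm A} F f sequentially \<longleftrightarrow> uniform_limit {0..norm A} F g sequentially" for F
    using assms by (intro uniform_limit_cong') auto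
  then show ?thesis by (simp add: fun_calc_def)
qed

lemma fun_calc_add:
  fixes A :: "'a::chilbert_space \<Rightarrow>\<^sub>L 'a"
  assumes A: "posop A" and f: "continuous_on {0..norm A} f" and g: "continuous_on {0..norm A} g"
  shows "fun_calc (\<lambda>t. f t + g t) A = fun_calc f A + fun_calc g A"
proof -
  obtain p where p: "uniform_limit {0..norm A} (\<lambda>n. poly (p n)) f sequentially"
    using ex_poly_uniform_limit[OF f] by blast
  obtain q where q: "uniform_limit {0..norm A} (\<lambda>n. poly (q n)) g sequentially"
    using ex_poly_uniform_limit[OF g] by blast
  have "uniform_limit {0..norm A} (\<lambda>n. poly (p n + q n)) (\<lambda>t. f t + g t) sequentially"
    using uniform_limit_add[OF p q] unfolding poly_add[abs_def] .
  from fun_calc_tendsto[OF A this]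
  have "(\<lambda>n. poly_op (p n) A + poly_op (q n) A) \<longlonglongrightarrow> fun_calc (\<lambda>t. f t + g t) A"
    by (simp add: poly_op_add)
  moreover have "(\<lambda>n. poly_op (p n) A + poly_op (q n) A) \<longlonglongrightarrow> fun_calc f A + fun_calc g A"
    by (intro tendsto_add fun_calc_tendsto[OF A] p q)
  ultimately show ?thesis by (rule LIMSEQ_unique)
qed

lemma fun_calc_mult:
  fixes A :: "'a::chilbert_space \<Rightarrow>\<^sub>L 'a"
  assumes A: "posop A" and f: "continuous_on {0..norm A} f" and g: "continuous_on {0..norm A} g"
  shows "fun_calc (\<lambda>t. f t * g t) A = fun_calc f A o\<^sub>L fun_calc g A"
proof -
  obtain p where p: "uniform_limit {0..norm A} (\<lambda>n. poly (p n)) f sequentially"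
    using ex_poly_uniform_limit[OF f] by blast
  obtain q where q: "uniform_limit {0..norm A} (\<lambda>n. poly (q n)) g sequentially"
    using ex_poly_uniform_limit[OF g] by blast
  have "bounded (f ` {0..norm A})" "bounded (g ` {0..norm A})"
    using f g by (auto intro!: compact_imp_bounded compact_continuous_image)
  from uniform_lim_mult[OF p q this]
  have "uniform_limit {0..norm A} (\<lambda>n. poly (p n * q n)) (\<lambda>t. f t * g t) sequentially"
    unfolding poly_mult[abs_def] .
  from fun_calc_tendsto[OF A this]
  have "(\<lambda>n. poly_op (p n) A o\<^sub>L poly_op (q n) A) \<longlonglongrightarrow> fun_calc (\<lambda>t. f t * g t) A"
    by (simp add: poly_op_mult)
  moreover have "(\<lambda>n. poly_op (p n) A o\<^sub>L poly_op (q n) A) \<longlonglongrightarrow> (fun_calc f A o\<^sub>L fun_calc g A)"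
    by (intro compose_tendsto fun_calc_tendsto[OF A] p q)
  ultimately show ?thesis by (rule LIMSEQ_unique)
qed

lemma fun_calc_const:
  fixes A :: "'a::chilbert_space \<Rightarrow>\<^sub>L 'a"
  assumes A: "posop A"
  shows "fun_calc (\<lambda>t. c) A = c *\<^sub>R id_blinfun"
proof -
  have "(\<lambda>t::real. c) = poly [:c:]" by (rule ext) simp
  then show ?thesis using fun_calc_poly[OF A, of "[:c:]"] by (simp add: compose_bilinear)
qed

lemma fun_calc_id:
  fixes A :: "'a::chilbert_space \<Rightarrow>\<^sub>L 'a"
  assumes A: "posop A"
  shows "fun_calc (\<lambda>t. t) A = A"
proof -
  have "(\<lambda>t::real. t) = poly [:0, 1:]" by (rule ext) simp
  then show ?thesis using fun_calc_poly[OF A, of "[:0, 1:]"] by (simp add: compose_bilinear)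
qed

lemma fun_calc_diff:
  fixes A :: "'a::chilbert_space \<Rightarrow>\<^sub>L 'a"
  assumes A: "posop A" and f: "continuous_on {0..norm A} f" and g: "continuous_on {0..norm A} g"
  shows "fun_calc (\<lambda>t. f t - g t) A = fun_calc f A - fun_calc g A"
proof -
  have "fun_calc (\<lambda>t. (f t - g t) + g t) A = fun_calc (\<lambda>t. f t - g t) A + fun_calc g A"
    by (intro fun_calc_add A continuous_intros f g)
  then show ?thesis by simp
qed

lemma fun_calc_commute:
  fixes A :: "'a::chilbert_space \<Rightarrow>\<^sub>L 'a"
  assumes A: "posop A" and f: "continuous_on {0..norm A} f" and C: "C o\<^sub>L A = A o\<^sub>L C"
  shows "C o\<^sub>L fun_calc f A = fun_calc f A o\<^sub>L C"
proof -
  obtain p where p: "uniform_limit {0..norm A} (\<lambda>n. poly (p n)) f sequentially"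
    using ex_poly_uniform_limit[OF f] by blast
  have "(\<lambda>n. C o\<^sub>L poly_op (p n) A) \<longlonglongrightarrow> (C o\<^sub>L fun_calc f A)"
       "(\<lambda>n. poly_op (p n) A o\<^sub>L C) \<longlonglongrightarrow> (fun_calc f A o\<^sub>L C)"
    by (intro compose_tendsto fun_calc_tendsto[OF A] p tendsto_const)+
  then show ?thesis using poly_op_commute[OF C] by (simp add: LIMSEQ_unique)
qed

lemma fun_calc_symop:
  fixes A :: "'a::chilbert_space \<Rightarrow>\<^sub>L 'a"
  assumes A: "posop A" and f: "continuous_on {0..norm A} f"
  shows "symop (fun_calc f A)"
  unfolding symop_def
proof (intro allI)
  fix x y
  obtain p where p: "uniform_limit {0..norm A} (\<lambda>n. poly (p n)) f sequentially"
    using ex_poly_uniform_limit[OF f] by blast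
  have "(\<lambda>n. poly_op (p n) A x \<bullet> y) \<longlonglongrightarrow> fun_calc f A x \<bullet> y"
       "(\<lambda>n. x \<bullet> poly_op (p n) A y) \<longlonglongrightarrow> x \<bullet> fun_calc f A y"
    by (intro tendsto_intros fun_calc_tendsto[OF A] p)+
  moreover have "poly_op (p n) A x \<bullet> y = x \<bullet> poly_op (p n) A y" for n
    using poly_op_symop[OF posop_symop[OF A]] by (rule symopD)
  ultimately show "fun_calc f A x \<bullet> y = x \<bullet> fun_calc f A y" by (simp add: LIMSEQ_unique)
qed

text \<open>A nonnegative function is the square of its root.\<close>

lemma fun_calc_posop:
  fixes A :: "'a::chilbert_space \<Rightarrow>\<^sub>L 'a"
  assumes A: "posop A" and f: "continuous_on {0..norm A} f"
    and nonneg: "\<And>t. t \<in> {0..norm A} \<Longrightarrow> 0 \<le> f t"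
  shows "posop (fun_calc f A)"
proof -
  have c: "continuous_on {0..norm A} (\<lambda>t. sqrt (f t))" using f by (intro continuous_intros)
  have "fun_calc f A = fun_calc (\<lambda>t. sqrt (f t) * sqrt (f t)) A"
    using nonneg by (intro fun_calc_cong) simp
  also have "\<dots> = fun_calc (\<lambda>t. sqrt (f t)) A o\<^sub>L fun_calc (\<lambda>t. sqrt (f t)) A"
    by (rule fun_calc_mult[OF A c c])
  finally show ?thesis using fun_calc_symop[OF A c] by (simp add: posop_square)
qed

lemma fun_calc_eigen:
  fixes A :: "'a::chilbert_space \<Rightarrow>\<^sub>L 'a"
  assumes A: "posop A" and f: "continuous_on {0..norm A} f" and x: "A x = s *\<^sub>R x"
  shows "fun_calc f A x = f s *\<^sub>R x"
proof (cases "x = 0")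
  case False
  have "0 \<le> s * (x \<bullet> x)" using posop_nonneg[OF A, of x] x by simp
  moreover have "0 < x \<bullet> x" using False by simp
  ultimately have "0 \<le> s" by (simp add: zero_le_mult_iff)
  moreover have "\<bar>s\<bar> * norm x \<le> norm A * norm x" using norm_blinfun[of A x] x by simp
  then have "\<bar>s\<bar> \<le> norm A" using False by simp
  ultimately have s: "s \<in> {0..norm A}" by simp
  obtain p where p: "uniform_limit {0..norm A} (\<lambda>n. poly (p n)) f sequentially"
    using ex_poly_uniform_limit[OF f] by blast
  have "(\<lambda>n. poly_op (p n) A x) \<longlonglongrightarrow> fun_calc f A x"
    by (intro tendsto_intros fun_calc_tendsto[OF A] p)
  moreover have "(\<lambda>n. poly_op (p n) A x) \<longlonglongrightarrow> f s *\<^sub>R x"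
    unfolding poly_op_eigen[OF x] by (intro tendsto_intros tendsto_uniform_limitI[OF p s])
  ultimately show ?thesis by (rule LIMSEQ_unique)
qed (simp add: blinfun.zero_right)

lemma fun_calc_norm_le:
  fixes A :: "'a::chilbert_space \<Rightarrow>\<^sub>L 'a"
  assumes A: "posop A" and f: "continuous_on {0..norm A} f"
    and nonneg: "\<And>t. t \<in> {0..norm A} \<Longrightarrow> 0 \<le> f t" and le: "\<And>t. t \<in> {0..norm A} \<Longrightarrow> f t \<le> c"
  shows "norm (fun_calc f A) \<le> c"
proof (rule posop_norm_le[OF fun_calc_posop[OF A f nonneg]])
  show "0 \<le> c" using nonneg[of 0] le[of 0] by simp
  have "posop (fun_calc (\<lambda>t. c - f t) A)"
    using f le by (intro fun_calc_posop A continuous_intros) auto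
  also have "fun_calc (\<lambda>t. c - f t) A = c *\<^sub>R id_blinfun - fun_calc f A"
    using f by (simp add: fun_calc_diff[OF A] fun_calc_const[OF A])
  finally have "0 \<le> (c *\<^sub>R id_blinfun - fun_calc f A) x \<bullet> x" for x by (rule posop_nonneg)
  then show "fun_calc f A x \<bullet> x \<le> c * (norm x)\<^sup>2" for x
    by (simp add: blinfun.bilinear_simps inner_diff power2_norm_eq_inner)
qed

section \<open>Complex-linear operators\<close>

lemma Re_cinner: "Re (cinner x y) = x \<bullet> y"
  by (simp add: inner_Re_cinner)

lemma Im_cinner: "Im (cinner x y) = - ((\<i> *\<^sub>C x) \<bullet> y)"
  by (simp add: inner_Re_cinner cinner_scaleC_left)

lemma cinner_scaleC_right: "cinner x (c *\<^sub>C y) = cnj c * cinner x y"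
  using cinner_commute[of x "c *\<^sub>C y"] cinner_commute[of x y] by (simp add: cinner_scaleC_left)

lemma inner_scaleC_left: "(c *\<^sub>C x) \<bullet> y = x \<bullet> (cnj c *\<^sub>C y)"
  by (simp add: inner_Re_cinner cinner_scaleC_left cinner_scaleC_right)

lemma scaleC_0_right [simp]: "c *\<^sub>C 0 = (0::'a::chilbert_space)"
  using scaleC_add_right[of c 0 "0::'a"] by simp

lemma scaleC_minus_right: "c *\<^sub>C (- x) = - (c *\<^sub>C x)" for x :: "'a::chilbert_space"
  using scaleC_add_right[of c x "- x"] by (simp add: eq_neg_iff_add_eq_0 add.commute)

lemma scaleC_diff_right: "c *\<^sub>C (x - y) = c *\<^sub>C x - c *\<^sub>C y" for x :: "'a::chilbert_space"
  using scaleC_add_right[of c x "- y"] by (simp add: scaleC_minus_right)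

lemma scaleC_1 [simp]: "1 *\<^sub>C x = (x::'a::chilbert_space)"
  using scaleR_scaleC[of 1 x] by simp

lemma scaleC_scaleR: "c *\<^sub>C (r *\<^sub>R x) = r *\<^sub>R (c *\<^sub>C x)" for x :: "'a::chilbert_space"
  by (simp add: scaleR_scaleC scaleC_scaleC mult.commute)

lemma norm_scaleC: "norm (c *\<^sub>C x) = cmod c * norm (x::'a::chilbert_space)"
proof -
  have "(c *\<^sub>C x) \<bullet> (c *\<^sub>C x) = ((cmod c)\<^sup>2) * (x \<bullet> x)"
  proof -
    have "cnj c * c = of_real ((cmod c)\<^sup>2)" using complex_norm_square[of c] by (simp only: mult.commute)
    then show ?thesis unfolding inner_scaleC_left scaleC_scaleC by (simp only: scaleR_scaleC[symmetric] inner_scaleR_right)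
  qed
  then have "(norm (c *\<^sub>C x))\<^sup>2 = (cmod c * norm x)\<^sup>2"
    by (simp add: power2_norm_eq_inner power_mult_distrib)
  then show ?thesis by (simp add: power2_eq_iff_nonneg)
qed

lemma bounded_linear_scaleC: "bounded_linear (\<lambda>x::'a::chilbert_space. c *\<^sub>C x)"
  by (rule bounded_linear_intro[where K="cmod c"])
    (auto simp: scaleC_add_right scaleC_scaleR norm_scaleC mult.commute)

lemmas tendsto_scaleC = bounded_linear.tendsto[OF bounded_linear_scaleC]

lemma clinear_opD: "clinear_op A \<Longrightarrow> A (c *\<^sub>C x) = c *\<^sub>C A x"
  by (simp add: clinear_op_def)

text \<open>Complex linearity is a commutation property, so it passes to square roots and to the functional
  calculus.\<close>

lemma clinear_op_iff_commute:
  fixes A :: "'a::chilbert_space \<Rightarrow>\<^sub>L 'a"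
  shows "clinear_op A \<longleftrightarrow> (\<forall>c. Blinfun ((*\<^sub>C) c) o\<^sub>L A = A o\<^sub>L Blinfun ((*\<^sub>C) c))"
proof -
  have sc: "blinfun_apply (Blinfun ((*\<^sub>C) c)) x = c *\<^sub>C x" for c and x :: 'a
    by (simp add: bounded_linear_Blinfun_apply bounded_linear_scaleC)
  show ?thesis
  proof
    show "\<forall>c. Blinfun ((*\<^sub>C) c) o\<^sub>L A = A o\<^sub>L Blinfun ((*\<^sub>C) c)" if "clinear_op A"
      using that by (auto intro!: blinfun_eqI simp: sc clinear_opD)
    show "clinear_op A" if *: "\<forall>c. Blinfun ((*\<^sub>C) c) o\<^sub>L A = A o\<^sub>L Blinfun ((*\<^sub>C) c)"
      unfolding clinear_op_def
    proof (intro allI)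
      fix c x
      have "(Blinfun ((*\<^sub>C) c) o\<^sub>L A) x = (A o\<^sub>L Blinfun ((*\<^sub>C) c)) x" using * by simp
      then show "A (c *\<^sub>C x) = c *\<^sub>C A x" by (simp add: sc)
    qed
  qed
qed

lemma clinear_op_arith:
  fixes A B :: "'a::chilbert_space \<Rightarrow>\<^sub>L 'a"
  shows "clinear_op (id_blinfun :: 'a \<Rightarrow>\<^sub>L 'a)" "clinear_op (0 :: 'a \<Rightarrow>\<^sub>L 'a)"
    "clinear_op A \<Longrightarrow> clinear_op B \<Longrightarrow> clinear_op (A + B)"
    "clinear_op A \<Longrightarrow> clinear_op B \<Longrightarrow> clinear_op (A - B)"
    "clinear_op A \<Longrightarrow> clinear_op (r *\<^sub>R A)"
    "clinear_op A \<Longrightarrow> clinear_op B \<Longrightarrow> clinear_op (A o\<^sub>L B)"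
  by (auto simp: clinear_op_def blinfun.bilinear_simps scaleC_add_right scaleC_diff_right scaleC_scaleR)

lemma clinear_op_adj:
  assumes "clinear_op T"
  shows "clinear_op (adj T)"
  unfolding clinear_op_def
proof (intro allI, rule inner_ext)
  fix c x z
  have "z \<bullet> adj T (c *\<^sub>C x) = (cnj c *\<^sub>C T z) \<bullet> x"
    by (simp add: inner_adj[symmetric] inner_scaleC_left)
  also have "\<dots> = (cnj c *\<^sub>C z) \<bullet> adj T x" by (simp add: inner_adj[symmetric] clinear_opD[OF assms])
  also have "\<dots> = z \<bullet> (c *\<^sub>C adj T x)" by (simp add: inner_scaleC_left)
  finally show "z \<bullet> adj T (c *\<^sub>C x) = z \<bullet> (c *\<^sub>C adj T x)" .
qed

text \<open>The imaginary part of \<open>cinner\<close> is the real inner product after multiplication by \<open>\<i>\<close>.\<close>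

lemma cinner_transpose:
  fixes A B :: "'a::chilbert_space \<Rightarrow>\<^sub>L 'a"
  assumes "clinear_op A" "\<And>x y. A x \<bullet> y = x \<bullet> B y"
  shows "cinner (A x) y = cinner x (B y)"
proof -
  have "(\<i> *\<^sub>C A x) \<bullet> y = (\<i> *\<^sub>C x) \<bullet> B y" using assms by (simp flip: clinear_opD)
  then show ?thesis using assms(2) by (simp add: complex_eq_iff Im_cinner Re_cinner)
qed

lemma Bplus_iff: "A \<in> Bplus \<longleftrightarrow> clinear_op A \<and> posop A"
proof
  show "clinear_op A \<and> posop A" if "A \<in> Bplus"
    using that unfolding Bplus_def posop_def symop_def qform_def inner_Re_cinner by auto
  show "A \<in> Bplus" if "clinear_op A \<and> posop A"
    using that cinner_transpose[of A A] by (auto simp add: Bplus_def posop_def symop_def qform_def Re_cinner)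
qed

lemma BplusD:
  assumes "A \<in> Bplus"
  shows "clinear_op A" "posop A" "symop A"
  using assms by (simp_all add: Bplus_iff posop_symop)

lemma qform_eq: "qform A x = A x \<bullet> x"
  by (simp add: qform_def Re_cinner)

lemma Bplus_add: "A \<in> Bplus \<Longrightarrow> B \<in> Bplus \<Longrightarrow> A + B \<in> Bplus"
  and Bplus_scale: "A \<in> Bplus \<Longrightarrow> 0 \<le> c \<Longrightarrow> c *\<^sub>R A \<in> Bplus"
  by (simp_all add: Bplus_iff clinear_op_arith posop_arith)

lemma cadjoint_eq_adj:
  assumes "clinear_op T"
  shows "cadjoint T = adj T"
  unfolding cadjoint_def
proof (rule the_equality)
  show "\<forall>x y. cinner (T x) y = cinner x (adj T y)"
    using cinner_transpose[OF assms inner_adj] by blast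
  fix S :: "'a \<Rightarrow>\<^sub>L 'a" assume *: "\<forall>x y. cinner (T x) y = cinner x (S y)"
  have "T x \<bullet> y = x \<bullet> S y" for x y unfolding inner_Re_cinner using * by simp
  then show "S = adj T" using adj_eqI by metis
qed

lemma symop_eqI:
  assumes "symop A" "symop B" "\<And>x. A x \<bullet> x = B x \<bullet> x"
  shows "A = B"
proof (rule blinfun_eqI, rule inner_ext)
  fix x y
  define D where "D = A - B"
  have s: "symop D" unfolding D_def using assms by (intro symop_arith)
  have z: "D u \<bullet> u = 0" for u using assms(3)[of u] by (simp add: D_def blinfun.bilinear_simps inner_diff)
  have "D (x + y) \<bullet> (x + y) = 2 * (D x \<bullet> y)"
    using z[of x] z[of y] symopD[OF s, of x y]
    by (simp add: blinfun.bilinear_simps inner_add inner_commute)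
  then have "D x \<bullet> y = 0" using z by simp
  then have "y \<bullet> D x = 0" by (simp add: inner_commute)
  then show "y \<bullet> A x = y \<bullet> B x" by (simp add: D_def blinfun.bilinear_simps inner_diff)
qed

section \<open>Complex subspaces and orthogonal projections\<close>

text \<open>For these subspaces the complex and the real notion of orthogonal complement agree
  (\<open>ocomp_iff\<close> below).\<close>

definition csubspace :: "'a::chilbert_space set \<Rightarrow> bool"
  where "csubspace S \<longleftrightarrow> subspace S \<and> (\<forall>c. \<forall>x\<in>S. c *\<^sub>C x \<in> S)"

lemma csubspace_closure: "csubspace S \<Longrightarrow> csubspace (closure S)"
  unfolding csubspace_def
proof (intro conjI allI ballI)
  assume *: "subspace S \<and> (\<forall>c. \<forall>x\<in>S. c *\<^sub>C x \<in> S)"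
  then show "subspace (closure S)" by (simp add: subspace_closure)
  fix c x assume "x \<in> closure S"
  then obtain u where "\<And>n. u n \<in> S" "u \<longlonglongrightarrow> x" by (auto simp: closure_sequential)
  then show "c *\<^sub>C x \<in> closure S" unfolding closure_sequential
    using * by (intro exI[of _ "\<lambda>n. c *\<^sub>C u n"]) (auto intro: tendsto_scaleC)
qed

lemma csubspace_range: "clinear_op A \<Longrightarrow> csubspace (range A)"
  unfolding csubspace_def
proof (intro conjI allI ballI)
  show "subspace (range A)"
    by (intro linear_subspace_image) (auto intro: bounded_linear.linear blinfun.bounded_linear_right)
  show "c *\<^sub>C x \<in> range A" if "clinear_op A" "x \<in> range A" for c x
    using that by (auto simp flip: clinear_opD)
qed

lemma csubspace_vimage: "clinear_op A \<Longrightarrow> csubspace S \<Longrightarrow> csubspace {x. A x \<in> S}"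
  by (auto simp: csubspace_def subspace_def blinfun.bilinear_simps clinear_opD)

lemma csubspace_ker: "clinear_op A \<Longrightarrow> csubspace (ker A)"
  by (auto simp: csubspace_def subspace_def ker_def blinfun.bilinear_simps clinear_opD)

lemma closed_ker: "closed (ker A)"
  unfolding ker_def by (intro closed_Collect_eq continuous_intros)

lemma cinner_eq_0_iff: "cinner x y = 0 \<longleftrightarrow> x \<bullet> y = 0 \<and> (\<i> *\<^sub>C x) \<bullet> y = 0"
  by (simp add: complex_eq_iff Im_cinner Re_cinner)

lemma ocomp_iff:
  assumes "csubspace S"
  shows "x \<in> ocomp S \<longleftrightarrow> (\<forall>y\<in>S. x \<bullet> y = 0)"
proof -
  have "(\<i> *\<^sub>C x) \<bullet> y = 0" if "y \<in> S" "\<forall>y\<in>S. x \<bullet> y = 0" for y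
    using that assms by (simp add: inner_scaleC_left csubspace_def)
  then show ?thesis by (auto simp: ocomp_def cinner_eq_0_iff)
qed

lemma csubspace_ocomp: "csubspace (ocomp S)"
proof -
  have "cinner 0 y = 0" for y :: 'a
    using cinner_add_left[of 0 0 y] by simp
  then show ?thesis
    by (auto simp: csubspace_def subspace_def ocomp_def cinner_add_left cinner_scaleC_left scaleR_scaleC)
qed

lemma closed_ocomp: "closed (ocomp S)"
proof -
  have "ocomp S = (\<Inter>y\<in>S. {x. x \<bullet> y = 0} \<inter> {x. x \<bullet> (- \<i> *\<^sub>C y) = 0})"
    by (auto simp: ocomp_def cinner_eq_0_iff inner_scaleC_left)
  also have "closed \<dots>"
    by (intro closed_INT ballI closed_Int closed_Collect_eq continuous_intros)
  finally show ?thesis .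
qed

lemma ocomp_closure: "csubspace S \<Longrightarrow> ocomp (closure S) = ocomp S"
proof -
  assume S: "csubspace S"
  have "x \<in> ocomp (closure S)" if x: "x \<in> ocomp S" for x
    unfolding ocomp_iff[OF csubspace_closure[OF S]]
  proof
    fix y assume y: "y \<in> closure S"
    have "y \<bullet> x = 0" using x by (intro orthogonal_closure[OF _ y]) (simp add: ocomp_iff[OF S] inner_commute)
    then show "x \<bullet> y = 0" by (simp add: inner_commute)
  qed
  moreover have "ocomp (closure S) \<subseteq> ocomp S"
    using closure_subset[of S] by (auto simp: ocomp_def)
  ultimately show ?thesis by blast
qed

lemma closure_eq_ocomp_ocomp:
  assumes "csubspace S"
  shows "closure S = ocomp (ocomp S)"
proof
  show "closure S \<subseteq> ocomp (ocomp S)"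
  proof (rule closure_minimal[OF _ closed_ocomp])
    show "S \<subseteq> ocomp (ocomp S)"
    proof
      fix x assume "x \<in> S"
      then have "y \<bullet> x = 0" if "y \<in> ocomp S" for y using that by (simp add: ocomp_iff[OF assms])
      then show "x \<in> ocomp (ocomp S)" by (simp add: ocomp_iff[OF csubspace_ocomp] inner_commute)
    qed
  qed
  show "ocomp (ocomp S) \<subseteq> closure S"
  proof
    fix x assume x: "x \<in> ocomp (ocomp S)"
    show "x \<in> closure S"
    proof (rule in_closure_of_orthogonal)
      show "subspace S" using assms by (simp add: csubspace_def)
      fix y assume "\<And>k. k \<in> S \<Longrightarrow> k \<bullet> y = 0"
      then have "y \<in> ocomp S" by (simp add: ocomp_iff[OF assms] inner_commute)
      then show "x \<bullet> y = 0" using x by (simp add: ocomp_iff[OF csubspace_ocomp])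
    qed
  qed
qed

context
  fixes K :: "'a::chilbert_space set"
  assumes K: "csubspace K" "closed K"
begin

lemma proj_unique:
  assumes "p \<in> K" "q \<in> K" "x - p \<in> ocomp K" "x - q \<in> ocomp K"
  shows "p = q"
proof -
  have "p - q \<in> K" using K assms by (simp add: csubspace_def subspace_diff)
  then have "(x - p) \<bullet> (p - q) = 0" "(x - q) \<bullet> (p - q) = 0"
    using assms by (auto simp: ocomp_iff[OF K(1)])
  then have "(p - q) \<bullet> (p - q) = 0" by (simp add: inner_diff)
  then show ?thesis by simp
qed

lemma ex_proj: "\<exists>P :: 'a \<Rightarrow>\<^sub>L 'a. \<forall>x. P x \<in> K \<and> x - P x \<in> ocomp K"
proof -
  have sub: "subspace K" using K by (simp add: csubspace_def)
  have "\<exists>p. p \<in> K \<and> x - p \<in> ocomp K" for x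
    using ex_orthogonal_decomposition[OF sub K(2), of x] by (auto simp: ocomp_iff[OF K(1)])
  then obtain p where p: "\<And>x. p x \<in> K" "\<And>x. x - p x \<in> ocomp K" by metis
  have oc: "subspace (ocomp K)" using csubspace_ocomp by (auto simp: csubspace_def)
  have "bounded_linear p"
  proof (rule bounded_linear_intro[where K=1])
    fix x y and r :: real
    have "(x - p x) + (y - p y) \<in> ocomp K" using p oc subspace_add by blast
    then show "p (x + y) = p x + p y"
      using p sub by (intro proj_unique[of _ _ "x + y"]) (auto simp: subspace_add algebra_simps)
    have "r *\<^sub>R (x - p x) \<in> ocomp K" using p oc subspace_scale by blast
    then show "p (r *\<^sub>R x) = r *\<^sub>R p x"
      using p sub by (intro proj_unique[of _ _ "r *\<^sub>R x"]) (auto simp: subspace_scale algebra_simps)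
    have "(x - p x) \<bullet> p x = 0" using p by (simp add: ocomp_iff[OF K(1)])
    then have "norm (p x) * norm (p x) = x \<bullet> p x"
      by (simp add: inner_diff power2_norm_eq_inner flip: power2_eq_square)
    also have "\<dots> \<le> norm x * norm (p x)" by (rule norm_cauchy_schwarz)
    finally show "norm (p x) \<le> norm x * 1" by (cases "p x = 0") auto
  qed
  then show ?thesis using p by (intro exI[of _ "Blinfun p"]) (simp add: bounded_linear_Blinfun_apply)
qed

lemma proj_in: "proj K x \<in> K" and proj_diff: "x - proj K x \<in> ocomp K"
proof -
  obtain P :: "'a \<Rightarrow>\<^sub>L 'a" where P: "\<forall>x. P x \<in> K \<and> x - P x \<in> ocomp K" using ex_proj by blast
  have "\<forall>x. proj K x \<in> K \<and> x - proj K x \<in> ocomp K"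
    unfolding proj_def
  proof (rule theI[of _ P])
    fix Q :: "'a \<Rightarrow>\<^sub>L 'a" assume Q: "\<forall>x. Q x \<in> K \<and> x - Q x \<in> ocomp K"
    show "Q = P" using P Q proj_unique by (intro blinfun_eqI) blast
  qed (rule P)
  then show "proj K x \<in> K" "x - proj K x \<in> ocomp K" by auto
qed

lemma proj_eqI: "p \<in> K \<Longrightarrow> x - p \<in> ocomp K \<Longrightarrow> proj K x = p"
  using proj_unique proj_in proj_diff by blast

lemma proj_same: "x \<in> K \<Longrightarrow> proj K x = x"
  using csubspace_ocomp[of K] by (intro proj_eqI) (auto simp: csubspace_def subspace_0)

lemma proj_ocomp: "x \<in> ocomp K \<Longrightarrow> proj K x = 0"
  using K by (intro proj_eqI) (auto simp: csubspace_def subspace_0)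

lemma proj_eq_0_iff: "proj K x = 0 \<longleftrightarrow> x \<in> ocomp K"
  using proj_ocomp proj_diff[of x] by auto

lemma proj_inner: "proj K x \<bullet> y = proj K x \<bullet> proj K y"
proof -
  have "(y - proj K y) \<bullet> proj K x = 0" using proj_diff[of y] proj_in[of x] by (simp add: ocomp_iff[OF K(1)])
  then have "proj K x \<bullet> (y - proj K y) = 0" by (simp add: inner_commute)
  then show ?thesis by (simp add: inner_diff_right)
qed

lemma proj_symop: "symop (proj K)"
  unfolding symop_def
proof (intro allI)
  show "proj K x \<bullet> y = x \<bullet> proj K y" for x y
    using proj_inner[of x y] proj_inner[of y x] by (simp add: inner_commute)
qed

lemma proj_Bplus: "proj K \<in> Bplus"
proof -
  have "proj K (c *\<^sub>C x) = c *\<^sub>C proj K x" for c x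
  proof (rule proj_eqI)
    show "c *\<^sub>C proj K x \<in> K" using K proj_in by (simp add: csubspace_def)
    have "c *\<^sub>C (x - proj K x) \<in> ocomp K"
      using csubspace_ocomp[of K] proj_diff by (simp add: csubspace_def)
    then show "c *\<^sub>C x - c *\<^sub>C proj K x \<in> ocomp K" by (simp add: scaleC_diff_right)
  qed
  moreover have "0 \<le> proj K x \<bullet> x" for x using proj_inner[of x x] by simp
  ultimately show ?thesis using proj_symop by (simp add: Bplus_iff clinear_op_def posop_def)
qed

end

section \<open>Square roots and their pseudo-inverses\<close>

lemma sqrt_op_facts:
  assumes "A \<in> Bplus"
  shows "sqrt_op A \<in> Bplus \<and> sqrt_op A o\<^sub>L sqrt_op A = A \<and>
    (\<forall>C. C o\<^sub>L A = A o\<^sub>L C \<longrightarrow> C o\<^sub>L sqrt_op A = sqrt_op A o\<^sub>L C)"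
proof -
  obtain B where B: "posop B" "B o\<^sub>L B = A" "\<And>C. C o\<^sub>L A = A o\<^sub>L C \<Longrightarrow> C o\<^sub>L B = B o\<^sub>L C"
    using ex_posop_sqrt BplusD(2)[OF assms] by blast
  have "clinear_op B" using BplusD(1)[OF assms] B(3) by (simp add: clinear_op_iff_commute)
  then have BB: "B \<in> Bplus" using B(1) by (simp add: Bplus_iff)
  have "sqrt_op A = B" unfolding sqrt_op_def
  proof (rule the_equality)
    show "C = B" if "C \<in> Bplus \<and> C o\<^sub>L C = A" for C
      by (rule posop_sqrt_unique) (use that B(1,2) in \<open>auto simp: Bplus_iff\<close>)
  qed (use B(2) BB in simp)
  then show ?thesis using BB B(2,3) by blast
qed

lemma sqrt_op_Bplus: "A \<in> Bplus \<Longrightarrow> sqrt_op A \<in> Bplus"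
  and sqrt_op_square: "A \<in> Bplus \<Longrightarrow> sqrt_op A o\<^sub>L sqrt_op A = A"
  and sqrt_op_commute: "A \<in> Bplus \<Longrightarrow> C o\<^sub>L A = A o\<^sub>L C \<Longrightarrow> C o\<^sub>L sqrt_op A = sqrt_op A o\<^sub>L C"
  using sqrt_op_facts by blast+

lemma sqrt_op_eqI: "B \<in> Bplus \<Longrightarrow> B o\<^sub>L B = A \<Longrightarrow> A \<in> Bplus \<Longrightarrow> sqrt_op A = B"
  by (rule posop_sqrt_unique) (simp_all add: sqrt_op_square BplusD sqrt_op_Bplus)

lemma sqrt_op_apply: "A \<in> Bplus \<Longrightarrow> sqrt_op A (sqrt_op A x) = A x"
  by (metis sqrt_op_square blinfun_apply_blinfun_compose)

lemma norm_sqrt_op: "A \<in> Bplus \<Longrightarrow> (norm (sqrt_op A x))\<^sup>2 = A x \<bullet> x"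
  using symopD[OF BplusD(3)[OF sqrt_op_Bplus], of A "sqrt_op A x" x]
  by (simp add: power2_norm_eq_inner sqrt_op_apply)

lemma sqrt_op_eq_0_iff: "A \<in> Bplus \<Longrightarrow> sqrt_op A x = 0 \<longleftrightarrow> A x = 0"
  using sqrt_op_apply[of A x] norm_sqrt_op[of A x] by (auto simp: blinfun.zero_right)

lemma closure_range_sqrt_op: "A \<in> Bplus \<Longrightarrow> closure (range (sqrt_op A)) = closure (range A)"
  using closure_range_symop_iff[OF BplusD(3), of A] closure_range_symop_iff[OF BplusD(3)[OF sqrt_op_Bplus], of A]
  by (intro set_eqI) (simp add: sqrt_op_eq_0_iff)

lemma sqrt_op_inj_on_closure_range:
  assumes A: "A \<in> Bplus" and xy: "x \<in> closure (range A)" "y \<in> closure (range A)" "sqrt_op A x = sqrt_op A y"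
  shows "x = y"
proof -
  have "csubspace (closure (range A))" using A by (intro csubspace_closure csubspace_range BplusD)
  then have d: "x - y \<in> closure (range A)" using xy by (simp add: csubspace_def subspace_diff)
  have "sqrt_op A (x - y) = 0" using xy(3) by (simp add: blinfun.bilinear_simps)
  then have "A (x - y) = 0" using A by (simp add: sqrt_op_eq_0_iff)
  then have "(x - y) \<bullet> (x - y) = 0" using d closure_range_symop_iff[OF BplusD(3)[OF A]] by blast
  then show ?thesis by simp
qed

lemma inv_sqrt_eqI:
  assumes A: "A \<in> Bplus" and x: "x \<in> closure (range A)" "sqrt_op A x = y"
  shows "inv_sqrt A y = x"
  unfolding inv_sqrt_def using x sqrt_op_inj_on_closure_range[OF A] by (intro the_equality) auto

text \<open>Removing the component in the kernel does not change the image.\<close>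

lemma ex_preimage_in_closure_range:
  assumes A: "clinear_op A" "symop A"
  obtains z where "z \<in> closure (range A)" "A z = A x"
proof -
  have K: "csubspace (closure (range A))" "closed (closure (range A))"
    using A by (auto intro: csubspace_closure csubspace_range)
  define z where "z = proj (closure (range A)) x"
  have "x - z \<in> ocomp (closure (range A))" unfolding z_def by (rule proj_diff[OF K])
  then have "x - z \<in> ocomp (range A)" using A by (simp add: ocomp_closure csubspace_range)
  then have "(x - z) \<bullet> A y = 0" for y using A by (simp add: ocomp_iff csubspace_range)
  then have "A (x - z) \<bullet> A (x - z) = 0" by (simp add: symopD[OF A(2)])
  then have "A z = A x" by (simp add: blinfun.bilinear_simps)
  then show thesis using that[of z] proj_in[OF K] by (simp add: z_def)
qed

lemma inv_sqrt:
  assumes A: "A \<in> Bplus" and y: "y \<in> range (sqrt_op A)"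
  shows "inv_sqrt A y \<in> closure (range A)" "sqrt_op A (inv_sqrt A y) = y"
proof -
  obtain x where "y = sqrt_op A x" using y by blast
  then obtain z where "z \<in> closure (range (sqrt_op A))" "sqrt_op A z = y"
    using ex_preimage_in_closure_range[of "sqrt_op A" x] BplusD[OF sqrt_op_Bplus[OF A]] by metis
  then have z: "z \<in> closure (range A)" "sqrt_op A z = y" using A by (simp_all add: closure_range_sqrt_op)
  then have "inv_sqrt A y = z" using A by (intro inv_sqrt_eqI)
  then show "inv_sqrt A y \<in> closure (range A)" "sqrt_op A (inv_sqrt A y) = y" using z by auto
qed

lemma range_subset_of_adj_le:
  fixes A B :: "'a::real_hilbert \<Rightarrow>\<^sub>L 'a"
  assumes "\<And>f. norm (adj A f) \<le> norm (adj B f)"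
  shows "range A \<subseteq> range B"
proof -
  obtain T :: "'a \<Rightarrow>\<^sub>L 'a" where "A = B o\<^sub>L T" using douglas[of 1 A B] assms by auto
  then show ?thesis by auto
qed

text \<open>If \<open>A = B B*\<close>, then \<open>sqrt A f\<close> and \<open>B* f\<close> have equal norms, so Douglas factorization applies in both
  directions.\<close>

lemma range_sqrt_op_eq:
  assumes A: "A \<in> Bplus" and B: "B o\<^sub>L adj B = A"
  shows "range (sqrt_op A) = range B"
proof -
  have "norm (adj B f) = norm (sqrt_op A f)" for f
  proof -
    have "(norm (adj B f))\<^sup>2 = A f \<bullet> f"
      unfolding B[symmetric] power2_norm_eq_inner by (simp add: inner_adj inner_commute)
    then have "(norm (adj B f))\<^sup>2 = (norm (sqrt_op A f))\<^sup>2" using norm_sqrt_op[OF A, of f] by simp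
    then show ?thesis by (rule power2_eq_imp_eq) simp_all
  qed
  then show ?thesis
    using range_subset_of_adj_le[of B "sqrt_op A"] range_subset_of_adj_le[of "sqrt_op A" B]
      BplusD(3)[OF sqrt_op_Bplus[OF A]] by (simp add: symop_adj antisym)
qed

lemma range_sqrt_op_mono:
  assumes "A \<in> Bplus" "B \<in> Bplus" "\<And>x. A x \<bullet> x \<le> B x \<bullet> x"
  shows "range (sqrt_op A) \<subseteq> range (sqrt_op B)"
proof -
  have "norm (sqrt_op A f) \<le> norm (sqrt_op B f)" for f
    
    by (rule power2_le_imp_le) (use assms norm_sqrt_op[of A f] norm_sqrt_op[of B f] in auto)
  moreover have "adj (sqrt_op A) = sqrt_op A" "adj (sqrt_op B) = sqrt_op B"
    using assms BplusD(3)[OF sqrt_op_Bplus] by (simp_all add: symop_adj)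
  ultimately show ?thesis using range_subset_of_adj_le[of "sqrt_op A" "sqrt_op B"] by simp
qed

section \<open>Parallel sums\<close>

lemma par_sum_eqI:
  fixes P X G :: "'a::chilbert_space \<Rightarrow>\<^sub>L 'a"
  assumes P: "P \<in> Bplus"
    and lower: "\<And>h g. P h \<bullet> h \<le> X (h - g) \<bullet> (h - g) + G g \<bullet> g"
    and approx: "\<And>h e. 0 < e \<Longrightarrow> \<exists>g. X (h - g) \<bullet> (h - g) + G g \<bullet> g < P h \<bullet> h + e"
  shows "par_sum X G = P"
proof -
  have inf: "qform P h = Inf {qform X f + qform G g | f g. h = f + g}" for h
  proof (rule cInf_eq_non_empty[symmetric])
    show "{qform X f + qform G g | f g. h = f + g} \<noteq> {}" by (auto intro: exI[of _ h] exI[of _ 0])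
    fix v assume "v \<in> {qform X f + qform G g | f g. h = f + g}"
    then obtain f g where v: "v = qform X f + qform G g" and h: "h = f + g" by blast
    show "qform P h \<le> v" using lower[of h g] by (simp add: qform_eq v h)
  next
    fix y assume y: "\<And>v. v \<in> {qform X f + qform G g | f g. h = f + g} \<Longrightarrow> y \<le> v"
    have "y \<le> X (h - g) \<bullet> (h - g) + G g \<bullet> g" for g
    proof (rule y, unfold mem_Collect_eq, intro exI conjI)
      show "h = (h - g) + g" by simp
    qed (simp add: qform_eq)
    note y_le = this
    have "y \<le> qform P h + e" if e: "0 < e" for e
    proof -
      obtain g where "X (h - g) \<bullet> (h - g) + G g \<bullet> g < P h \<bullet> h + e" using approx[OF e] by blast
      then show ?thesis using y_le[of g] by (simp add: qform_eq)
    qed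
    then show "y \<le> qform P h" by (rule field_le_epsilon)
  qed
  show ?thesis unfolding par_sum_def
  proof (rule the_equality)
    fix Q assume Q: "Q \<in> Bplus \<and> (\<forall>h. qform Q h = Inf {qform X f + qform G g | f g. h = f + g})"
    have "Q x \<bullet> x = P x \<bullet> x" for x using Q inf[of x] by (simp add: qform_eq)
    then show "Q = P" using P Q by (intro symop_eqI BplusD) auto
  qed (use P inf in simp)
qed

lemma Bplus_sandwich: "A \<in> Bplus \<Longrightarrow> R \<in> Bplus \<Longrightarrow> R o\<^sub>L A o\<^sub>L R \<in> Bplus"
  by (simp add: Bplus_iff posop_sandwich posop_symop clinear_op_arith)

lemma fun_calc_Bplus:
  assumes "A \<in> Bplus" "continuous_on {0..norm A} f" "\<And>t. t \<in> {0..norm A} \<Longrightarrow> 0 \<le> f t"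
  shows "fun_calc f A \<in> Bplus"
  using assms fun_calc_posop[of A f] fun_calc_commute[of A f]
  by (simp add: Bplus_iff clinear_op_iff_commute)

section \<open>The iteration in the coordinates of the sum\<close>

context
  fixes R K :: "'a::chilbert_space \<Rightarrow>\<^sub>L 'a"
  assumes R: "R \<in> Bplus" and K: "K \<in> Bplus" and K1: "norm K \<le> 1"
    and kerRK: "\<And>z. R z = 0 \<Longrightarrow> K z = 0"
begin

text \<open>On the kernel of \<open>R\<close> the operator \<open>K\<close> vanishes, so \<open>f(K)\<close> acts there as the scalar \<open>f 0\<close>; by
  symmetry it preserves the orthogonal complement as well.\<close>

lemma fun_calc_closure_range:
  assumes f: "continuous_on {0..norm K} f" and x: "x \<in> closure (range R)"
  shows "fun_calc f K x \<in> closure (range R)"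
proof -
  have "fun_calc f K x \<bullet> y = 0" if "R y = 0" for y
  proof -
    have "K y = 0 *\<^sub>R y" using kerRK[OF that] by simp
    then have "fun_calc f K y = f 0 *\<^sub>R y" by (rule fun_calc_eigen[OF BplusD(2)[OF K] f])
    then have "fun_calc f K x \<bullet> y = f 0 * (x \<bullet> y)"
      using symopD[OF fun_calc_symop[OF BplusD(2)[OF K] f], of x y] by simp
    also have "x \<bullet> y = 0" using x that closure_range_symop_iff[OF BplusD(3)[OF R]] by blast
    finally show ?thesis by simp
  qed
  then show ?thesis using closure_range_symop_iff[OF BplusD(3)[OF R]] by blast
qed

text \<open>Completing the square. With \<open>F = f(K)\<close>, \<open>M = F + 1 - K\<close> and \<open>W\<close> the inverse of \<open>M\<close>, the quantity to
  minimize is \<open>C u \<bullet> u + M (v - W F u) \<bullet> (v - W F u)\<close>, where \<open>C = F (1 - K) W\<close>, \<open>u = R h\<close> and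
  \<open>v = R g\<close>. The optimal \<open>v = W F u\<close> need not be in the range of \<open>R\<close> but is in its closure, which is
  enough for the infimum.\<close>

lemma par_sum_coordinates:
  assumes f: "continuous_on {0..norm K} f" and f0: "\<And>t. t \<in> {0..norm K} \<Longrightarrow> 0 \<le> f t"
    and pos: "\<And>t. t \<in> {0..norm K} \<Longrightarrow> 0 < f t + (1 - t)"
  shows "par_sum (R o\<^sub>L fun_calc f K o\<^sub>L R) (R o\<^sub>L (id_blinfun - K) o\<^sub>L R) =
    R o\<^sub>L fun_calc (\<lambda>t. f t * (1 - t) / (f t + (1 - t))) K o\<^sub>L R"
proof -
  have pK: "posop K" using K by (rule BplusD)
  define F where "F = fun_calc f K"
  define W where "W = fun_calc (\<lambda>t. 1 / (f t + (1 - t))) K"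
  define c where "c = (\<lambda>t. f t * (1 - t) / (f t + (1 - t)))"
  define C where "C = fun_calc c K"
  define M where "M = F + (id_blinfun - K)"
  have ne: "\<And>t. t \<in> {0..norm K} \<Longrightarrow> f t + (1 - t) \<noteq> 0" using pos by fastforce
  have cm: "continuous_on {0..norm K} (\<lambda>t. f t + (1 - t))" using f by (intro continuous_intros)
  have cw: "continuous_on {0..norm K} (\<lambda>t. 1 / (f t + (1 - t)))"
    by (rule continuous_on_divide[OF continuous_on_const cm]) (use ne in blast)
  have cc: "continuous_on {0..norm K} c" unfolding c_def
    by (rule continuous_on_divide[OF _ cm], intro continuous_intros f) (use ne in blast)
  have cwf: "continuous_on {0..norm K} (\<lambda>t. 1 / (f t + (1 - t)) * f t)"
    by (rule continuous_on_mult[OF cw f])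
  have sub: "fun_calc (\<lambda>t. 1 - t) K = id_blinfun - K"
    by (simp add: fun_calc_diff[OF pK] fun_calc_const[OF pK] fun_calc_id[OF pK])
  have M: "M = fun_calc (\<lambda>t. f t + (1 - t)) K"
    unfolding M_def F_def sub[symmetric]
    by (rule fun_calc_add[OF pK f, symmetric]) (intro continuous_intros)
  have posM: "posop M" unfolding M using pos less_imp_le by (intro fun_calc_posop pK cm) blast
  have "M o\<^sub>L W = fun_calc (\<lambda>t. (f t + (1 - t)) * (1 / (f t + (1 - t)))) K"
    unfolding M W_def by (rule fun_calc_mult[OF pK cm cw, symmetric])
  also have "\<dots> = fun_calc (\<lambda>t. 1) K" using ne by (intro fun_calc_cong) simp
  finally have MW: "M (W x) = x" for x
    by (metis fun_calc_const[OF pK] blinfun_apply_blinfun_compose blinfun_apply_id_blinfun id_apply scaleR_one)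
  have WF: "W o\<^sub>L F = fun_calc (\<lambda>t. 1 / (f t + (1 - t)) * f t) K"
    unfolding W_def F_def by (rule fun_calc_mult[OF pK cw f, symmetric])
  have "F o\<^sub>L (W o\<^sub>L F) = fun_calc (\<lambda>t. f t * (1 / (f t + (1 - t)) * f t)) K"
    unfolding WF unfolding F_def by (rule fun_calc_mult[OF pK f cwf, symmetric])
  moreover have "continuous_on {0..norm K} (\<lambda>t. f t * (1 / (f t + (1 - t)) * f t))"
    by (rule continuous_on_mult[OF f cwf])
  ultimately have "C + (F o\<^sub>L (W o\<^sub>L F)) = fun_calc (\<lambda>t. c t + f t * (1 / (f t + (1 - t)) * f t)) K"
    unfolding C_def using cc by (simp add: fun_calc_add[OF pK])
  also have "\<dots> = F" unfolding F_def
  proof (rule fun_calc_cong)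
    fix t assume "t \<in> {0..norm K}"
    then have m: "f t + (1 - t) \<noteq> 0" by (rule ne)
    have "c t + f t * (1 / (f t + (1 - t)) * f t) = (f t * (f t + (1 - t))) / (f t + (1 - t))"
      unfolding c_def by (simp add: add_divide_distrib[symmetric] algebra_simps)
    then show "c t + f t * (1 / (f t + (1 - t)) * f t) = f t" using m by simp
  qed
  finally have CF: "C u + F (W (F u)) = F u" for u
    by (metis blinfun.add_left blinfun_apply_blinfun_compose)
  have sF: "symop F" and sW: "symop W"
    unfolding F_def W_def using f cw by (auto intro: fun_calc_symop pK)
  have key: "F (u - v) \<bullet> (u - v) + (id_blinfun - K) v \<bullet> v =
      C u \<bullet> u + M (v - W (F u)) \<bullet> (v - W (F u))" for u v
  proof -
    have "M (v - W (F u)) \<bullet> (v - W (F u)) = (M v - F u) \<bullet> (v - W (F u))"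
      by (simp add: blinfun.diff_right MW)
    also have "\<dots> = M v \<bullet> v - F u \<bullet> v - M v \<bullet> W (F u) + F u \<bullet> W (F u)"
      by (simp add: inner_diff)
    also have "M v \<bullet> W (F u) = F u \<bullet> v"
      using symopD[OF posop_symop[OF posM], of v "W (F u)"] by (simp add: MW inner_commute)
    also have "F u \<bullet> W (F u) = F u \<bullet> u - C u \<bullet> u"
    proof -
      have "F u \<bullet> W (F u) = F (W (F u)) \<bullet> u"
        using symopD[OF sF, of "W (F u)" u] by (simp add: inner_commute)
      also have "F (W (F u)) = F u - C u" using CF[of u] by (simp add: algebra_simps)
      finally show ?thesis by (simp add: inner_diff)
    qed
    finally show ?thesis
      using symopD[OF sF, of v u] by (simp add: M_def blinfun.bilinear_simps inner_diff inner_add inner_commute)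
  qed
  have "par_sum (R o\<^sub>L F o\<^sub>L R) (R o\<^sub>L (id_blinfun - K) o\<^sub>L R) = R o\<^sub>L C o\<^sub>L R"
  proof (rule par_sum_eqI)
    have "C \<in> Bplus" unfolding C_def
    proof (rule fun_calc_Bplus[OF K cc])
      fix t assume t: "t \<in> {0..norm K}"
      then show "0 \<le> c t" unfolding c_def using f0[OF t] pos[OF t] K1 by simp
    qed
    then show "R o\<^sub>L C o\<^sub>L R \<in> Bplus" using R by (rule Bplus_sandwich)
    have RR: "(R o\<^sub>L A o\<^sub>L R) x \<bullet> x = A (R x) \<bullet> R x" for A x
      using symopD[OF BplusD(3)[OF R]] by simp
    have form: "(R o\<^sub>L F o\<^sub>L R) (h - g) \<bullet> (h - g) + (R o\<^sub>L (id_blinfun - K) o\<^sub>L R) g \<bullet> g =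
        (R o\<^sub>L C o\<^sub>L R) h \<bullet> h + M (R g - W (F (R h))) \<bullet> (R g - W (F (R h)))" for h g
      unfolding RR blinfun.diff_right[of R] by (rule key)
    show "(R o\<^sub>L C o\<^sub>L R) h \<bullet> h \<le> (R o\<^sub>L F o\<^sub>L R) (h - g) \<bullet> (h - g) + (R o\<^sub>L (id_blinfun - K) o\<^sub>L R) g \<bullet> g"
      for h g unfolding form using posop_nonneg[OF posM] by simp
    fix h and e :: real assume "0 < e"
    have "(W o\<^sub>L F) (R h) \<in> closure (range R)" unfolding WF
      by (rule fun_calc_closure_range[OF cwf]) (rule subsetD[OF closure_subset], rule rangeI)
    then obtain v where v: "\<And>n. v n \<in> range R" "v \<longlonglongrightarrow> W (F (R h))"
      by (auto simp: closure_sequential)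
    have "(\<lambda>n. M (v n - W (F (R h))) \<bullet> (v n - W (F (R h)))) \<longlonglongrightarrow>
        M (W (F (R h)) - W (F (R h))) \<bullet> (W (F (R h)) - W (F (R h)))"
      by (intro tendsto_intros v)
    then have "(\<lambda>n. M (v n - W (F (R h))) \<bullet> (v n - W (F (R h)))) \<longlonglongrightarrow> 0"
      by (simp add: blinfun.zero_right)
    then have "\<forall>\<^sub>F n in sequentially. M (v n - W (F (R h))) \<bullet> (v n - W (F (R h))) < e"
      using \<open>0 < e\<close> by (rule order_tendstoD)
    then obtain n where n: "M (v n - W (F (R h))) \<bullet> (v n - W (F (R h))) < e"
      by (auto simp: eventually_sequentially)
    obtain g where "v n = R g" using v(1) by blast
    then show "\<exists>g. (R o\<^sub>L F o\<^sub>L R) (h - g) \<bullet> (h - g) + (R o\<^sub>L (id_blinfun - K) o\<^sub>L R) g \<bullet> g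
        < (R o\<^sub>L C o\<^sub>L R) h \<bullet> h + e"
      unfolding form using n by (intro exI[of _ g]) simp
  qed
  then show ?thesis by (simp add: F_def C_def c_def)
qed

end

text \<open>The scalar iteration: \<open>x \<mapsto> x - x : g\<close> with \<open>g = 1 - t\<close>, started at \<open>x = t\<close>.\<close>

primrec iter_fun :: "nat \<Rightarrow> real \<Rightarrow> real" where
  "iter_fun 0 t = t"
| "iter_fun (Suc n) t = (iter_fun n t)\<^sup>2 / (iter_fun n t + (1 - t))"

lemma iter_fun_bounds:
  assumes "0 \<le> t" "t \<le> 1"
  shows "0 \<le> iter_fun n t" "iter_fun n t \<le> t ^ Suc n" "0 < iter_fun n t + (1 - t)"
proof -
  have one: "iter_fun n 1 = 1" for n by (induction n) auto
  have "0 \<le> iter_fun n t \<and> iter_fun n t \<le> t ^ Suc n \<and> 0 < iter_fun n t + (1 - t)"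
  proof (cases "t = 1")
    case True
    then show ?thesis by (simp add: one)
  next
    case False
    then have t: "t < 1" using assms by simp
    show ?thesis
    proof (induction n)
      case 0
      then show ?case using assms by simp
    next
      case (Suc n)
      let ?f = "iter_fun n t"
      have le: "?f \<le> t"
        using Suc mult_left_mono[of "t ^ n" 1 t] power_le_one[of t n] assms by simp
      have "0 \<le> (t - ?f) * (1 - t)" using le t by simp
      then have "?f \<le> t * (?f + (1 - t))" by (simp add: algebra_simps)
      then have "?f / (?f + (1 - t)) \<le> t" using Suc by (simp add: field_simps)
      then have "?f * (?f / (?f + (1 - t))) \<le> t ^ Suc n * t"
        using Suc assms by (intro mult_mono) auto
      then have "iter_fun (Suc n) t \<le> t ^ Suc (Suc n)"
        by (simp add: power2_eq_square mult_ac)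
      moreover have "0 \<le> iter_fun (Suc n) t" using Suc by simp
      ultimately show ?case using t by simp
    qed
  qed
  then show "0 \<le> iter_fun n t" "iter_fun n t \<le> t ^ Suc n" "0 < iter_fun n t + (1 - t)" by auto
qed

lemma iter_fun_1: "iter_fun n 1 = 1"
  by (induction n) auto

lemma iter_fun_continuous: "continuous_on {0..1} (iter_fun n)"
proof (induction n)
  case 0
  have "iter_fun 0 = (\<lambda>t. t)" by (rule ext) simp
  then show ?case by simp
next
  case (Suc n)
  have "continuous_on {0..1} (\<lambda>t. (iter_fun n t)\<^sup>2 / (iter_fun n t + (1 - t)))"
    using Suc iter_fun_bounds(3)[of _ n] by (intro continuous_intros) (auto simp: order_less_le)
  moreover have "iter_fun (Suc n) = (\<lambda>t. (iter_fun n t)\<^sup>2 / (iter_fun n t + (1 - t)))" by (rule ext) simp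
  ultimately show ?case by simp
qed

text \<open>The sum of \<open>t ^ i * (1 - t)\<close> over \<open>i \<le> n\<close> telescopes to at most \<open>1\<close>, and \<open>t ^ n * (1 - t)\<close> is the
  smallest of these \<open>n + 1\<close> terms.\<close>

lemma power_mult_one_minus_le:
  assumes "0 \<le> t" "t \<le> (1::real)"
  shows "t ^ n * (1 - t) \<le> 1 / real (Suc n)"
proof -
  have "real (Suc n) * t ^ n = (\<Sum>i<Suc n. t ^ n)" by simp
  also have "\<dots> \<le> (\<Sum>i<Suc n. t ^ i)"
    using assms by (intro sum_mono power_decreasing) auto
  finally have "(1 - t) * (real (Suc n) * t ^ n) \<le> (1 - t) * (\<Sum>i<Suc n. t ^ i)"
    using assms by (intro mult_left_mono) auto
  also have "\<dots> = 1 - t ^ Suc n" by (rule one_diff_power_eq[symmetric])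
  also have "\<dots> \<le> 1" using assms by simp
  finally show ?thesis by (simp add: field_simps)
qed

lemma tendsto_0_on_closure:
  fixes F :: "nat \<Rightarrow> 'a::real_normed_vector \<Rightarrow>\<^sub>L 'b::real_normed_vector"
  assumes F: "\<And>n. norm (F n) \<le> c" and S: "\<And>x. x \<in> S \<Longrightarrow> (\<lambda>n. F n x) \<longlonglongrightarrow> 0" and x: "x \<in> closure S"
  shows "(\<lambda>n. F n x) \<longlonglongrightarrow> 0"
proof (rule tendstoI)
  fix e :: real assume e: "0 < e"
  have c: "0 \<le> c" using F[of 0] norm_ge_zero order_trans by blast
  have "0 < e / (2 * (c + 1))" using e c by simp
  then obtain y where y: "y \<in> S" "dist y x < e / (2 * (c + 1))"
    using x by (auto simp: closure_approachable)
  have "\<forall>\<^sub>F n in sequentially. dist (F n y) 0 < e / 2"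
    using S[OF y(1)] e by (intro tendstoD) auto
  then show "\<forall>\<^sub>F n in sequentially. dist (F n x) 0 < e"
  proof eventually_elim
    case (elim n)
    have "norm (F n (x - y)) \<le> c * norm (x - y)"
      by (rule order_trans[OF norm_blinfun mult_right_mono[OF F norm_ge_zero]])
    also have "\<dots> \<le> (c + 1) * norm (x - y)" by (intro mult_right_mono) auto
    also have "\<dots> \<le> e / 2" using y(2) c e by (simp add: dist_norm norm_minus_commute field_simps)
    finally have "norm (F n (x - y)) \<le> e / 2" .
    moreover have "F n x = F n y + F n (x - y)" by (simp add: blinfun.diff_right)
    ultimately show ?case using elim norm_triangle_ineq[of "F n y" "F n (x - y)"] by (simp add: dist_norm)
  qed
qed

context
  fixes K :: "'a::chilbert_space \<Rightarrow>\<^sub>L 'a"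
  assumes K: "K \<in> Bplus" and K1: "norm K \<le> 1"
begin

lemma iter_fun_continuous': "continuous_on {0..norm K} (iter_fun n)"
  using iter_fun_continuous by (rule continuous_on_subset) (use K1 in auto)

text \<open>On \<open>ker (1 - K)\<close> the iterates act as the identity. On the range of \<open>1 - K\<close>, dense in the
  orthogonal complement, they tend to \<open>0\<close> because \<open>iter_fun n t * (1 - t)\<close> is at most \<open>1 / (n + 1)\<close>.\<close>

lemma fun_calc_iter_fun_tendsto:
  "(\<lambda>n. fun_calc (iter_fun n) K x) \<longlonglongrightarrow> proj (ker (id_blinfun - K)) x"
proof -
  define E where "E = ker (id_blinfun - K)"
  have cl: "clinear_op (id_blinfun - K)" using K by (intro clinear_op_arith BplusD)
  have sym: "symop (id_blinfun - K)" using K by (intro symop_arith BplusD)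
  have E: "csubspace E" "closed E" unfolding E_def using cl by (auto intro: csubspace_ker closed_ker)
  have pK: "posop K" using K by (rule BplusD)
  note cont = iter_fun_continuous'
  let ?F = "\<lambda>n. fun_calc (iter_fun n) K"
  have fixE: "?F n (proj E x) = proj E x" for n
  proof -
    have "(id_blinfun - K) (proj E x) = 0" using proj_in[OF E, of x] by (simp add: E_def ker_def)
    then have "K (proj E x) = 1 *\<^sub>R proj E x" by (simp add: blinfun.bilinear_simps)
    from fun_calc_eigen[OF pK cont this] show ?thesis by (simp add: iter_fun_1)
  qed
  have "(\<lambda>n. ?F n (x - proj E x)) \<longlonglongrightarrow> 0"
  proof (rule tendsto_0_on_closure)
    show "norm (?F n) \<le> 1" for n
    proof (rule fun_calc_norm_le[OF pK cont])
      fix t assume "t \<in> {0..norm K}"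
      then have t: "0 \<le> t" "t \<le> 1" using K1 by auto
      show "0 \<le> iter_fun n t" using t by (rule iter_fun_bounds)
      show "iter_fun n t \<le> 1" using iter_fun_bounds(2)[OF t, of n] power_le_one[OF t, of "Suc n"] by simp
    qed
    have "(x - proj E x) \<bullet> y = 0" if "(id_blinfun - K) y = 0" for y
      using proj_diff[OF E, of x] that by (simp add: ocomp_iff[OF E(1)]) (simp add: E_def ker_def)
    then show "x - proj E x \<in> closure (range (id_blinfun - K))"
      using closure_range_symop_iff[OF sym] by blast
    fix y assume "y \<in> range (id_blinfun - K)"
    then obtain z where z: "y = (id_blinfun - K) z" by blast
    have sub: "id_blinfun - K = fun_calc (\<lambda>t. 1 - t) K"
      by (simp add: fun_calc_diff[OF pK] fun_calc_const[OF pK] fun_calc_id[OF pK])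
    have Fy: "?F n y = fun_calc (\<lambda>t. iter_fun n t * (1 - t)) K z" for n
      unfolding z sub using cont by (subst fun_calc_mult[OF pK]) (auto intro!: continuous_intros)
    have bound: "norm (?F n y) \<le> inverse (real (Suc n)) * norm z" for n
    proof -
      have "norm (fun_calc (\<lambda>t. iter_fun n t * (1 - t)) K) \<le> inverse (real (Suc n))"
      proof (rule fun_calc_norm_le[OF pK])
        show "continuous_on {0..norm K} (\<lambda>t. iter_fun n t * (1 - t))"
          using cont by (intro continuous_intros)
        fix t assume "t \<in> {0..norm K}"
        then have t: "0 \<le> t" "t \<le> 1" using K1 by auto
        show "0 \<le> iter_fun n t * (1 - t)" using iter_fun_bounds(1)[OF t] t by simp
        have "iter_fun n t \<le> t ^ n"
          using iter_fun_bounds(2)[OF t, of n] t mult_right_mono[of t 1 "t ^ n"] by simp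
        then have "iter_fun n t * (1 - t) \<le> t ^ n * (1 - t)" using t by (intro mult_right_mono) auto
        then show "iter_fun n t * (1 - t) \<le> inverse (real (Suc n))"
          using power_mult_one_minus_le[OF t, of n] by (simp add: inverse_eq_divide)
      qed
      then show ?thesis unfolding Fy
        by (rule order_trans[OF norm_blinfun mult_right_mono[OF _ norm_ge_zero]])
    qed
    have lim: "(\<lambda>n. inverse (real (Suc n)) * norm z) \<longlonglongrightarrow> 0"
      using tendsto_mult_left_zero[OF LIMSEQ_inverse_real_of_nat] by blast
    show "(\<lambda>n. ?F n y) \<longlonglongrightarrow> 0"
      by (rule Lim_null_comparison[OF _ lim], rule always_eventually, rule allI, rule bound)
  qed
  then have "(\<lambda>n. proj E x + ?F n (x - proj E x)) \<longlonglongrightarrow> proj E x + 0"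
    by (intro tendsto_intros)
  moreover have "proj E x + ?F n (x - proj E x) = ?F n x" for n
    by (simp add: blinfun.diff_right fixE)
  ultimately show ?thesis by (simp add: E_def)
qed

lemma mu_iterates_coordinates:
  assumes R: "R \<in> Bplus" and kerRK: "\<And>z. R z = 0 \<Longrightarrow> K z = 0"
    and X: "X = R o\<^sub>L K o\<^sub>L R" and G: "G = R o\<^sub>L (id_blinfun - K) o\<^sub>L R"
  shows "(mu G ^^ n) X = R o\<^sub>L fun_calc (iter_fun n) K o\<^sub>L R"
proof (induction n)
  case 0
  have "iter_fun 0 = (\<lambda>t. t)" by (rule ext) simp
  then show ?case using K by (simp add: X fun_calc_id BplusD)
next
  case (Suc n)
  have pK: "posop K" using K by (rule BplusD)
  note cont = iter_fun_continuous'
  have t: "0 \<le> t" "t \<le> 1" if "t \<in> {0..norm K}" for t using that K1 by auto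
  let ?c = "\<lambda>t. iter_fun n t * (1 - t) / (iter_fun n t + (1 - t))"
  have cc: "continuous_on {0..norm K} ?c"
    using cont iter_fun_bounds(3)[of _ n] t by (intro continuous_intros) (auto simp: order_less_le)
  have "(mu G ^^ Suc n) X = mu G (R o\<^sub>L fun_calc (iter_fun n) K o\<^sub>L R)" using Suc by simp
  also have "\<dots> = (R o\<^sub>L fun_calc (iter_fun n) K o\<^sub>L R) - (R o\<^sub>L fun_calc ?c K o\<^sub>L R)"
    unfolding mu_def G using t
    by (subst par_sum_coordinates[OF R K K1 kerRK cont]) (auto intro: iter_fun_bounds)
  also have "\<dots> = R o\<^sub>L (fun_calc (iter_fun n) K - fun_calc ?c K) o\<^sub>L R"
    by (simp add: compose_bilinear)
  also have "fun_calc (iter_fun n) K - fun_calc ?c K = fun_calc (\<lambda>t. iter_fun n t - ?c t) K"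
    by (rule fun_calc_diff[OF pK cont cc, symmetric])
  also have "\<dots> = fun_calc (iter_fun (Suc n)) K"
  proof (rule fun_calc_cong)
    fix s assume "s \<in> {0..norm K}"
    then have "iter_fun n s + (1 - s) \<noteq> 0" using iter_fun_bounds(3)[OF t] by (metis less_irrefl)
    then have "iter_fun n s = iter_fun n s * (iter_fun n s + (1 - s)) / (iter_fun n s + (1 - s))" by simp
    then have "iter_fun n s - ?c s =
        (iter_fun n s * (iter_fun n s + (1 - s)) - iter_fun n s * (1 - s)) / (iter_fun n s + (1 - s))"
      by (metis diff_divide_distrib)
    then show "iter_fun n s - ?c s = iter_fun (Suc n) s"
      by (simp add: power2_eq_square algebra_simps)
  qed
  finally show ?case .
qed

end

section \<open>The limit of the iteration\<close>

context
  fixes G X :: "'a::chilbert_space \<Rightarrow>\<^sub>L 'a"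
  assumes G: "G \<in> Bplus" and X: "X \<in> Bplus"
begin

lemma sum_Bplus: "G + X \<in> Bplus"
  using G X by (rule Bplus_add)

text \<open>The form of \<open>X\<close> is below that of \<open>G + X\<close>, so Douglas factorization applies to the square roots. Its
  factor takes values in the closure of the range of \<open>G + X\<close>, hence is given by the
  pseudo-inverse.\<close>

lemma contr_props:
  shows sqrt_op_eq_contr: "sqrt_op X = sqrt_op (G + X) o\<^sub>L contr G X"
    and contr_apply: "contr G X f = inv_sqrt (G + X) (sqrt_op X f)"
    and contr_in: "contr G X f \<in> closure (range (G + X))"
    and clinear_contr: "clinear_op (contr G X)"
    and norm_contr: "norm (contr G X) \<le> 1"
proof -
  let ?R = "sqrt_op (G + X)"
  have adjs: "adj (sqrt_op X) = sqrt_op X" "adj ?R = ?R"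
    using BplusD(3)[OF sqrt_op_Bplus[OF X]] BplusD(3)[OF sqrt_op_Bplus[OF sum_Bplus]]
    by (simp_all add: symop_adj)
  have le: "norm (adj (sqrt_op X) f) \<le> 1 * norm (adj ?R f)" for f
  proof -
    have "(norm (sqrt_op X f))\<^sup>2 \<le> (norm (?R f))\<^sup>2"
      using posop_nonneg[OF BplusD(2)[OF G], of f]
      by (simp add: norm_sqrt_op X sum_Bplus blinfun.add_left inner_add_left)
    then have "norm (sqrt_op X f) \<le> norm (?R f)" by (rule power2_le_imp_le) simp
    then show ?thesis by (simp add: adjs)
  qed
  obtain T :: "'a \<Rightarrow>\<^sub>L 'a" where T: "sqrt_op X = ?R o\<^sub>L T" "norm T \<le> 1" "\<And>y. T y \<in> closure (range (adj ?R))"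
    using douglas[OF zero_le_one le] by blast
  have Tin: "T y \<in> closure (range (G + X))" for y
    using T(3)[of y] by (simp add: adjs closure_range_sqrt_op sum_Bplus)
  have RT: "?R (T f) = sqrt_op X f" for f using T(1) by simp
  have inv: "inv_sqrt (G + X) (sqrt_op X f) = T f" for f
    by (rule inv_sqrt_eqI[OF sum_Bplus Tin RT])
  have C: "contr G X = T" unfolding contr_def inv by (rule blinfun_apply_inverse)
  show "sqrt_op X = ?R o\<^sub>L contr G X" "norm (contr G X) \<le> 1"
    "contr G X f = inv_sqrt (G + X) (sqrt_op X f)" "contr G X f \<in> closure (range (G + X))"
    unfolding C inv by (rule T Tin refl)+
  have cs: "csubspace (closure (range (G + X)))"
    using BplusD(1)[OF sum_Bplus] by (intro csubspace_closure csubspace_range)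
  show "clinear_op (contr G X)" unfolding C clinear_op_def
  proof (intro allI)
    fix c x
    have "c *\<^sub>C T x \<in> closure (range (G + X))" using cs Tin by (simp add: csubspace_def)
    moreover have "?R (T (c *\<^sub>C x)) = ?R (c *\<^sub>C T x)"
      unfolding clinear_opD[OF BplusD(1)[OF sqrt_op_Bplus[OF sum_Bplus]]] RT
      by (rule clinear_opD[OF BplusD(1)[OF sqrt_op_Bplus[OF X]]])
    ultimately show "T (c *\<^sub>C x) = c *\<^sub>C T x"
      using sqrt_op_inj_on_closure_range[OF sum_Bplus Tin] by blast
  qed
qed

text \<open>The formal quotient of \<open>X\<close> by \<open>G + X\<close>; that of \<open>G\<close> by \<open>G + X\<close> is \<open>1 - Kop\<close>.\<close>

definition Kop :: "'a \<Rightarrow>\<^sub>L 'a" where "Kop = contr G X o\<^sub>L adj (contr G X)"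

lemma sqrt_op_apply_contr: "sqrt_op X x = sqrt_op (G + X) (contr G X x)"
  by (subst sqrt_op_eq_contr) simp

lemma sqrt_op_apply_adj_contr: "sqrt_op X x = adj (contr G X) (sqrt_op (G + X) x)"
proof (rule inner_ext)
  fix z
  have "z \<bullet> sqrt_op X x = sqrt_op X z \<bullet> x"
    using symopD[OF BplusD(3)[OF sqrt_op_Bplus[OF X]], of z x] by simp
  also have "\<dots> = contr G X z \<bullet> sqrt_op (G + X) x"
    unfolding sqrt_op_apply_contr by (rule symopD[OF BplusD(3)[OF sqrt_op_Bplus[OF sum_Bplus]]])
  also have "\<dots> = z \<bullet> adj (contr G X) (sqrt_op (G + X) x)" by (rule inner_adj)
  finally show "z \<bullet> sqrt_op X x = z \<bullet> adj (contr G X) (sqrt_op (G + X) x)" .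
qed

lemma Kop_inner: "Kop x \<bullet> y = adj (contr G X) x \<bullet> adj (contr G X) y"
  unfolding Kop_def by (simp add: inner_adj)

lemma Kop_Bplus: "Kop \<in> Bplus"
  unfolding Bplus_iff posop_def symop_def
proof (intro conjI allI)
  show "clinear_op Kop"
    unfolding Kop_def by (intro clinear_op_arith clinear_contr clinear_op_adj)
  show "Kop x \<bullet> y = x \<bullet> Kop y" for x y
    using Kop_inner[of x y] Kop_inner[of y x] by (simp only: inner_commute)
  show "0 \<le> Kop x \<bullet> x" for x by (simp add: Kop_inner)
qed

lemma Kop_form: "Kop x \<bullet> x = (norm (adj (contr G X) x))\<^sup>2"
  by (simp add: Kop_inner power2_norm_eq_inner)

lemma Kop_norm: "norm Kop \<le> 1"
proof (rule posop_norm_le[OF BplusD(2)[OF Kop_Bplus]])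
  fix x
  let ?y = "adj (contr G X) x"
  have "norm ?y * norm ?y = contr G X ?y \<bullet> x"
    by (simp add: inner_adj power2_norm_eq_inner flip: power2_eq_square)
  also have "\<dots> \<le> norm (contr G X ?y) * norm x" by (rule norm_cauchy_schwarz)
  also have "\<dots> \<le> norm ?y * norm x"
    using norm_blinfun[of "contr G X" ?y] mult_right_mono[OF norm_contr, of "norm ?y"]
    by (intro mult_right_mono) auto
  finally have "norm ?y \<le> norm x" by (cases "?y = 0") auto
  then show "Kop x \<bullet> x \<le> 1 * (norm x)\<^sup>2" by (simp add: Kop_form power_mono)
qed simp

lemma Kop_ker: "sqrt_op (G + X) z = 0 \<Longrightarrow> Kop z = 0"
proof -
  assume z: "sqrt_op (G + X) z = 0"
  then have z': "(G + X) z = 0" by (simp add: sqrt_op_eq_0_iff sum_Bplus)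
  have "y \<bullet> adj (contr G X) z = y \<bullet> 0" for y
  proof -
    have "contr G X y \<bullet> z = 0"
      using contr_in[of y] z' closure_range_symop_iff[OF BplusD(3)[OF sum_Bplus]] by blast
    then show ?thesis by (simp add: inner_adj)
  qed
  then have "adj (contr G X) z = 0" by (rule inner_ext)
  then show ?thesis by (simp add: Kop_def blinfun.zero_right)
qed

lemma X_coordinates: "X = sqrt_op (G + X) o\<^sub>L Kop o\<^sub>L sqrt_op (G + X)"
proof (rule blinfun_eqI)
  fix x
  have "X x = sqrt_op X (sqrt_op X x)" by (simp add: sqrt_op_apply X)
  also have "\<dots> = sqrt_op (G + X) (contr G X (adj (contr G X) (sqrt_op (G + X) x)))"
    by (simp only: sqrt_op_apply_contr[symmetric] sqrt_op_apply_adj_contr[symmetric])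
  finally show "X x = (sqrt_op (G + X) o\<^sub>L Kop o\<^sub>L sqrt_op (G + X)) x" by (simp add: Kop_def)
qed

lemma G_coordinates: "G = sqrt_op (G + X) o\<^sub>L (id_blinfun - Kop) o\<^sub>L sqrt_op (G + X)"
proof -
  have "sqrt_op (G + X) o\<^sub>L (id_blinfun - Kop) o\<^sub>L sqrt_op (G + X) =
      (sqrt_op (G + X) o\<^sub>L sqrt_op (G + X)) - (sqrt_op (G + X) o\<^sub>L Kop o\<^sub>L sqrt_op (G + X))"
    by (simp add: compose_bilinear)
  also have "\<dots> = G" using X_coordinates by (simp add: sqrt_op_square sum_Bplus)
  finally show ?thesis ..
qed

lemma par_sum_Bplus: "par_sum X G \<in> Bplus"
  and par_sum_le: "par_sum X G x \<bullet> x \<le> G x \<bullet> x"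
  and mu_Bplus: "mu G X \<in> Bplus"
proof -
  let ?R = "sqrt_op (G + X)"
  have pK: "posop Kop" using Kop_Bplus by (rule BplusD)
  have "par_sum X G = ?R o\<^sub>L fun_calc (\<lambda>t. t * (1 - t) / (t + (1 - t))) Kop o\<^sub>L ?R"
    using par_sum_coordinates[OF sqrt_op_Bplus[OF sum_Bplus] Kop_Bplus Kop_norm Kop_ker, of "\<lambda>t. t"]
    unfolding X_coordinates[symmetric] G_coordinates[symmetric] fun_calc_id[OF pK]
    by (simp add: continuous_on_id)
  also have "fun_calc (\<lambda>t. t * (1 - t) / (t + (1 - t))) Kop = fun_calc (\<lambda>t. t * (1 - t)) Kop"
    by (rule fun_calc_cong) simp
  finally have ps: "par_sum X G = ?R o\<^sub>L fun_calc (\<lambda>t. t * (1 - t)) Kop o\<^sub>L ?R" .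
  have "fun_calc (\<lambda>t. t * (1 - t)) Kop \<in> Bplus"
  proof (rule fun_calc_Bplus[OF Kop_Bplus])
    show "continuous_on {0..norm Kop} (\<lambda>t. t * (1 - t))" by (intro continuous_intros)
    show "0 \<le> t * (1 - t)" if "t \<in> {0..norm Kop}" for t using that Kop_norm by simp
  qed
  then show B: "par_sum X G \<in> Bplus"
    unfolding ps using sqrt_op_Bplus[OF sum_Bplus] by (rule Bplus_sandwich)
  have mu: "mu G X = ?R o\<^sub>L fun_calc (iter_fun 1) Kop o\<^sub>L ?R"
    using mu_iterates_coordinates[OF Kop_Bplus Kop_norm sqrt_op_Bplus[OF sum_Bplus] Kop_ker X_coordinates G_coordinates, of 1]
    by simp
  have "fun_calc (iter_fun 1) Kop \<in> Bplus"
  proof (rule fun_calc_Bplus[OF Kop_Bplus iter_fun_continuous'[OF Kop_Bplus Kop_norm]])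
    show "0 \<le> iter_fun 1 t" if "t \<in> {0..norm Kop}" for t
      using that Kop_norm by (intro iter_fun_bounds) auto
  qed
  then show "mu G X \<in> Bplus"
    unfolding mu using sqrt_op_Bplus[OF sum_Bplus] by (rule Bplus_sandwich)
  have inner_le: "fun_calc (\<lambda>t. t * (1 - t)) Kop y \<bullet> y \<le> (id_blinfun - Kop) y \<bullet> y" for y
  proof -
    have "posop (fun_calc (\<lambda>t. (1 - t) - t * (1 - t)) Kop)"
    proof (rule fun_calc_posop[OF pK])
      show "continuous_on {0..norm Kop} (\<lambda>t. (1 - t) - t * (1 - t))" by (intro continuous_intros)
      fix t assume "t \<in> {0..norm Kop}"
      have "(1 - t) - t * (1 - t) = (1 - t)\<^sup>2" by (simp add: power2_eq_square algebra_simps)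
      then show "0 \<le> (1 - t) - t * (1 - t)" by simp
    qed
    also have "fun_calc (\<lambda>t. (1 - t) - t * (1 - t)) Kop =
        (id_blinfun - Kop) - fun_calc (\<lambda>t. t * (1 - t)) Kop"
      by (subst fun_calc_diff[OF pK], intro continuous_intros, intro continuous_intros)
        (simp add: fun_calc_diff[OF pK] fun_calc_const[OF pK] fun_calc_id[OF pK])
    finally show ?thesis
      using posop_nonneg[of "(id_blinfun - Kop) - fun_calc (\<lambda>t. t * (1 - t)) Kop" y]
      by (simp add: blinfun.diff_left inner_diff_left)
  qed
  have RR: "(?R o\<^sub>L A o\<^sub>L ?R) x \<bullet> x = A (?R x) \<bullet> ?R x" for A
    using symopD[OF BplusD(3)[OF sqrt_op_Bplus[OF sum_Bplus]]] by simp
  show "par_sum X G x \<bullet> x \<le> G x \<bullet> x"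
    using inner_le[of "?R x"] unfolding ps RR by (subst (2) G_coordinates) (simp only: RR)
qed

lemma mu_iterates_tendsto:
  "(\<lambda>n. (mu G ^^ n) X f) \<longlonglongrightarrow> (sqrt_op (G + X) o\<^sub>L proj (ker (id_blinfun - Kop)) o\<^sub>L sqrt_op (G + X)) f"
proof -
  have "(mu G ^^ n) X f = sqrt_op (G + X) (fun_calc (iter_fun n) Kop (sqrt_op (G + X) f))" for n
    using mu_iterates_coordinates[OF Kop_Bplus Kop_norm sqrt_op_Bplus[OF sum_Bplus] Kop_ker X_coordinates G_coordinates, of n]
    by simp
  then show ?thesis
    using fun_calc_iter_fun_tendsto[OF Kop_Bplus Kop_norm]
    by (simp add: blinfun.tendsto[OF tendsto_const])
qed

lemma tau_eqI:
  fixes T :: "'a \<Rightarrow>\<^sub>L 'a"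
  assumes "\<And>f. (\<lambda>n. (mu G ^^ n) X f) \<longlonglongrightarrow> T f"
  shows "tau G X = T"
  unfolding tau_def
proof (rule the_equality)
  fix T' :: "'a \<Rightarrow>\<^sub>L 'a" assume "\<forall>f. (\<lambda>n. (mu G ^^ n) X f) \<longlonglongrightarrow> T' f"
  then show "T' = T" using assms LIMSEQ_unique by (intro blinfun_eqI) blast
qed (use assms in blast)

lemma tau_coordinates:
  "tau G X = sqrt_op (G + X) o\<^sub>L proj (ker (id_blinfun - Kop)) o\<^sub>L sqrt_op (G + X)"
  by (rule tau_eqI[OF mu_iterates_tendsto])

lemma tau_tendsto: "(\<lambda>n. (mu G ^^ n) X f) \<longlonglongrightarrow> tau G X f"
  unfolding tau_coordinates by (rule mu_iterates_tendsto)

lemma csubspace_ker_Kop: "csubspace (ker (id_blinfun - Kop))" "closed (ker (id_blinfun - Kop))"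
proof -
  have "clinear_op (id_blinfun - Kop)" using BplusD(1)[OF Kop_Bplus] by (intro clinear_op_arith)
  then show "csubspace (ker (id_blinfun - Kop))" by (rule csubspace_ker)
qed (rule closed_ker)

lemma tau_Bplus: "tau G X \<in> Bplus"
  unfolding tau_coordinates
  by (intro Bplus_sandwich proj_Bplus csubspace_ker_Kop sqrt_op_Bplus sum_Bplus)

definition Dop :: "'a \<Rightarrow>\<^sub>L 'a" where "Dop = sqrt_op (id_blinfun - Kop)"

lemma id_minus_Kop_Bplus: "id_blinfun - Kop \<in> Bplus"
proof -
  have "Kop x \<bullet> x \<le> x \<bullet> x" for x
    using inner_le_norm_op[of Kop x] mult_right_mono[OF Kop_norm, of "(norm x)\<^sup>2"]
    by (simp add: power2_norm_eq_inner)
  then show ?thesis using BplusD[OF Kop_Bplus]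
    by (simp add: Bplus_iff posop_def clinear_op_arith symop_arith blinfun.diff_left inner_diff_left)
qed

lemma Dop: "Dop \<in> Bplus" "Dop (Dop x) = x - Kop x" "Dop x = 0 \<longleftrightarrow> x \<in> ker (id_blinfun - Kop)"
  using id_minus_Kop_Bplus
  by (simp_all add: Dop_def sqrt_op_Bplus sqrt_op_apply sqrt_op_eq_0_iff ker_def blinfun.diff_left)

text \<open>\<open>G = A A*\<close> for \<open>A = sqrt (G + X) Dop\<close>.\<close>

lemma range_sqrt_op_G: "range (sqrt_op G) = range (sqrt_op (G + X) o\<^sub>L Dop)"
proof (rule range_sqrt_op_eq[OF G])
  let ?R = "sqrt_op (G + X)"
  have "adj (?R o\<^sub>L Dop) = Dop o\<^sub>L ?R"
    using symopD[OF BplusD(3)[OF sqrt_op_Bplus[OF sum_Bplus]]] symopD[OF BplusD(3)[OF Dop(1)]]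
    by (intro adj_eqI) simp
  moreover have "?R (Dop (Dop (?R x))) = G x" for x
    by (subst (2) G_coordinates) (simp add: Dop blinfun.bilinear_simps)
  ultimately show "(?R o\<^sub>L Dop) o\<^sub>L adj (?R o\<^sub>L Dop) = G"
    by (intro blinfun_eqI) simp
qed

lemma csubspace_preimage: "clinear_op A \<Longrightarrow> csubspace {f. A f \<in> range (sqrt_op G)}"
  by (rule csubspace_vimage[OF _ csubspace_range[OF BplusD(1)[OF sqrt_op_Bplus[OF G]]]])

text \<open>A vector \<open>f\<close> with \<open>sqrt (G + X) f\<close> in the range of \<open>sqrt G\<close> differs from some \<open>Dop w\<close> by an element
  of the kernel of \<open>sqrt (G + X)\<close>, on which \<open>Kop\<close> vanishes.\<close>

lemma ker_Kop_eq: "ker (id_blinfun - Kop) = ocomp {f. sqrt_op (G + X) f \<in> range (sqrt_op G)}"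
proof (intro set_eqI iffI)
  let ?R = "sqrt_op (G + X)"
  have cs: "csubspace {f. ?R f \<in> range (sqrt_op G)}"
    using sqrt_op_Bplus[OF sum_Bplus] by (intro csubspace_preimage BplusD)
  fix x
  {
    assume x: "x \<in> ker (id_blinfun - Kop)"
    then have x': "Dop x = 0" "Kop x = x" by (auto simp: Dop ker_def blinfun.diff_left)
    show "x \<in> ocomp {f. ?R f \<in> range (sqrt_op G)}" unfolding ocomp_iff[OF cs]
    proof
      fix f assume "f \<in> {f. ?R f \<in> range (sqrt_op G)}"
      then obtain w where w: "?R f = ?R (Dop w)" unfolding range_sqrt_op_G by auto
      then have "Kop (f - Dop w) = 0" by (intro Kop_ker) (simp add: blinfun.diff_right)
      then have "Kop x \<bullet> (f - Dop w) = 0" using symopD[OF BplusD(3)[OF Kop_Bplus], of x "f - Dop w"] by simp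
      moreover have "x \<bullet> Dop w = 0" using symopD[OF BplusD(3)[OF Dop(1)], of x w] x' by simp
      ultimately show "x \<bullet> f = 0" by (simp add: x' inner_diff_right)
    qed
  }
  assume x: "x \<in> ocomp {f. ?R f \<in> range (sqrt_op G)}"
  have "Dop (Dop x) \<in> {f. ?R f \<in> range (sqrt_op G)}" unfolding range_sqrt_op_G by auto
  then have "x \<bullet> Dop (Dop x) = 0" using x unfolding ocomp_iff[OF cs] by blast
  then have "Dop x \<bullet> Dop x = 0" using symopD[OF BplusD(3)[OF Dop(1)], of x "Dop x"] by simp
  then show "x \<in> ker (id_blinfun - Kop)" by (simp add: Dop)
qed

lemma tau_eq_sum_form:
  "tau G X = sqrt_op (G + X) o\<^sub>L proj (ocomp {f. sqrt_op (G + X) f \<in> range (sqrt_op G)}) o\<^sub>L sqrt_op (G + X)"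
  unfolding ker_Kop_eq[symmetric] by (rule tau_coordinates)

text \<open>Both inclusions rest on \<open>T (1 - T* T) = (1 - Kop) T\<close>, where \<open>T = contr G X\<close>. By this identity \<open>T\<close>
  maps the kernel of \<open>1 - T* T\<close> into that of \<open>1 - Kop\<close>, and \<open>sqrt X\<close> maps the range of \<open>1 - T* T\<close>
  into the range of \<open>sqrt G\<close>.\<close>

lemma ker_contr_eq:
  "ker (id_blinfun - (adj (contr G X) o\<^sub>L contr G X)) = ocomp {g. sqrt_op X g \<in> range (sqrt_op G)}"
proof (intro set_eqI iffI)
  let ?R = "sqrt_op (G + X)" and ?T = "contr G X"
  have cs: "csubspace {g. sqrt_op X g \<in> range (sqrt_op G)}"
    using sqrt_op_Bplus[OF X] by (intro csubspace_preimage BplusD)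
  fix x
  {
    assume "x \<in> ker (id_blinfun - (adj ?T o\<^sub>L ?T))"
    then have x: "adj ?T (?T x) = x" by (simp add: ker_def blinfun.diff_left)
    then have "Kop (?T x) = ?T x" by (simp add: Kop_def)
    then have K: "Kop (?T x) = ?T x" "Dop (?T x) = 0" by (simp_all add: Dop ker_def blinfun.diff_left)
    show "x \<in> ocomp {g. sqrt_op X g \<in> range (sqrt_op G)}" unfolding ocomp_iff[OF cs]
    proof
      fix g assume "g \<in> {g. sqrt_op X g \<in> range (sqrt_op G)}"
      then obtain w where w: "?R (?T g) = ?R (Dop w)"
        unfolding range_sqrt_op_G sqrt_op_apply_contr by auto
      then have "Kop (?T g - Dop w) = 0" by (intro Kop_ker) (simp add: blinfun.diff_right)
      then have "Kop (?T x) \<bullet> (?T g - Dop w) = 0"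
        using symopD[OF BplusD(3)[OF Kop_Bplus], of "?T x" "?T g - Dop w"] by simp
      moreover have "?T x \<bullet> Dop w = 0" using symopD[OF BplusD(3)[OF Dop(1)], of "?T x" w] K by simp
      ultimately have "?T x \<bullet> ?T g = 0" by (simp add: K inner_diff_right)
      then have "adj ?T (?T x) \<bullet> g = 0" by (simp add: inner_adj')
      then show "x \<bullet> g = 0" by (simp add: x)
    qed
  }
  assume x: "x \<in> ocomp {g. sqrt_op X g \<in> range (sqrt_op G)}"
  \<comment> \<open>\<open>y\<close> is in the preimage, hence \<open>x \<bullet> y = 0\<close>; this forces \<open>y = 0\<close> because \<open>?T\<close> is a contraction.\<close>
  define y where "y = x - adj ?T (?T x)"
  have "?T y = Dop (Dop (?T x))" by (simp add: y_def Dop Kop_def blinfun.diff_right)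
  then have "sqrt_op X y \<in> range (sqrt_op G)"
    unfolding range_sqrt_op_G sqrt_op_apply_contr by auto
  then have orth: "x \<bullet> y = 0" using x unfolding ocomp_iff[OF cs] by blast
  have adjle: "norm (?T x) \<le> norm x"
    using norm_blinfun[of ?T x] mult_right_mono[OF norm_contr, of "norm x"] by simp
  have "y \<bullet> y = x \<bullet> y - adj ?T (?T x) \<bullet> y" unfolding y_def by (simp add: inner_diff_left)
  also have "adj ?T (?T x) \<bullet> y = adj ?T (?T x) \<bullet> x - (norm (adj ?T (?T x)))\<^sup>2"
    by (simp add: y_def inner_diff_right power2_norm_eq_inner)
  also have "adj ?T (?T x) \<bullet> x = x \<bullet> x"
    using orth by (simp add: y_def inner_diff_right inner_commute)
  also have "x \<bullet> y - (x \<bullet> x - (norm (adj ?T (?T x)))\<^sup>2) \<le> 0"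
    using orth Kop_form[of "?T x"] inner_le_norm_op[of Kop "?T x"] mult_right_mono[OF Kop_norm, of "(norm (?T x))\<^sup>2"]
      power_mono[OF adjle norm_ge_zero, of 2]
    by (simp add: power2_norm_eq_inner)
  finally have "y = 0" by (metis inner_ge_zero inner_eq_zero_iff order_antisym)
  then show "x \<in> ker (id_blinfun - (adj ?T o\<^sub>L ?T))" by (simp add: y_def ker_def blinfun.diff_left)
qed

text \<open>With \<open>T = contr G X\<close>, the operator \<open>T P T*\<close> is the projection onto \<open>ker (1 - T T*)\<close> when \<open>P\<close> is the
  projection onto \<open>ker (1 - T* T)\<close>, because \<open>T\<close> maps the second kernel isometrically onto the
  first.\<close>

lemma tau_eq_form:
  "tau G X = sqrt_op X o\<^sub>L proj (ocomp {g. sqrt_op X g \<in> range (sqrt_op G)}) o\<^sub>L sqrt_op X"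
proof -
  let ?T = "contr G X"
  define L where "L = ker (id_blinfun - (adj ?T o\<^sub>L ?T))"
  have L: "csubspace L" "closed L" unfolding L_def ker_contr_eq by (rule csubspace_ocomp closed_ocomp)+
  have L_iff: "x \<in> L \<longleftrightarrow> adj ?T (?T x) = x" for x by (auto simp: L_def ker_def blinfun.diff_left)
  have E_iff: "x \<in> ker (id_blinfun - Kop) \<longleftrightarrow> ?T (adj ?T x) = x" for x
    by (auto simp: Kop_def ker_def blinfun.diff_left)
  have P: "proj (ker (id_blinfun - Kop)) x = ?T (proj L (adj ?T x))" for x
  proof (rule proj_eqI[OF csubspace_ker_Kop])
    have "adj ?T (?T (proj L (adj ?T x))) = proj L (adj ?T x)" using proj_in[OF L] L_iff by blast
    then show "?T (proj L (adj ?T x)) \<in> ker (id_blinfun - Kop)" by (simp add: E_iff)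
    show "x - ?T (proj L (adj ?T x)) \<in> ocomp (ker (id_blinfun - Kop))"
      unfolding ocomp_iff[OF csubspace_ker_Kop(1)]
    proof
      fix e assume "e \<in> ker (id_blinfun - Kop)"
      then have e: "?T (adj ?T e) = e" by (simp add: E_iff)
      then have "adj ?T e \<in> L" by (simp add: L_iff)
      then have "proj L (adj ?T e) = adj ?T e" by (rule proj_same[OF L])
      moreover have "?T (proj L (adj ?T x)) \<bullet> e = adj ?T x \<bullet> proj L (adj ?T e)"
        using symopD[OF proj_symop[OF L]] by (simp add: inner_adj)
      ultimately have "?T (proj L (adj ?T x)) \<bullet> e = x \<bullet> e" by (simp add: inner_adj' e)
      then show "(x - ?T (proj L (adj ?T x))) \<bullet> e = 0" by (simp add: inner_diff_left)
    qed
  qed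
  have "tau G X = sqrt_op X o\<^sub>L proj L o\<^sub>L sqrt_op X"
  proof (rule blinfun_eqI)
    fix x
    have "tau G X x = sqrt_op (G + X) (?T (proj L (adj ?T (sqrt_op (G + X) x))))"
      unfolding tau_coordinates by (simp add: P)
    also have "\<dots> = sqrt_op X (proj L (sqrt_op X x))"
      by (simp only: sqrt_op_apply_contr[symmetric] sqrt_op_apply_adj_contr[symmetric])
    finally show "tau G X x = (sqrt_op X o\<^sub>L proj L o\<^sub>L sqrt_op X) x" by simp
  qed
  then show ?thesis unfolding L_def ker_contr_eq .
qed

end

section \<open>Consequences of the two formulas for the limit\<close>

abbreviation (input) pre_range :: "('a::chilbert_space \<Rightarrow>\<^sub>L 'a) \<Rightarrow> ('a \<Rightarrow>\<^sub>L 'a) \<Rightarrow> 'a set"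
  where "pre_range G X \<equiv> {g. sqrt_op X g \<in> range (sqrt_op G)}"

lemma csubspace_pre_range: "G \<in> Bplus \<Longrightarrow> X \<in> Bplus \<Longrightarrow> csubspace (pre_range G X)"
  by (rule csubspace_preimage) (simp_all add: BplusD sqrt_op_Bplus)

lemma tau_form:
  assumes "G \<in> Bplus" "X \<in> Bplus"
  shows "tau G X f \<bullet> f = (norm (proj (ocomp (pre_range G X)) (sqrt_op X f)))\<^sup>2"
proof -
  let ?P = "proj (ocomp (pre_range G X))"
  have "tau G X f \<bullet> f = ?P (sqrt_op X f) \<bullet> sqrt_op X f"
    using symopD[OF BplusD(3)[OF sqrt_op_Bplus[OF assms(2)]], of "?P (sqrt_op X f)" f]
    by (simp add: tau_eq_form[OF assms])
  then show ?thesis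
    using proj_inner[OF csubspace_ocomp closed_ocomp, of "pre_range G X" "sqrt_op X f" "sqrt_op X f"]
    by (simp add: power2_norm_eq_inner)
qed

lemma norm_proj_le:
  assumes "csubspace K" "closed K"
  shows "norm (proj K x) \<le> norm x"
proof -
  have "norm (proj K x) * norm (proj K x) = proj K x \<bullet> x"
    using proj_inner[OF assms, of x x] by (simp add: power2_norm_eq_inner flip: power2_eq_square)
  also have "\<dots> \<le> norm (proj K x) * norm x" by (rule norm_cauchy_schwarz)
  finally show ?thesis by (cases "proj K x = 0") auto
qed

lemma tau_le:
  assumes "G \<in> Bplus" "X \<in> Bplus"
  shows "tau G X f \<bullet> f \<le> X f \<bullet> f"
  using power_mono[OF norm_proj_le[OF csubspace_ocomp closed_ocomp] norm_ge_zero, of "pre_range G X" "sqrt_op X f" 2]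
  by (simp add: tau_form[OF assms] norm_sqrt_op[OF assms(2)])

lemma Bplus_eq_0I: "A \<in> Bplus \<Longrightarrow> (\<And>f. A f \<bullet> f = 0) \<Longrightarrow> A = 0"
proof (rule blinfun_eqI)
  fix x assume "A \<in> Bplus" "\<And>f. A f \<bullet> f = 0"
  then show "A x = blinfun_apply 0 x" using posop_zero_form[OF BplusD(2), of A x] by simp
qed

text \<open>Every vector is mapped by \<open>sqrt X\<close> into the range of \<open>sqrt G\<close>, so the projection is onto \<open>{0}\<close>.\<close>

lemma tau_eq_0I:
  assumes "G \<in> Bplus" "X \<in> Bplus" "range (sqrt_op X) \<subseteq> range (sqrt_op G)"
  shows "tau G X = 0"
proof (rule Bplus_eq_0I[OF tau_Bplus[OF assms(1,2)]])
  fix f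
  let ?L = "ocomp (pre_range G X)"
  have "pre_range G X = UNIV" using assms(3) by auto
  moreover have "proj ?L (sqrt_op X f) \<in> ?L" by (rule proj_in[OF csubspace_ocomp closed_ocomp])
  ultimately have "proj ?L (sqrt_op X f) \<bullet> proj ?L (sqrt_op X f) = 0"
    using ocomp_iff[OF csubspace_pre_range[OF assms(1,2)]] by blast
  then show "tau G X f \<bullet> f = 0" by (simp add: tau_form[OF assms(1,2)])
qed

lemma mu_iterate_Bplus: "G \<in> Bplus \<Longrightarrow> X \<in> Bplus \<Longrightarrow> (mu G ^^ n) X \<in> Bplus"
  by (induction n) (simp_all add: mu_Bplus)

lemma tau_mu:
  assumes "G \<in> Bplus" "X \<in> Bplus"
  shows "tau G (mu G X) = tau G X"
proof (rule tau_eqI[OF assms(1) mu_Bplus[OF assms]])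
  fix f
  have "(\<lambda>n. (mu G ^^ Suc n) X f) \<longlonglongrightarrow> tau G X f" by (rule LIMSEQ_Suc[OF tau_tendsto[OF assms]])
  then show "(\<lambda>n. (mu G ^^ n) (mu G X) f) \<longlonglongrightarrow> tau G X f" by (simp add: funpow_swap1)
qed

lemma tau_mu_iterate:
  assumes "G \<in> Bplus" "X \<in> Bplus"
  shows "tau G ((mu G ^^ n) X) = tau G X"
  by (induction n) (simp_all add: tau_mu assms mu_iterate_Bplus)

text \<open>The range of \<open>sqrt (tau G X)\<close> is that of \<open>sqrt X P\<close>; if \<open>sqrt X (P a)\<close> lies in the range of
  \<open>sqrt G\<close>, then \<open>P a\<close> belongs to the set to which the range of \<open>P\<close> is orthogonal.\<close>

lemma range_tau_Int_range:
  assumes "G \<in> Bplus" "X \<in> Bplus"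
  shows "range (sqrt_op (tau G X)) \<inter> range (sqrt_op G) = {0}"
proof -
  let ?L = "ocomp (pre_range G X)"
  have L: "csubspace ?L" "closed ?L" by (rule csubspace_ocomp closed_ocomp)+
  let ?B = "sqrt_op X o\<^sub>L proj ?L"
  have "adj ?B = proj ?L o\<^sub>L sqrt_op X"
    using symopD[OF BplusD(3)[OF sqrt_op_Bplus[OF assms(2)]]] symopD[OF proj_symop[OF L]]
    by (intro adj_eqI) simp
  then have "?B o\<^sub>L adj ?B = tau G X"
    by (intro blinfun_eqI) (simp add: tau_eq_form[OF assms] proj_same[OF L] proj_in[OF L])
  then have r: "range (sqrt_op (tau G X)) = range ?B" by (rule range_sqrt_op_eq[OF tau_Bplus[OF assms]])
  have "y = 0" if y: "y \<in> range ?B" "y \<in> range (sqrt_op G)" for y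
  proof -
    obtain a where a: "y = sqrt_op X (proj ?L a)" using y(1) by auto
    then have "proj ?L a \<in> pre_range G X" using y(2) by simp
    then have "proj ?L a \<bullet> proj ?L a = 0"
      using proj_in[OF L, of a] unfolding ocomp_iff[OF csubspace_pre_range[OF assms]] by blast
    then show "y = 0" by (simp add: a blinfun.zero_right)
  qed
  moreover have "0 \<in> range (sqrt_op G)" "0 \<in> range (sqrt_op (tau G X))"
    by (metis blinfun.zero_right rangeI)+
  ultimately show ?thesis unfolding r by blast
qed

text \<open>The parallel sum lies below both operators, so the range of its square root lies in both ranges.\<close>

lemma par_sum_eq_0I:
  assumes "G \<in> Bplus" "X \<in> Bplus" "range (sqrt_op X) \<inter> range (sqrt_op G) = {0}"
  shows "par_sum X G = 0"
proof -
  let ?P = "par_sum X G"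
  have P: "?P \<in> Bplus" using assms by (intro par_sum_Bplus)
  have "?P x \<bullet> x \<le> X x \<bullet> x" for x
    using posop_nonneg[OF BplusD(2)[OF mu_Bplus[OF assms(1,2)]], of x]
    by (simp add: mu_def blinfun.diff_left inner_diff_left)
  then have "range (sqrt_op ?P) \<subseteq> range (sqrt_op X)" by (intro range_sqrt_op_mono P assms)
  moreover have "range (sqrt_op ?P) \<subseteq> range (sqrt_op G)"
    using assms par_sum_le by (intro range_sqrt_op_mono P)
  ultimately have "range (sqrt_op ?P) \<subseteq> {0}" using assms(3) by blast
  then have "sqrt_op ?P x = 0" for x by blast
  then show ?thesis using P by (intro blinfun_eqI) (simp flip: sqrt_op_apply)
qed

lemma par_sum_tau: "G \<in> Bplus \<Longrightarrow> X \<in> Bplus \<Longrightarrow> par_sum (tau G X) G = 0"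
  by (intro par_sum_eq_0I tau_Bplus range_tau_Int_range)

lemma tau_eq_self_iff:
  assumes "G \<in> Bplus" "X \<in> Bplus"
  shows "tau G X = X \<longleftrightarrow> par_sum X G = 0"
proof
  show "par_sum X G = 0" if "tau G X = X" using par_sum_tau[OF assms] that by simp
  assume "par_sum X G = 0"
  then have "mu G X = X" by (simp add: mu_def)
  then have "(mu G ^^ n) X = X" for n by (induction n) auto
  then show "tau G X = X" by (intro tau_eqI[OF assms]) simp
qed

lemma par_sum_eq_0_iff:
  assumes "G \<in> Bplus" "X \<in> Bplus"
  shows "par_sum X G = 0 \<longleftrightarrow> range (sqrt_op X) \<inter> range (sqrt_op G) = {0}"
proof
  assume "par_sum X G = 0"
  then have "tau G X = X" by (simp add: tau_eq_self_iff[OF assms])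
  then show "range (sqrt_op X) \<inter> range (sqrt_op G) = {0}" using range_tau_Int_range[OF assms] by simp
qed (rule par_sum_eq_0I[OF assms])

lemma tau_tau: "G \<in> Bplus \<Longrightarrow> X \<in> Bplus \<Longrightarrow> tau G (tau G X) = tau G X"
  using tau_eq_self_iff[OF _ tau_Bplus] par_sum_tau by blast

lemma tau_cong_range:
  assumes "G1 \<in> Bplus" "G2 \<in> Bplus" "X \<in> Bplus" "range (sqrt_op G1) = range (sqrt_op G2)"
  shows "tau G1 X = tau G2 X"
  using assms by (simp add: tau_eq_form)

lemma proj_form_mono:
  assumes K: "csubspace K" "closed K" and L: "csubspace L" "closed L" and sub: "K \<subseteq> L"
  shows "norm (proj K x) \<le> norm (proj L x)"
proof -
  have "x - proj L x \<in> ocomp L" by (rule proj_diff[OF L])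
  then have "x - proj L x \<in> ocomp K" using sub by (auto simp: ocomp_def)
  then have "proj K (x - proj L x) = 0" by (rule proj_ocomp[OF K])
  then have "proj K x = proj K (proj L x)" by (simp add: blinfun.diff_right)
  then show ?thesis using norm_proj_le[OF K, of "proj L x"] by simp
qed

lemma tau_antimono_range:
  assumes "G1 \<in> Bplus" "G2 \<in> Bplus" "X \<in> Bplus" "range (sqrt_op G1) \<subseteq> range (sqrt_op G2)"
  shows "tau G2 X f \<bullet> f \<le> tau G1 X f \<bullet> f"
proof -
  have "ocomp (pre_range G2 X) \<subseteq> ocomp (pre_range G1 X)" using assms(4) by (auto simp: ocomp_def)
  then have "norm (proj (ocomp (pre_range G2 X)) (sqrt_op X f)) \<le> norm (proj (ocomp (pre_range G1 X)) (sqrt_op X f))"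
    by (intro proj_form_mono csubspace_ocomp closed_ocomp)
  then show ?thesis using assms by (simp add: tau_form power_mono)
qed

lemma sqrt_op_scale:
  assumes "A \<in> Bplus" "0 \<le> c"
  shows "sqrt_op (c *\<^sub>R A) = sqrt c *\<^sub>R sqrt_op A"
proof (rule sqrt_op_eqI)
  show "sqrt c *\<^sub>R sqrt_op A \<in> Bplus" "c *\<^sub>R A \<in> Bplus" using assms by (auto intro: Bplus_scale sqrt_op_Bplus)
  show "sqrt c *\<^sub>R sqrt_op A o\<^sub>L sqrt c *\<^sub>R sqrt_op A = c *\<^sub>R A"
    using assms by (simp add: compose_bilinear sqrt_op_square)
qed

lemma range_scaleR_blinfun: "c \<noteq> 0 \<Longrightarrow> range (blinfun_apply (c *\<^sub>R A)) = range (blinfun_apply A)"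
proof -
  assume c: "c \<noteq> 0"
  have "A x = (c *\<^sub>R A) ((1 / c) *\<^sub>R x)" for x
    using c by (simp add: blinfun.bilinear_simps)
  moreover have "(c *\<^sub>R A) x = A (c *\<^sub>R x)" for x by (simp add: blinfun.bilinear_simps)
  ultimately show ?thesis by (metis (no_types) image_subsetI rangeI subset_antisym)
qed

lemma range_sqrt_op_scale:
  assumes "A \<in> Bplus" "0 < c"
  shows "range (sqrt_op (c *\<^sub>R A)) = range (sqrt_op A)"
  using assms range_scaleR_blinfun[of "sqrt c" "sqrt_op A"] by (simp add: sqrt_op_scale)

text \<open>The formula in terms of \<open>G + X\<close> is the other formula with \<open>G + X\<close> in place of \<open>X\<close>.\<close>

lemma tau_add_self:
  assumes "G \<in> Bplus" "X \<in> Bplus"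
  shows "tau G (G + X) = tau G X"
  by (simp add: tau_eq_form[OF assms(1) Bplus_add[OF assms]] tau_eq_sum_form[OF assms])

lemma tau_scale_left:
  assumes "G \<in> Bplus" "X \<in> Bplus" "0 < c"
  shows "tau (c *\<^sub>R G) X = tau G X"
  using assms by (intro tau_cong_range range_sqrt_op_scale Bplus_scale) auto

lemma tau_add_scaled:
  assumes "G \<in> Bplus" "X \<in> Bplus" "0 < c"
  shows "tau G (c *\<^sub>R G + X) = tau G X"
proof -
  have cG: "c *\<^sub>R G \<in> Bplus" using assms by (simp add: Bplus_scale)
  have "tau G (c *\<^sub>R G + X) = tau (c *\<^sub>R G) (c *\<^sub>R G + X)"
    using tau_scale_left[OF assms(1) Bplus_add[OF cG assms(2)] assms(3)] by simp
  also have "\<dots> = tau (c *\<^sub>R G) X" using cG assms(2) by (rule tau_add_self)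
  also have "\<dots> = tau G X" using assms by (rule tau_scale_left)
  finally show ?thesis .
qed

lemma tau_scale_right:
  assumes "G \<in> Bplus" "X \<in> Bplus" "0 < c"
  shows "tau G (c *\<^sub>R X) = c *\<^sub>R tau G X"
proof -
  have "range (sqrt_op G) = range (sqrt_op ((1/c) *\<^sub>R G))"
    using assms by (simp add: range_sqrt_op_scale)
  have cs: "csubspace (range (sqrt_op G))" using assms by (intro csubspace_range BplusD(1) sqrt_op_Bplus)
  have "sqrt c *\<^sub>R y \<in> range (sqrt_op G) \<longleftrightarrow> y \<in> range (sqrt_op G)" for y
  proof
    assume "sqrt c *\<^sub>R y \<in> range (sqrt_op G)"
    then have "(1 / sqrt c) *\<^sub>R sqrt c *\<^sub>R y \<in> range (sqrt_op G)"
      using cs unfolding csubspace_def by (blast intro: subspace_scale)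
    then show "y \<in> range (sqrt_op G)" using assms by simp
  next
    assume "y \<in> range (sqrt_op G)"
    then show "sqrt c *\<^sub>R y \<in> range (sqrt_op G)" using cs unfolding csubspace_def by (blast intro: subspace_scale)
  qed
  then have eq: "pre_range G (c *\<^sub>R X) = pre_range G X"
    using assms by (simp add: sqrt_op_scale blinfun.scaleR_left)
  have cX: "c *\<^sub>R X \<in> Bplus" using assms by (simp add: Bplus_scale)
  show ?thesis
    unfolding tau_eq_form[OF assms(1) cX] tau_eq_form[OF assms(1,2)] eq
    using assms by (simp add: sqrt_op_scale compose_bilinear)
qed

text \<open>The square roots commute. Hence \<open>sqrt X\<close> maps the range of \<open>sqrt G\<close> into itself, which gives one
  inclusion. For the other, the projection onto \<open>ker G\<close> splits a vector of the preimage into a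
  part killed by \<open>X\<close> and a part orthogonal to \<open>ker G\<close>.\<close>

lemma ocomp_pre_range_commuting:
  assumes G: "G \<in> Bplus" and X: "X \<in> Bplus" and com: "X o\<^sub>L G = G o\<^sub>L X"
  shows "ocomp (pre_range G X) = ker G \<inter> closure (range X)"
proof -
  have "G o\<^sub>L sqrt_op X = sqrt_op X o\<^sub>L G" using com by (intro sqrt_op_commute X) simp
  then have "sqrt_op X o\<^sub>L sqrt_op G = sqrt_op G o\<^sub>L sqrt_op X" by (intro sqrt_op_commute G) simp
  then have XG: "sqrt_op X (sqrt_op G x) = sqrt_op G (sqrt_op X x)" for x
    by (metis blinfun_apply_blinfun_compose)
  note cs = csubspace_pre_range[OF G X]
  note symX = symopD[OF BplusD(3)[OF sqrt_op_Bplus[OF X]]] and symG = symopD[OF BplusD(3)[OF sqrt_op_Bplus[OF G]]]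
  have "x \<in> ker G \<inter> closure (range X)" if x: "x \<in> ocomp (pre_range G X)" for x
  proof
    have "sqrt_op G (sqrt_op G x) \<in> pre_range G X" by (simp add: XG)
    then have "x \<bullet> sqrt_op G (sqrt_op G x) = 0" using x unfolding ocomp_iff[OF cs] by blast
    then have "sqrt_op G x \<bullet> sqrt_op G x = 0" by (simp add: symG)
    then show "x \<in> ker G" using G by (simp add: ker_def sqrt_op_eq_0_iff)
    have "x \<bullet> y = 0" if "X y = 0" for y
    proof -
      have "sqrt_op X y = sqrt_op G 0" using that X by (simp add: sqrt_op_eq_0_iff blinfun.zero_right)
      then have "y \<in> pre_range G X" by blast
      then show ?thesis using x unfolding ocomp_iff[OF cs] by blast
    qed
    then show "x \<in> closure (range X)" using closure_range_symop_iff[OF BplusD(3)[OF X]] by blast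
  qed
  moreover have "x \<in> ocomp (pre_range G X)" if x: "x \<in> ker G" "x \<in> closure (range X)" for x
    unfolding ocomp_iff[OF cs]
  proof
    fix g assume "g \<in> pre_range G X"
    then obtain w where w: "sqrt_op X g = sqrt_op G w" by auto
    define p where "p = proj (ker G) g"
    have kG: "csubspace (ker G)" "closed (ker G)"
      by (rule csubspace_ker[OF BplusD(1)[OF G]], rule closed_ker)
    have "sqrt_op G p = 0"
      using proj_in[OF kG, of g] G by (simp add: p_def ker_def sqrt_op_eq_0_iff)
    then have Gp: "sqrt_op G (sqrt_op X p) = 0" by (simp flip: XG add: blinfun.zero_right)
    then have "sqrt_op G (sqrt_op X (sqrt_op X p)) = 0" by (simp flip: XG add: blinfun.zero_right)
    then have "sqrt_op X (sqrt_op X p) \<in> ker G"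
      using G by (simp add: ker_def sqrt_op_eq_0_iff)
    then have "(g - p) \<bullet> sqrt_op X (sqrt_op X p) = 0"
      using proj_diff[OF kG, of g] unfolding p_def[symmetric] ocomp_iff[OF kG(1)] by blast
    then have "sqrt_op X p \<bullet> sqrt_op X p = sqrt_op X g \<bullet> sqrt_op X p"
      by (simp add: inner_diff_left symX)
    also have "\<dots> = 0" unfolding w by (simp add: symG Gp)
    finally have "X p = 0" using X by (simp add: sqrt_op_eq_0_iff)
    then have "x \<bullet> p = 0" using x(2) closure_range_symop_iff[OF BplusD(3)[OF X]] by blast
    moreover have "x \<bullet> (g - p) = 0"
      using proj_diff[OF kG, of g] x(1) unfolding p_def[symmetric] ocomp_iff[OF kG(1)] by (simp add: inner_commute)
    ultimately show "x \<bullet> g = 0" by (simp add: inner_diff_right)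
  qed
  ultimately show ?thesis by blast
qed

lemma surj_if_bounded_below:
  fixes Q :: "'a::real_hilbert \<Rightarrow>\<^sub>L 'a"
  assumes Q: "symop Q" and m: "0 < m" and below: "\<And>f. m * norm f \<le> norm (Q f)"
  shows "range Q = UNIV"
proof -
  have "complete (Q ` UNIV)"
    using below by (intro complete_isometric_image[OF m]) (auto simp: complete_UNIV blinfun.bounded_linear_right)
  then have "closure (range Q) = range Q" by (simp add: complete_imp_closed)
  moreover have "x \<in> closure (range Q)" for x
  proof -
    have "y = 0" if "Q y = 0" for y using below[of y] that m by (simp add: mult_le_0_iff)
    then show ?thesis using closure_range_symop_iff[OF Q] inner_zero_right by metis
  qed
  ultimately show ?thesis by auto
qed

text \<open>Here \<open>sqrt X\<close> is onto, so every vector of \<open>range (sqrt G)\<close> is reached, and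
  \<open>sqrt X k \<bullet> g = k \<bullet> sqrt X g\<close> reduces orthogonality to \<open>sqrt G k = 0\<close>.\<close>

lemma ocomp_pre_range_positive_definite:
  assumes G: "G \<in> Bplus" and X: "X \<in> Bplus" and pd: "positive_definite X"
  shows "ocomp (pre_range G X) = sqrt_op X ` ker G"
proof -
  obtain m where m: "0 < m" "\<And>f. m * (norm f)\<^sup>2 \<le> X f \<bullet> f"
    using pd by (auto simp: positive_definite_def qform_eq)
  have "sqrt m * norm f \<le> norm (sqrt_op X f)" for f
  proof (rule power2_le_imp_le)
    show "(sqrt m * norm f)\<^sup>2 \<le> (norm (sqrt_op X f))\<^sup>2"
      using m by (simp add: power_mult_distrib norm_sqrt_op X)
  qed simp
  then have surj: "range (sqrt_op X) = UNIV"
    using m by (intro surj_if_bounded_below[of _ "sqrt m"] BplusD sqrt_op_Bplus X) auto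
  note cs = csubspace_pre_range[OF G X]
  note symX = symopD[OF BplusD(3)[OF sqrt_op_Bplus[OF X]]] and symG = symopD[OF BplusD(3)[OF sqrt_op_Bplus[OF G]]]
  have "sqrt_op X k \<in> ocomp (pre_range G X) \<longleftrightarrow> k \<in> ker G" for k
  proof
    assume k: "sqrt_op X k \<in> ocomp (pre_range G X)"
    obtain g where g: "sqrt_op X g = sqrt_op G (sqrt_op G k)" using surj by (metis UNIV_I imageE)
    then have "g \<in> pre_range G X" by simp
    then have "sqrt_op X k \<bullet> g = 0" using k unfolding ocomp_iff[OF cs] by blast
    then have "k \<bullet> sqrt_op G (sqrt_op G k) = 0" by (simp add: symX g)
    then have "sqrt_op G k \<bullet> sqrt_op G k = 0" by (simp add: symG)
    then show "k \<in> ker G" using G by (simp add: ker_def sqrt_op_eq_0_iff)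
  next
    assume "k \<in> ker G"
    then have k: "sqrt_op G k = 0" using G by (simp add: ker_def sqrt_op_eq_0_iff)
    show "sqrt_op X k \<in> ocomp (pre_range G X)" unfolding ocomp_iff[OF cs]
    proof
      fix g assume "g \<in> pre_range G X"
      then obtain w where w: "sqrt_op X g = sqrt_op G w" by auto
      have "sqrt_op X k \<bullet> g = sqrt_op G k \<bullet> w" unfolding symX w by (simp add: symG)
      then show "sqrt_op X k \<bullet> g = 0" by (simp add: k)
    qed
  qed
  then show ?thesis using surj by (auto simp: image_iff) (metis UNIV_I imageE)
qed

lemma Bplus0_iff: "A \<in> Bplus0 \<longleftrightarrow> A \<in> Bplus \<and> (\<forall>x. A x = 0 \<longrightarrow> x = 0)"
  by (auto simp: Bplus0_def ker_def blinfun.zero_right)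

lemma Bplus0_mono:
  assumes "A \<in> Bplus0" "B \<in> Bplus" "\<And>x. A x \<bullet> x \<le> B x \<bullet> x"
  shows "B \<in> Bplus0"
proof -
  have "x = 0" if "B x = 0" for x
  proof -
    have "A x \<bullet> x = 0" using assms(3)[of x] that posop_nonneg[OF BplusD(2), of A x] assms(1)
      by (simp add: Bplus0_iff)
    then show ?thesis using assms(1) posop_zero_form[OF BplusD(2), of A x] by (simp add: Bplus0_iff)
  qed
  then show ?thesis using assms(2) by (simp add: Bplus0_iff)
qed

context
  fixes G X :: "'a::chilbert_space \<Rightarrow>\<^sub>L 'a"
  assumes G: "G \<in> Bplus" and X: "X \<in> Bplus0"
begin

lemma X_Bplus: "X \<in> Bplus"
  using X by (simp add: Bplus0_iff)

lemma sqrt_op_inj: "sqrt_op X x = 0 \<Longrightarrow> x = 0"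
  using X by (simp add: Bplus0_iff sqrt_op_eq_0_iff)

lemma inv_sqrt_sqrt_op: "inv_sqrt X (sqrt_op X x) = x"
proof (rule inv_sqrt_eqI[OF X_Bplus])
  show "x \<in> closure (range X)"
    using X unfolding closure_range_symop_iff[OF BplusD(3)[OF X_Bplus]] Bplus0_iff by auto
qed simp

lemma inv_sqrt_image: "inv_sqrt X ` (range (sqrt_op X) \<inter> range (sqrt_op G)) = pre_range G X"
proof (intro set_eqI iffI)
  fix u assume "u \<in> inv_sqrt X ` (range (sqrt_op X) \<inter> range (sqrt_op G))"
  then obtain x where "u = inv_sqrt X (sqrt_op X x)" "sqrt_op X x \<in> range (sqrt_op G)" by blast
  then show "u \<in> pre_range G X" by (simp add: inv_sqrt_sqrt_op)
next
  fix u assume "u \<in> pre_range G X"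
  then have "sqrt_op X u \<in> range (sqrt_op X) \<inter> range (sqrt_op G)" "u = inv_sqrt X (sqrt_op X u)"
    by (auto simp: inv_sqrt_sqrt_op)
  then show "u \<in> inv_sqrt X ` (range (sqrt_op X) \<inter> range (sqrt_op G))" by (rule image_eqI[rotated])
qed

text \<open>All four criteria for a trivial kernel are translations of this one.\<close>

lemma tau_Bplus0_iff: "tau G X \<in> Bplus0 \<longleftrightarrow> (\<forall>f. sqrt_op X f \<in> closure (pre_range G X) \<longrightarrow> f = 0)"
proof -
  have "tau G X f = 0 \<longleftrightarrow> sqrt_op X f \<in> closure (pre_range G X)" for f
  proof -
    have "tau G X f = 0 \<longleftrightarrow> tau G X f \<bullet> f = 0"
      using posop_zero_form[OF BplusD(2)[OF tau_Bplus[OF G X_Bplus]]] by auto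
    also have "\<dots> \<longleftrightarrow> proj (ocomp (pre_range G X)) (sqrt_op X f) = 0"
      by (simp add: tau_form[OF G X_Bplus])
    also have "\<dots> \<longleftrightarrow> sqrt_op X f \<in> closure (pre_range G X)"
      by (simp add: proj_eq_0_iff[OF csubspace_ocomp closed_ocomp]
          closure_eq_ocomp_ocomp[OF csubspace_pre_range[OF G X_Bplus]])
    finally show ?thesis .
  qed
  then show ?thesis by (simp add: Bplus0_iff tau_Bplus[OF G X_Bplus])
qed

lemma tau_Bplus0_iff_Int:
  "tau G X \<in> Bplus0 \<longleftrightarrow> range (sqrt_op X) \<inter> closure (inv_sqrt X ` (range (sqrt_op X) \<inter> range (sqrt_op G))) = {0}"
proof -
  have "0 \<in> closure (pre_range G X)"
    using csubspace_closure[OF csubspace_pre_range[OF G X_Bplus]] by (simp add: csubspace_def subspace_0)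
  moreover have "0 \<in> range (sqrt_op X)" by (metis blinfun.zero_right rangeI)
  ultimately have "range (sqrt_op X) \<inter> closure (pre_range G X) = {0} \<longleftrightarrow>
      (\<forall>f. sqrt_op X f \<in> closure (pre_range G X) \<longrightarrow> sqrt_op X f = 0)" by blast
  also have "\<dots> \<longleftrightarrow> (\<forall>f. sqrt_op X f \<in> closure (pre_range G X) \<longrightarrow> f = 0)"
    using sqrt_op_inj blinfun.zero_right by metis
  finally show ?thesis unfolding inv_sqrt_image tau_Bplus0_iff by blast
qed

text \<open>The sequences \<open>z\<close> and \<open>\<lambda>n. inv_sqrt X (z n)\<close> determine each other through \<open>sqrt_op X\<close>, which is
  continuous, so joint convergence amounts to approximating a point from \<open>pre_range G X\<close>.\<close>

lemma convergent_inv_sqrt_iff: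
  "(\<exists>z. (\<forall>n. z n \<in> range (sqrt_op X) \<inter> range (sqrt_op G)) \<and> z \<longlonglongrightarrow> l \<and> convergent (\<lambda>n. inv_sqrt X (z n)))
   \<longleftrightarrow> l \<in> sqrt_op X ` closure (pre_range G X)"
proof
  assume "\<exists>z. (\<forall>n. z n \<in> range (sqrt_op X) \<inter> range (sqrt_op G)) \<and> z \<longlonglongrightarrow> l \<and> convergent (\<lambda>n. inv_sqrt X (z n))"
  then obtain z u where z: "\<And>n. z n \<in> range (sqrt_op X) \<inter> range (sqrt_op G)" "z \<longlonglongrightarrow> l"
    and u: "(\<lambda>n. inv_sqrt X (z n)) \<longlonglongrightarrow> u" by (auto simp: convergent_def)
  have "inv_sqrt X (z n) \<in> pre_range G X" for n unfolding inv_sqrt_image[symmetric] using z(1) by blast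
  then have "u \<in> closure (pre_range G X)"
    unfolding closure_sequential using u by (intro exI[of _ "\<lambda>n. inv_sqrt X (z n)"]) simp
  moreover have "(\<lambda>n. sqrt_op X (inv_sqrt X (z n))) \<longlonglongrightarrow> sqrt_op X u" by (intro tendsto_intros u)
  then have "z \<longlonglongrightarrow> sqrt_op X u" using inv_sqrt(2)[OF X_Bplus] z(1) by simp
  then have "l = sqrt_op X u" using z(2) LIMSEQ_unique by blast
  ultimately show "l \<in> sqrt_op X ` closure (pre_range G X)" by blast
next
  assume "l \<in> sqrt_op X ` closure (pre_range G X)"
  then obtain u where u: "l = sqrt_op X u" "u \<in> closure (pre_range G X)" by blast
  then obtain v where v: "\<And>n. v n \<in> pre_range G X" "v \<longlonglongrightarrow> u"
    unfolding closure_sequential by blast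
  show "\<exists>z. (\<forall>n. z n \<in> range (sqrt_op X) \<inter> range (sqrt_op G)) \<and> z \<longlonglongrightarrow> l \<and> convergent (\<lambda>n. inv_sqrt X (z n))"
  proof (intro exI[of _ "\<lambda>n. sqrt_op X (v n)"] conjI allI)
    show "sqrt_op X (v n) \<in> range (sqrt_op X) \<inter> range (sqrt_op G)" for n using v(1)[of n] by simp
    show "(\<lambda>n. sqrt_op X (v n)) \<longlonglongrightarrow> l" unfolding u(1) by (intro tendsto_intros v)
    show "convergent (\<lambda>n. inv_sqrt X (sqrt_op X (v n)))"
      using v(2) by (auto simp: inv_sqrt_sqrt_op convergent_def)
  qed
qed

end

lemma tau_Bplus0_imp:
  assumes "G \<in> Bplus" "X \<in> Bplus" "tau G X \<in> Bplus0"
  shows "X \<in> Bplus0"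
  using assms(3,2) tau_le[OF assms(1,2)] by (rule Bplus0_mono)

lemma sum_Bplus0:
  assumes "G \<in> Bplus" "X \<in> Bplus0"
  shows "G + X \<in> Bplus0"
proof (rule Bplus0_mono[OF assms(2)])
  show "G + X \<in> Bplus" using assms by (intro Bplus_add) (simp_all add: Bplus0_iff)
  show "X x \<bullet> x \<le> (G + X) x \<bullet> x" for x
    using posop_nonneg[OF BplusD(2)[OF assms(1)], of x] by (simp add: blinfun.add_left inner_add_left)
qed

lemma range_sqrt_op_sum:
  assumes "G \<in> Bplus" "X \<in> Bplus"
  shows "range (sqrt_op G) \<subseteq> range (sqrt_op (G + X))" "range (sqrt_op X) \<subseteq> range (sqrt_op (G + X))"
proof -
  have "G x \<bullet> x \<le> (G + X) x \<bullet> x" "X x \<bullet> x \<le> (G + X) x \<bullet> x" for x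
    using posop_nonneg[OF BplusD(2)[OF assms(1)], of x] posop_nonneg[OF BplusD(2)[OF assms(2)], of x]
    by (simp_all add: blinfun.add_left inner_add_left)
  then show "range (sqrt_op G) \<subseteq> range (sqrt_op (G + X))" "range (sqrt_op X) \<subseteq> range (sqrt_op (G + X))"
    using assms by (simp_all add: range_sqrt_op_mono Bplus_add)
qed

lemma tau_Bplus0_iff_sum_Int:
  assumes G: "G \<in> Bplus" and X: "X \<in> Bplus0"
  shows "tau G X \<in> Bplus0 \<longleftrightarrow>
    range (sqrt_op (G + X)) \<inter> closure (inv_sqrt (G + X) ` range (sqrt_op G)) = {0}"
proof -
  have XB: "X \<in> Bplus" using X by (simp add: Bplus0_iff)
  have "range (sqrt_op (G + X)) \<inter> range (sqrt_op G) = range (sqrt_op G)"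
    using range_sqrt_op_sum(1)[OF G XB] by blast
  then show ?thesis
    using tau_Bplus0_iff_Int[OF G sum_Bplus0[OF G X]] by (simp add: tau_add_self[OF G XB])
qed

lemma range_notin_iff: "(\<forall>f. h f \<in> C \<longrightarrow> h f = 0) \<longleftrightarrow> (\<forall>l. l \<in> range h \<and> l \<noteq> 0 \<longrightarrow> l \<notin> C)"
  by blast

lemma tau_Bplus0_iff_divergent:
  assumes G: "G \<in> Bplus" and X: "X \<in> Bplus0"
  shows "tau G X \<in> Bplus0 \<longleftrightarrow>
    (\<forall>z l. (\<forall>n. z n \<in> range (sqrt_op X) \<inter> range (sqrt_op G)) \<and> z \<longlonglongrightarrow> l \<and> l \<in> range X \<and> l \<noteq> 0 \<longrightarrow>
      \<not> convergent (\<lambda>n. inv_sqrt X (z n)))"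
proof -
  have XB: "X \<in> Bplus" using X by (simp add: Bplus0_iff)
  have mem: "X f \<in> sqrt_op X ` closure (pre_range G X) \<longleftrightarrow> sqrt_op X f \<in> closure (pre_range G X)" for f
  proof
    assume "X f \<in> sqrt_op X ` closure (pre_range G X)"
    then obtain u where u: "u \<in> closure (pre_range G X)" "sqrt_op X (sqrt_op X f) = sqrt_op X u"
      by (auto simp: sqrt_op_apply[OF XB])
    then have "sqrt_op X (sqrt_op X f - u) = 0" by (simp add: blinfun.diff_right)
    then have "sqrt_op X f = u" using sqrt_op_inj[OF G X] by (metis eq_iff_diff_eq_0)
    then show "sqrt_op X f \<in> closure (pre_range G X)" using u by simp
  next
    assume "sqrt_op X f \<in> closure (pre_range G X)"
    then show "X f \<in> sqrt_op X ` closure (pre_range G X)"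
      by (intro image_eqI[where x="sqrt_op X f"]) (simp_all add: sqrt_op_apply[OF XB])
  qed
  have inj: "X f = 0 \<longleftrightarrow> f = 0" for f using X by (auto simp: Bplus0_iff blinfun.zero_right)
  have "tau G X \<in> Bplus0 \<longleftrightarrow> (\<forall>f. X f \<in> sqrt_op X ` closure (pre_range G X) \<longrightarrow> X f = 0)"
    unfolding tau_Bplus0_iff[OF G X] mem inj ..
  also have "\<dots> \<longleftrightarrow> (\<forall>l. l \<in> range X \<and> l \<noteq> 0 \<longrightarrow> l \<notin> sqrt_op X ` closure (pre_range G X))"
    by (rule range_notin_iff)
  finally show ?thesis unfolding convergent_inv_sqrt_iff[OF G X, symmetric] by (simp only: not_ex de_Morgan_conj) blast
qed

lemma tau_Bplus0_iff_sum_divergent: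
  assumes G: "G \<in> Bplus" and X: "X \<in> Bplus0"
  shows "tau G X \<in> Bplus0 \<longleftrightarrow>
    (\<forall>y l. (\<forall>n. y n \<in> range (sqrt_op G)) \<and> y \<longlonglongrightarrow> l \<and> l \<in> range X \<and> l \<noteq> 0 \<longrightarrow>
      \<not> convergent (\<lambda>n. inv_sqrt (G + X) (y n)))"
proof -
  have XB: "X \<in> Bplus" using X by (simp add: Bplus0_iff)
  let ?S = "G + X"
  note S = sum_Bplus0[OF G X]
  have SB: "?S \<in> Bplus" using S by (simp add: Bplus0_iff)
  have abs: "range (sqrt_op ?S) \<inter> range (sqrt_op G) = range (sqrt_op G)"
    using range_sqrt_op_sum(1)[OF G XB] by blast
  have sub: "subspace (closure (pre_range G ?S))"
    using csubspace_closure[OF csubspace_pre_range[OF G SB]] by (simp add: csubspace_def)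
  have mem: "X f \<in> sqrt_op ?S ` closure (pre_range G ?S) \<longleftrightarrow> sqrt_op ?S f \<in> closure (pre_range G ?S)" for f
  proof -
    \<comment> \<open>\<open>X f\<close> and \<open>(G + X) f\<close> differ by \<open>G f\<close>, which lies in \<open>range (sqrt_op G)\<close>.\<close>
    have Gf: "G f \<in> range (sqrt_op G)" unfolding sqrt_op_apply[OF G, symmetric] by (rule rangeI)
    then have "G f \<in> range (sqrt_op ?S)" using range_sqrt_op_sum(1)[OF G XB] by (rule subsetD[rotated])
    then obtain g where g1: "G f = sqrt_op ?S g" by (rule rangeE)
    then have "g \<in> pre_range G ?S" using Gf by simp
    then have g: "sqrt_op ?S g = G f" "g \<in> closure (pre_range G ?S)"
      using g1 closure_subset[of "pre_range G ?S"] by auto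
    have Xf: "X f = sqrt_op ?S (sqrt_op ?S f - g)"
      by (simp add: blinfun.diff_right g sqrt_op_apply[OF SB] blinfun.add_left)
    have "X f \<in> sqrt_op ?S ` closure (pre_range G ?S) \<longleftrightarrow> sqrt_op ?S f - g \<in> closure (pre_range G ?S)"
    proof
      assume "X f \<in> sqrt_op ?S ` closure (pre_range G ?S)"
      then obtain u where u: "u \<in> closure (pre_range G ?S)" "sqrt_op ?S (sqrt_op ?S f - g) = sqrt_op ?S u"
        using Xf by auto
      then have "sqrt_op ?S ((sqrt_op ?S f - g) - u) = 0" by (simp only: blinfun.diff_right[of _ _ u]) simp
      then have "sqrt_op ?S f - g = u" using sqrt_op_inj[OF G S] by (metis eq_iff_diff_eq_0)
      then show "sqrt_op ?S f - g \<in> closure (pre_range G ?S)" using u by simp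
    next
      assume "sqrt_op ?S f - g \<in> closure (pre_range G ?S)"
      then show "X f \<in> sqrt_op ?S ` closure (pre_range G ?S)" unfolding Xf by (rule imageI)
    qed
    also have "\<dots> \<longleftrightarrow> sqrt_op ?S f \<in> closure (pre_range G ?S)"
      using subspace_add[OF sub _ g(2), of "sqrt_op ?S f - g"] subspace_diff[OF sub _ g(2), of "sqrt_op ?S f"]
      by auto
    finally show ?thesis .
  qed
  have inj: "X f = 0 \<longleftrightarrow> f = 0" for f using X by (auto simp: Bplus0_iff blinfun.zero_right)
  have "tau G X \<in> Bplus0 \<longleftrightarrow> tau G ?S \<in> Bplus0" by (simp add: tau_add_self[OF G XB])
  also have "\<dots> \<longleftrightarrow> (\<forall>f. X f \<in> sqrt_op ?S ` closure (pre_range G ?S) \<longrightarrow> X f = 0)"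
    unfolding tau_Bplus0_iff[OF G S] mem inj ..
  also have "\<dots> \<longleftrightarrow> (\<forall>l. l \<in> range X \<and> l \<noteq> 0 \<longrightarrow> l \<notin> sqrt_op ?S ` closure (pre_range G ?S))"
    by (rule range_notin_iff)
  finally show ?thesis unfolding convergent_inv_sqrt_iff[OF G S, symmetric] abs by (simp only: not_ex de_Morgan_conj) blast
qed

text \<open>If \<open>X f\<close> lies in the range of \<open>sqrt G\<close>, then \<open>sqrt X f\<close> belongs to the preimage, which the
  projection annihilates; so \<open>tau G X f = 0\<close>.\<close>

lemma par_sum_square_eq_0:
  assumes G: "G \<in> Bplus" and X: "X \<in> Bplus" and t: "tau G X \<in> Bplus0"
  shows "par_sum (X o\<^sub>L X) G = 0"
proof -
  have X0: "X \<in> Bplus0" by (rule tau_Bplus0_imp[OF G X t])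
  have XX: "X o\<^sub>L X \<in> Bplus"
    using BplusD[OF X] by (simp add: Bplus_iff posop_square clinear_op_arith)
  have sq: "sqrt_op (X o\<^sub>L X) = X" by (rule sqrt_op_eqI[OF X refl XX])
  have "X f = 0" if "X f \<in> range (sqrt_op G)" for f
  proof -
    have "sqrt_op X f \<in> pre_range G X" using that by (simp add: sqrt_op_apply[OF X])
    then have "sqrt_op X f \<in> closure (pre_range G X)" by (rule subsetD[OF closure_subset])
    then have "f = 0" using t unfolding tau_Bplus0_iff[OF G X0] by blast
    then show ?thesis by (simp add: blinfun.zero_right)
  qed
  moreover have "0 \<in> range X" "0 \<in> range (sqrt_op G)" by (metis blinfun.zero_right rangeI)+
  ultimately show ?thesis
    by (intro par_sum_eq_0I[OF G XX]) (auto simp: sq)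
qed

section \<open>Uniform boundedness and equal ranges\<close>

text \<open>Uniform boundedness for functionals given by vectors, from the Baire category theorem.\<close>

lemma weakly_bounded_imp_bounded:
  fixes W :: "'a::real_hilbert set"
  assumes "\<And>h. \<exists>c. \<forall>w\<in>W. \<bar>h \<bullet> w\<bar> \<le> c"
  obtains c where "0 \<le> c" "\<And>w. w \<in> W \<Longrightarrow> norm w \<le> c"
proof -
  define T where "T n = {h. \<forall>w\<in>W. \<bar>h \<bullet> w\<bar> \<le> real n}" for n
  have T_closed: "closed (T n)" for n
  proof -
    have "T n = (\<Inter>w\<in>W. {h. \<bar>h \<bullet> w\<bar> \<le> real n})" by (auto simp: T_def)
    also have "closed \<dots>" by (intro closed_INT ballI closed_Collect_le continuous_intros)
    finally show ?thesis .
  qed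
  have cover: "\<Union>(range T) = UNIV"
  proof -
    have "h \<in> \<Union>(range T)" for h
    proof -
      obtain c where "\<forall>w\<in>W. \<bar>h \<bullet> w\<bar> \<le> c" using assms by blast
      moreover obtain n where "c \<le> real n" using real_arch_simple by blast
      ultimately have "h \<in> T n" by (auto simp: T_def intro: order_trans)
      then show ?thesis by blast
    qed
    then show ?thesis by blast
  qed
  have "\<exists>n. interior (T n) \<noteq> {}"
  proof (rule ccontr)
    assume "\<nexists>n. interior (T n) \<noteq> {}"
    then have "(euclidean :: 'a topology) interior_of \<Union>(range T) = {}"
      using Met_TC.metric_Baire_category_alt[where ?'a='a, of "range T"] T_closed complete_UNIV
      by auto
    then show False unfolding cover by simp
  qed
  then obtain n x where "x \<in> interior (T n)" by blast
  then obtain r where r: "0 < r" "cball x r \<subseteq> T n" by (meson mem_interior_cball)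
  show thesis
  proof (rule that[of "2 * real n / r"])
    show "0 \<le> 2 * real n / r" using r by simp
    fix w assume w: "w \<in> W"
    have "norm w \<le> 2 * real n / r"
    proof (cases "w = 0")
      case False
      define h where "h = (r / norm w) *\<^sub>R w"
      have "norm h = r" using False r by (simp add: h_def)
      then have "x \<in> T n" "x + h \<in> T n" using r by (auto simp: dist_norm)
      then have "\<bar>x \<bullet> w\<bar> \<le> real n" "\<bar>x \<bullet> w + h \<bullet> w\<bar> \<le> real n" using w by (auto simp: T_def inner_add_left)
      then have "h \<bullet> w \<le> 2 * real n" by linarith
      moreover have "h \<bullet> w = r * norm w"
        using False by (simp add: h_def power2_norm_eq_inner[symmetric] power2_eq_square)
      ultimately show ?thesis using r by (simp add: field_simps)
    qed (use r in simp)
    then show "norm w \<le> 2 * real n / r" .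
  qed
qed

text \<open>The converse of Douglas factorization. If \<open>A h = Q y\<close>, then \<open>h \<bullet> A k = y \<bullet> Q k\<close>; hence the vectors
  \<open>A k\<close> with \<open>norm (Q k) \<le> 1\<close> are weakly bounded.\<close>

lemma range_subset_imp_norm_le:
  fixes A Q :: "'a::real_hilbert \<Rightarrow>\<^sub>L 'a"
  assumes A: "symop A" and Q: "symop Q" and sub: "range A \<subseteq> range Q"
  obtains c where "0 \<le> c" "\<And>k. norm (A k) \<le> c * norm (Q k)"
proof -
  have dual: "\<exists>y. \<forall>k. h \<bullet> A k = y \<bullet> Q k" for h
  proof -
    obtain y where y: "A h = Q y" using sub by blast
    have "h \<bullet> A k = y \<bullet> Q k" for k using symopD[OF A, of h k] symopD[OF Q, of y k] y by simp
    then show ?thesis by blast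
  qed
  let ?W = "{A k | k. norm (Q k) \<le> 1}"
  have "\<exists>c. \<forall>w\<in>?W. \<bar>h \<bullet> w\<bar> \<le> c" for h
  proof -
    obtain y where y: "\<And>k. h \<bullet> A k = y \<bullet> Q k" using dual by blast
    have "\<bar>h \<bullet> A k\<bar> \<le> norm y" if k: "norm (Q k) \<le> 1" for k
      using Cauchy_Schwarz_ineq2[of y "Q k"] mult_left_mono[OF k, of "norm y"] by (simp add: y)
    then show ?thesis by blast
  qed
  then obtain c where c: "0 \<le> c" "\<And>w. w \<in> ?W \<Longrightarrow> norm w \<le> c"
    using weakly_bounded_imp_bounded[of ?W] by blast
  have "norm (A k) \<le> c * norm (Q k)" for k
  proof (cases "Q k = 0")
    case True
    obtain y where "\<And>k'. A k \<bullet> A k' = y \<bullet> Q k'" using dual by blast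
    then have "A k \<bullet> A k = 0" using True by (metis inner_zero_right)
    then show ?thesis using c by simp
  next
    case False
    have "norm (Q ((1 / norm (Q k)) *\<^sub>R k)) \<le> 1" using False by (simp add: blinfun.scaleR_right)
    then have "norm (A ((1 / norm (Q k)) *\<^sub>R k)) \<le> c" by (intro c(2)) blast
    then show ?thesis using False by (simp add: blinfun.scaleR_right field_simps)
  qed
  then show thesis using that c(1) by blast
qed

text \<open>Factor \<open>A = sqrt X Y\<close>. All vectors \<open>Y (C h)\<close> are mapped by \<open>sqrt X\<close> into the range of \<open>sqrt G\<close>. A
  vector \<open>l\<close> orthogonal to them satisfies \<open>C Y* l = 0\<close>, so \<open>A Y* l = 0\<close> and \<open>Y* l = 0\<close>; since \<open>sqrt X\<close>
  and \<open>A\<close> have equal ranges, \<open>l\<close> itself is of the form \<open>Y h\<close>, and therefore \<open>l = 0\<close>.\<close>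

lemma tau_eq_0_of_factor:
  assumes G: "G \<in> Bplus" and X: "X \<in> Bplus" and A: "symop A" and C: "symop C"
    and ran: "range (sqrt_op X) = range A"
    and AC: "\<And>x. A (C x) = sqrt_op G x" and ker: "\<And>x. C x = 0 \<Longrightarrow> A x = 0"
  shows "tau G X = 0"
proof -
  let ?Q = "sqrt_op X"
  have Q: "symop ?Q" using X by (intro BplusD sqrt_op_Bplus)
  have adjs: "adj A = A" "adj ?Q = ?Q" using A Q by (simp_all add: symop_adj)
  obtain c where "0 \<le> c" "\<And>k. norm (A k) \<le> c * norm (?Q k)"
    using range_subset_imp_norm_le[OF A Q] ran by blast
  then obtain Y :: "'a \<Rightarrow>\<^sub>L 'a" where Y: "A = ?Q o\<^sub>L Y" "\<And>y. Y y \<in> closure (range ?Q)"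
    using douglas[of c A ?Q] unfolding adjs by blast
  have QY: "?Q (Y x) = A x" for x using Y(1) by simp
  have inj: "u = 0" if "u \<in> closure (range ?Q)" "?Q u = 0" for u
    using that closure_range_symop_iff[OF Q] by (metis inner_eq_zero_iff)
  have cs: "subspace (closure (range ?Q))"
    using csubspace_closure[OF csubspace_range[OF BplusD(1)[OF sqrt_op_Bplus[OF X]]]] by (simp add: csubspace_def)
  note L_iff = ocomp_iff[OF csubspace_pre_range[OF G X]]
  have L0: "l = 0" if l: "l \<in> ocomp (pre_range G X)" for l
  proof -
    have "l \<bullet> y = 0" if "?Q y = 0" for y
    proof -
      have "?Q y = sqrt_op G 0" using that by (simp add: blinfun.zero_right)
      then have "y \<in> pre_range G X" by blast
      then show ?thesis using l unfolding L_iff by blast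
    qed
    then have l_cl: "l \<in> closure (range ?Q)" using closure_range_symop_iff[OF Q] by blast
    have "l \<bullet> Y (C h) = 0" for h
    proof -
      have "Y (C h) \<in> pre_range G X" by (simp add: QY AC)
      then show ?thesis using l unfolding L_iff by blast
    qed
    then have "C (adj Y l) \<bullet> h = 0" for h by (simp add: symopD[OF C] inner_adj')
    then have "C (adj Y l) = 0" by (metis inner_eq_zero_iff)
    then have "A (adj Y l) = 0" by (rule ker)
    then have "?Q (Y (adj Y l)) = 0" by (simp add: QY)
    then have "Y (adj Y l) = 0" by (rule inj[OF Y(2)])
    then have "adj Y l \<bullet> adj Y l = 0" by (simp add: inner_adj')
    then have Yl: "adj Y l = 0" by simp
    \<comment> \<open>By the equality of ranges \<open>l = Y h\<close>, so \<open>l \<bullet> l = adj Y l \<bullet> h = 0\<close>.\<close>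
    obtain h where h: "?Q l = A h" using ran by blast
    have "l - Y h \<in> closure (range ?Q)" using cs l_cl Y(2) by (simp add: subspace_diff)
    then have "l - Y h = 0" by (rule inj) (simp add: blinfun.diff_right h QY)
    then have "l \<bullet> l = l \<bullet> Y h" by simp
    also have "\<dots> = adj Y l \<bullet> h" by (simp add: inner_adj')
    finally show "l = 0" by (simp add: Yl)
  qed
  show ?thesis
  proof (rule Bplus_eq_0I[OF tau_Bplus[OF G X]])
    show "tau G X f \<bullet> f = 0" for f
      using L0[OF proj_in[OF csubspace_ocomp closed_ocomp]] by (simp add: tau_form[OF G X])
  qed
qed

section \<open>Powers\<close>

context
  fixes G :: "'a::chilbert_space \<Rightarrow>\<^sub>L 'a"
  assumes G: "G \<in> Bplus"
begin

lemma powr_continuous: "0 < a \<Longrightarrow> continuous_on {0..norm G} (\<lambda>t. t powr a)"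
  by (intro continuous_on_powr' continuous_intros) auto

lemma fun_calc_powr_Bplus: "0 < a \<Longrightarrow> fun_calc (\<lambda>t. t powr a) G \<in> Bplus"
  using G powr_continuous by (intro fun_calc_Bplus) auto

lemma fun_calc_powr_add:
  assumes "0 < a" "0 < b"
  shows "fun_calc (\<lambda>t. t powr a) G (fun_calc (\<lambda>t. t powr b) G x) = fun_calc (\<lambda>t. t powr (a + b)) G x"
  using fun_calc_mult[OF BplusD(2)[OF G] powr_continuous[OF assms(1)] powr_continuous[OF assms(2)]]
  by (simp add: powr_add)

lemma fun_calc_powr_1: "fun_calc (\<lambda>t. t powr 1) G = G"
proof -
  have "fun_calc (\<lambda>t. t powr 1) G = fun_calc (\<lambda>t. t) G" by (rule fun_calc_cong) simp
  then show ?thesis by (simp add: fun_calc_id BplusD(2)[OF G])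
qed

lemma sqrt_op_eq_powr: "sqrt_op G = fun_calc (\<lambda>t. t powr (1/2)) G"
proof (rule sqrt_op_eqI[OF _ _ G])
  show "fun_calc (\<lambda>t. t powr (1/2)) G \<in> Bplus" by (rule fun_calc_powr_Bplus) simp
  show "fun_calc (\<lambda>t. t powr (1/2)) G o\<^sub>L fun_calc (\<lambda>t. t powr (1/2)) G = G"
    using fun_calc_powr_add[of "1/2" "1/2"] by (intro blinfun_eqI) (simp add: fun_calc_powr_1[simplified])
qed

text \<open>Exponents below \<open>1\<close> are complemented to \<open>1\<close>; halving reduces larger exponents to these, since
  \<open>H (H x) = 0\<close> implies \<open>H x = 0\<close> for symmetric \<open>H\<close>.\<close>

lemma fun_calc_powr_ker:
  assumes "0 < a"
  shows "fun_calc (\<lambda>t. t powr a) G x = 0 \<longleftrightarrow> G x = 0"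
proof
  assume "G x = 0"
  then have "G x = 0 *\<^sub>R x" by simp
  from fun_calc_eigen[OF BplusD(2)[OF G] powr_continuous[OF assms] this]
  show "fun_calc (\<lambda>t. t powr a) G x = 0" by simp
next
  have main: "\<forall>b. 0 < b \<and> b \<le> 2 ^ n \<longrightarrow> fun_calc (\<lambda>t. t powr b) G x = 0 \<longrightarrow> G x = 0" for n
  proof (induction n)
    case 0
    show ?case
    proof (intro allI impI)
      fix b :: real assume b: "0 < b \<and> b \<le> 2 ^ 0" and z: "fun_calc (\<lambda>t. t powr b) G x = 0"
      show "G x = 0"
      proof (cases "b = 1")
        case True
        then show ?thesis using z by (simp only: fun_calc_powr_1)
      next
        case False
        then have "fun_calc (\<lambda>t. t powr ((1 - b) + b)) G x = 0"
          using b z by (subst fun_calc_powr_add[symmetric]) (auto simp: blinfun.zero_right)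
        moreover have "(1 - b) + b = 1" by simp
        ultimately show ?thesis by (simp only: fun_calc_powr_1)
      qed
    qed
  next
    case (Suc n)
    show ?case
    proof (intro allI impI)
      fix b :: real assume b: "0 < b \<and> b \<le> 2 ^ Suc n" and z: "fun_calc (\<lambda>t. t powr b) G x = 0"
      let ?H = "fun_calc (\<lambda>t. t powr (b/2)) G"
      have "?H (?H x) = 0" using fun_calc_powr_add[of "b/2" "b/2" x] b z by simp
      then have "?H x \<bullet> ?H x = 0"
        using symopD[OF BplusD(3)[OF fun_calc_powr_Bplus], of "b/2" x "?H x"] b by simp
      then have "?H x = 0" by simp
      moreover have "0 < b/2 \<and> b/2 \<le> 2 ^ n" using b by simp
      ultimately show "G x = 0" using Suc by blast
    qed
  qed
  obtain n where "a < 2 ^ n" using real_arch_pow[of 2 a] by auto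
  then show "fun_calc (\<lambda>t. t powr a) G x = 0 \<Longrightarrow> G x = 0" using main[of n] assms by force
qed

lemma closure_range_csubspace: "csubspace (closure (range G))"
  by (rule csubspace_closure[OF csubspace_range[OF BplusD(1)[OF G]]])

lemma ran_powr_nonpos:
  assumes "a \<le> 0"
  shows "ran_powr G a = closure (range G)"
proof (cases "a = 0")
  case True
  note K = closure_range_csubspace closed_closure[of "range G"]
  have "x \<in> range (proj (closure (range G)))" if "x \<in> closure (range G)" for x
    using proj_same[OF K that] by (metis rangeI)
  then show ?thesis using True proj_in[OF K] by (auto simp: ran_powr_def)
next
  case False
  define b where "b = - a"
  have b: "0 < b" using False assms by (simp add: b_def)
  let ?H = "fun_calc (\<lambda>t. t powr b) G"
  have H: "?H \<in> Bplus" by (rule fun_calc_powr_Bplus[OF b])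
  have cl: "closure (range ?H) = closure (range G)"
    using closure_range_symop_iff[OF BplusD(3)[OF H]] closure_range_symop_iff[OF BplusD(3)[OF G]]
    by (intro set_eqI) (simp add: fun_calc_powr_ker[OF b])
  have inj: "u = v" if uv: "u \<in> closure (range G)" "v \<in> closure (range G)" "?H u = ?H v" for u v
  proof -
    have "?H (u - v) = 0" using uv(3) by (simp add: blinfun.diff_right)
    then have "G (u - v) = 0" by (simp add: fun_calc_powr_ker[OF b])
    moreover have "u - v \<in> closure (range G)"
      using closure_range_csubspace uv by (simp add: csubspace_def subspace_diff)
    ultimately have "(u - v) \<bullet> (u - v) = 0" using closure_range_symop_iff[OF BplusD(3)[OF G]] by blast
    then show ?thesis by simp
  qed
  have the: "(THE x. x \<in> closure (range G) \<and> ?H x = ?H u) = u" if "u \<in> closure (range G)" for u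
    using that inj by (intro the_equality) auto
  have "range ?H = ?H ` closure (range G)"
  proof -
    have "?H x \<in> ?H ` closure (range G)" for x
    proof -
      obtain z where "z \<in> closure (range ?H)" "?H z = ?H x"
        using ex_preimage_in_closure_range[OF BplusD(1)[OF H] BplusD(3)[OF H], of x] by blast
      then show ?thesis unfolding cl by (metis imageI)
    qed
    then show ?thesis by blast
  qed
  then have "ran_powr G a = (\<lambda>u. THE x. x \<in> closure (range G) \<and> ?H x = ?H u) ` closure (range G)"
    using False assms by (simp add: ran_powr_def b_def image_image)
  also have "\<dots> = closure (range G)" using the by simp
  finally show ?thesis .
qed

text \<open>For \<open>a \<le> 0\<close> the range is the closure of the range of \<open>G\<close>, and the projection onto it takes the
  role of \<open>G\<^sup>a\<close>.\<close>

lemma tau_eq_0_of_range_powr: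
  assumes X: "X \<in> Bplus" and a: "a < 1/2" and ran: "range (sqrt_op X) = ran_powr G a"
  shows "tau G X = 0"
proof (cases "0 < a")
  case True
  let ?A = "fun_calc (\<lambda>t. t powr a) G" and ?C = "fun_calc (\<lambda>t. t powr (1/2 - a)) G"
  show ?thesis
  proof (rule tau_eq_0_of_factor[OF G X])
    show "symop ?A" "symop ?C" using True a by (auto intro!: BplusD(3) fun_calc_powr_Bplus)
    show "range (sqrt_op X) = range ?A" using ran True by (simp add: ran_powr_def)
    show "?A (?C x) = sqrt_op G x" for x
      using True a by (simp add: fun_calc_powr_add sqrt_op_eq_powr)
    show "?A x = 0" if "?C x = 0" for x using that True a by (simp add: fun_calc_powr_ker)
  qed
next
  case False
  note K = closure_range_csubspace closed_closure[of "range G"]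
  let ?A = "proj (closure (range G))"
  show ?thesis
  proof (rule tau_eq_0_of_factor[OF G X])
    show "symop ?A" by (rule proj_symop[OF K])
    show "symop (sqrt_op G)" using G by (intro BplusD(3) sqrt_op_Bplus)
    have "range ?A = closure (range G)" using ran_powr_nonpos[of 0] by (simp add: ran_powr_def)
    then show "range (sqrt_op X) = range ?A" using ran ran_powr_nonpos[of a] False by simp
    show "?A (sqrt_op G x) = sqrt_op G x" for x
    proof (rule proj_same[OF K])
      have "sqrt_op G x \<in> closure (range (sqrt_op G))" by (rule subsetD[OF closure_subset rangeI])
      then show "sqrt_op G x \<in> closure (range G)" by (simp add: closure_range_sqrt_op G)
    qed
    show "?A x = 0" if "sqrt_op G x = 0" for x
    proof (rule proj_ocomp[OF K])
      have "G x = 0" using that G by (simp add: sqrt_op_eq_0_iff)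
      then have "x \<bullet> y = 0" if "y \<in> closure (range G)" for y
        using that closure_range_symop_iff[OF BplusD(3)[OF G], of y] by (metis inner_commute)
      then show "x \<in> ocomp (closure (range G))" by (simp add: ocomp_iff[OF K(1)])
    qed
  qed
qed

end

section \<open>Finite orthonormal families\<close>

interpretation cvs: vector_space "scaleC :: complex \<Rightarrow> 'a \<Rightarrow> 'a::chilbert_space"
  by unfold_locales (simp_all add: scaleC_add_right scaleC_add_left scaleC_scaleC)

definition corthonormal :: "'a::chilbert_space set \<Rightarrow> bool"
  where "corthonormal B \<longleftrightarrow> (\<forall>x\<in>B. \<forall>y\<in>B. cinner x y = (if x = y then 1 else 0))"

definition fourier_sum :: "'a::chilbert_space set \<Rightarrow> 'a \<Rightarrow> 'a"
  where "fourier_sum B x = (\<Sum>e\<in>B. cinner x e *\<^sub>C e)"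

lemma cinner_zero_left [simp]: "cinner 0 y = 0"
  using cinner_add_left[of 0 0 y] by simp

lemma cinner_sum_left: "cinner (\<Sum>i\<in>I. f i) y = (\<Sum>i\<in>I. cinner (f i) y)"
  by (induction I rule: infinite_finite_induct) (simp_all add: cinner_add_left)

lemma cinner_diff_left: "cinner (x - y) z = cinner x z - cinner y z"
  using cinner_add_left[of "x - y" y z] by simp

lemma scaleC_sum_right: "c *\<^sub>C (\<Sum>i\<in>I. f i) = (\<Sum>i\<in>I. c *\<^sub>C f i)"
  for f :: "'i \<Rightarrow> 'a::chilbert_space"
  by (induction I rule: infinite_finite_induct) (simp_all add: scaleC_add_right)

lemma inner_via_cinner: "x \<bullet> y = Re (cinner x y)"
  by (rule inner_Re_cinner)

lemma cinner_self: "cinner x x = of_real ((norm x)\<^sup>2)"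
proof -
  have "cinner x x = cnj (cinner x x)" by (rule cinner_commute)
  then have "Im (cinner x x) = 0" by (simp add: complex_eq_iff)
  then show ?thesis by (simp add: complex_eq_iff Re_cinner power2_norm_eq_inner)
qed

context
  fixes B :: "'a::chilbert_space set"
  assumes fin: "finite B" and on: "corthonormal B"
begin

lemma cinner_combination:
  assumes "f \<in> B"
  shows "cinner (\<Sum>e\<in>B. c e *\<^sub>C e) f = c f"
proof -
  have "cinner (\<Sum>e\<in>B. c e *\<^sub>C e) f = (\<Sum>e\<in>B. if e = f then c e else 0)"
    unfolding cinner_sum_left using on assms
    by (intro sum.cong) (auto simp: cinner_scaleC_left corthonormal_def)
  then show ?thesis using fin assms by simp
qed

lemma fourier_residual_orth: "f \<in> B \<Longrightarrow> cinner (x - fourier_sum B x) f = 0"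
  by (simp add: cinner_diff_left fourier_sum_def cinner_combination)

lemma inner_combination_orth:
  assumes "\<And>f. f \<in> B \<Longrightarrow> cinner r f = 0"
  shows "(\<Sum>e\<in>B. c e *\<^sub>C e) \<bullet> r = 0"
proof -
  have "cinner e r = 0" if "e \<in> B" for e
    using assms[OF that] cinner_commute[of e r] by simp
  then have "cinner (\<Sum>e\<in>B. c e *\<^sub>C e) r = 0"
    by (simp add: cinner_sum_left cinner_scaleC_left)
  then show ?thesis by (simp add: inner_via_cinner)
qed

lemma norm_fourier_sum: "(norm (fourier_sum B x))\<^sup>2 = (\<Sum>e\<in>B. (cmod (cinner x e))\<^sup>2)"
proof -
  have "cinner (fourier_sum B x) (fourier_sum B x) =
      (\<Sum>e\<in>B. cinner x e * cinner e (fourier_sum B x))"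
    by (subst fourier_sum_def) (simp add: cinner_sum_left cinner_scaleC_left)
  also have "\<dots> = (\<Sum>e\<in>B. of_real ((cmod (cinner x e))\<^sup>2))"
  proof (rule sum.cong[OF refl])
    fix e assume e: "e \<in> B"
    have "cinner (fourier_sum B x) e = cinner x e"
      unfolding fourier_sum_def by (rule cinner_combination[OF e])
    then have "cinner e (fourier_sum B x) = cnj (cinner x e)"
      using cinner_commute[of e "fourier_sum B x"] by simp
    then show "cinner x e * cinner e (fourier_sum B x) = of_real ((cmod (cinner x e))\<^sup>2)"
      using complex_norm_square[of "cinner x e"] by simp
  qed
  finally have "complex_of_real ((norm (fourier_sum B x))\<^sup>2) = of_real (\<Sum>e\<in>B. (cmod (cinner x e))\<^sup>2)"
    by (simp add: cinner_self)
  then show ?thesis by (simp only: of_real_eq_iff)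
qed

lemma fourier_pythagoras: "(norm x)\<^sup>2 = (norm (fourier_sum B x))\<^sup>2 + (norm (x - fourier_sum B x))\<^sup>2"
proof -
  have "fourier_sum B x \<bullet> (x - fourier_sum B x) = 0"
    unfolding fourier_sum_def[of B x]
    by (rule inner_combination_orth) (use fourier_residual_orth in \<open>simp add: fourier_sum_def\<close>)
  then show ?thesis by (simp add: power2_norm_eq_inner inner_diff inner_commute)
qed

lemma bessel: "(\<Sum>e\<in>B. (cmod (cinner x e))\<^sup>2) \<le> (norm x)\<^sup>2"
  using fourier_pythagoras[of x] by (simp add: norm_fourier_sum)

lemma norm_fourier_residual_le: "norm (x - fourier_sum B x) \<le> norm x"
  by (rule power2_le_imp_le) (use fourier_pythagoras[of x] in auto)

lemma fourier_sum_diff: "fourier_sum B (x - y) = fourier_sum B x - fourier_sum B y"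
proof -
  have "(a - b) *\<^sub>C e = a *\<^sub>C e - b *\<^sub>C e" for a b and e :: 'a
    using scaleC_add_left[of "a - b" b e] by simp
  then show ?thesis by (simp add: fourier_sum_def cinner_diff_left sum_subtractf)
qed

lemma corthonormal_independent: "cvs.independent B"
proof (rule cvs.independent_if_scalars_zero[OF fin])
  fix f x assume "(\<Sum>x\<in>B. f x *\<^sub>C x) = 0" "x \<in> B"
  then show "f x = 0" using cinner_combination[of x f] by simp
qed

end

lemma csubspace_fourier_sum:
  assumes "csubspace E" "B \<subseteq> E"
  shows "fourier_sum B x \<in> E"
  unfolding fourier_sum_def using assms
  by (intro subspace_sum) (auto simp: csubspace_def)

text \<open>An orthonormal subset of maximal cardinality spans: a nonzero residual could be normalized and
  added.\<close>

lemma ex_orthonormal_basis: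
  fixes E :: "'a::chilbert_space set"
  assumes E: "csubspace E"
    and bound: "\<And>B. finite B \<Longrightarrow> corthonormal B \<Longrightarrow> B \<subseteq> E \<Longrightarrow> card B \<le> N"
  obtains B where "finite B" "corthonormal B" "B \<subseteq> E" "\<And>x. x \<in> E \<Longrightarrow> fourier_sum B x = x"
    "vector_space.dim scaleC E = card B"
proof -
  let ?P = "\<lambda>k. \<exists>B. finite B \<and> corthonormal B \<and> B \<subseteq> E \<and> card B = k"
  have "?P 0" by (intro exI[of _ "{}"]) (simp add: corthonormal_def)
  then obtain k where k: "?P k" "\<And>j. ?P j \<Longrightarrow> j \<le> k"
    using Nat.ex_has_greatest_nat[of ?P 0 N] bound by blast
  then obtain B where B: "finite B" "corthonormal B" "B \<subseteq> E" "card B = k" by blast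
  have full: "fourier_sum B x = x" if x: "x \<in> E" for x
  proof (rule ccontr)
    assume "fourier_sum B x \<noteq> x"
    define r where "r = x - fourier_sum B x"
    define e where "e = (1 / norm r) *\<^sub>R r"
    have r0: "r \<noteq> 0" using \<open>fourier_sum B x \<noteq> x\<close> by (simp add: r_def)
    have "r \<in> E" unfolding r_def
      using E x csubspace_fourier_sum[OF E B(3)] by (simp add: csubspace_def subspace_diff)
    then have eE: "e \<in> E" unfolding e_def using E by (simp add: csubspace_def subspace_scale)
    have re: "cinner r f = 0" if "f \<in> B" for f
      unfolding r_def by (rule fourier_residual_orth[OF B(1,2) that])
    have ef: "cinner e f = 0" "cinner f e = 0" if "f \<in> B" for f
    proof -
      show "cinner e f = 0" using re[OF that] by (simp add: e_def scaleR_scaleC cinner_scaleC_left)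
      then show "cinner f e = 0" using cinner_commute[of f e] by simp
    qed
    have "norm e = 1" using r0 by (simp add: e_def)
    then have ee: "cinner e e = 1" by (simp add: cinner_self)
    have "e \<notin> B" using ef ee by auto
    moreover have "corthonormal (insert e B)"
      using B(2) ef ee by (auto simp: corthonormal_def)
    ultimately have "?P (Suc k)" using B eE by (intro exI[of _ "insert e B"]) auto
    then have "Suc k \<le> k" by (rule k(2))
    then show False by simp
  qed
  have "E \<subseteq> cvs.span B"
  proof
    fix x assume "x \<in> E"
    then have "x = (\<Sum>e\<in>B. cinner x e *\<^sub>C e)" using full by (simp add: fourier_sum_def)
    also have "\<dots> \<in> cvs.span B" by (intro cvs.span_sum cvs.span_scale cvs.span_base)
    finally show "x \<in> cvs.span B" .
  qed
  then have "vector_space.dim scaleC E = card B"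
    using cvs.basis_card_eq_dim[OF B(3) _ corthonormal_independent[OF B(1,2)]] by simp
  then show thesis using that B full by blast
qed

section \<open>Eigenspaces of compact operators\<close>

definition eigenspace :: "('a::chilbert_space \<Rightarrow>\<^sub>L 'a) \<Rightarrow> real \<Rightarrow> 'a set"
  where "eigenspace T s = {x. T x = s *\<^sub>R x}"

lemma csubspace_eigenspace: "clinear_op T \<Longrightarrow> csubspace (eigenspace T s)"
  by (auto simp: eigenspace_def csubspace_def subspace_def blinfun.bilinear_simps clinear_opD
      scaleR_add_right scaleC_scaleR)

lemma eigenspaces_orthogonal:
  assumes "symop T" "clinear_op T" "x \<in> eigenspace T s" "y \<in> eigenspace T t" "s \<noteq> t"
  shows "cinner x y = 0"
proof -
  have "cinner (T x) y = cinner x (T y)"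
    using assms by (intro cinner_transpose symopD)
  then have "of_real s * cinner x y = of_real t * cinner x y"
    using assms(3,4) by (simp add: eigenspace_def scaleR_scaleC cinner_scaleC_left cinner_scaleC_right)
  then show ?thesis using assms(5) by simp
qed

text \<open>Orthonormal eigenvectors for \<open>s\<close> are mapped to points at mutual distance
  \<open>sqrt 2 * s\<close>, of which a totally bounded set contains only finitely many.\<close>

lemma compact_op_orthonormal_bound:
  assumes T: "compact_op T" and s: "0 < s"
  obtains N where "\<And>B. finite B \<Longrightarrow> corthonormal B \<Longrightarrow> B \<subseteq> eigenspace T s \<Longrightarrow> card B \<le> N"
proof -
  let ?C = "closure (T ` cball 0 1)"
  have "compact ?C" using T by (simp add: compact_op_def)
  then obtain k where k: "finite k" "?C \<subseteq> (\<Union>x\<in>k. ball x (s / 2))"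
    using s unfolding compact_eq_totally_bounded by (metis half_gt_zero)
  have "card B \<le> card k" if B: "finite B" "corthonormal B" "B \<subseteq> eigenspace T s" for B
  proof -
    have "\<exists>x\<in>k. dist x (s *\<^sub>R e) < s / 2" if e: "e \<in> B" for e
    proof -
      have "cinner e e = 1" using B(2) e by (simp add: corthonormal_def)
      then have "(norm e)\<^sup>2 = 1" by (metis cinner_self of_real_eq_1_iff)
      then have "norm e = 1" by (simp add: power2_eq_1_iff) (smt (verit) norm_ge_zero)
      then have "T e \<in> T ` cball 0 1" by simp
      then have "T e \<in> ?C" by (rule subsetD[OF closure_subset])
      moreover have "T e = s *\<^sub>R e" using B(3) e by (auto simp: eigenspace_def)
      ultimately have "s *\<^sub>R e \<in> ?C" by (simp only:)
      then have "s *\<^sub>R e \<in> (\<Union>x\<in>k. ball x (s / 2))" by (rule subsetD[OF k(2)])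
      then obtain x where "x \<in> k" "s *\<^sub>R e \<in> ball x (s / 2)" by blast
      then show ?thesis unfolding mem_ball by blast
    qed
    then obtain g where g: "\<And>e. e \<in> B \<Longrightarrow> g e \<in> k" "\<And>e. e \<in> B \<Longrightarrow> dist (g e) (s *\<^sub>R e) < s / 2"
      by metis
    have "inj_on g B"
    proof (rule inj_onI, rule ccontr)
      fix e f assume ef: "e \<in> B" "f \<in> B" "g e = g f" "e \<noteq> f"
      have "dist (s *\<^sub>R e) (s *\<^sub>R f) < s"
        using g(2)[OF ef(1)] g(2)[OF ef(2)] ef(3) dist_triangle[of "s *\<^sub>R e" "s *\<^sub>R f" "g e"]
          dist_commute[of "g e" "s *\<^sub>R e"] by simp
      also have "dist (s *\<^sub>R e) (s *\<^sub>R f) = s * norm (e - f)"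
        using s by (simp add: dist_norm flip: scaleR_diff_right)
      finally have "norm (e - f) < 1" using s by simp
      moreover have "e \<bullet> e = 1" "f \<bullet> f = 1" "e \<bullet> f = 0"
        using B(2) ef by (simp_all add: corthonormal_def inner_via_cinner)
      then have "(norm (e - f))\<^sup>2 = 2"
        by (simp add: power2_norm_eq_inner inner_diff inner_commute)
      ultimately show False using power_mono[of "norm (e - f)" 1 2] by simp
    qed
    then show ?thesis using g(1) k(1) by (intro card_inj_on_le[of g]) auto
  qed
  then show thesis by (rule that)
qed

text \<open>Unit vectors \<open>x\<close> with \<open>Z x \<bullet> x\<close> close to \<open>m = norm Z\<close> are approximate eigenvectors, as
  \<open>norm (Z x - m x) ^ 2 \<le> m (m - Z x \<bullet> x)\<close>; by compactness a subsequence of the \<open>Z x\<close> converges, and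
  so do the \<open>x\<close>.\<close>

lemma compact_posop_eigenvector:
  assumes Z: "posop Z" and comp: "compact_op Z" and ne: "Z \<noteq> 0"
  obtains y where "y \<noteq> 0" "Z y = norm Z *\<^sub>R y"
proof -
  define m where "m = norm Z"
  have m: "0 < m" using ne by (simp add: m_def)
  have le_m: "Z x \<bullet> x \<le> m * (norm x)\<^sup>2" for x unfolding m_def by (rule inner_le_norm_op)
  have "\<exists>x. norm x = 1 \<and> m - 1 / real (Suc n) \<le> Z x \<bullet> x" for n
  proof (rule ccontr)
    assume no: "\<nexists>x. norm x = 1 \<and> m - 1 / real (Suc n) \<le> Z x \<bullet> x"
    define c where "c = max 0 (m - 1 / real (Suc n))"
    have "Z x \<bullet> x \<le> c * (norm x)\<^sup>2" for x
    proof (cases "x = 0")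
      case False
      let ?u = "(1 / norm x) *\<^sub>R x"
      have "norm ?u = 1" using False by simp
      then have "Z ?u \<bullet> ?u < m - 1 / real (Suc n)" using no by (meson not_le)
      then have "Z ?u \<bullet> ?u \<le> c" unfolding c_def by linarith
      then have "(Z ?u \<bullet> ?u) * (norm x)\<^sup>2 \<le> c * (norm x)\<^sup>2" by (rule mult_right_mono) simp
      moreover have "Z x \<bullet> x = (Z ?u \<bullet> ?u) * (norm x)\<^sup>2"
        using False by (simp add: blinfun.scaleR_right power2_eq_square)
      ultimately show ?thesis by (simp only:)
    qed (simp add: blinfun.zero_right)
    then have "norm Z \<le> c" by (intro posop_norm_le[OF Z]) (simp_all add: c_def)
    then have "m \<le> max 0 (m - 1 / real (Suc n))" by (simp only: m_def c_def)
    moreover have "0 < 1 / real (Suc n)" by simp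
    ultimately show False using m by linarith
  qed
  then obtain x where x: "\<And>n. norm (x n) = 1" "\<And>n. m - 1 / real (Suc n) \<le> Z (x n) \<bullet> x n" by metis
  have "Z (x n) \<in> closure (Z ` cball 0 1)" for n
    using x(1) by (intro subsetD[OF closure_subset] imageI) simp
  moreover have "compact (closure (Z ` cball 0 1))" using comp by (simp add: compact_op_def)
  ultimately obtain y r where y: "strict_mono r" "((\<lambda>n. Z (x n)) \<circ> r) \<longlonglongrightarrow> y"
    unfolding compact_def by metis
  have approx: "(\<lambda>n. Z (x n) - m *\<^sub>R x n) \<longlonglongrightarrow> 0"
  proof -
    have sq: "(norm (Z (x n) - m *\<^sub>R x n))\<^sup>2 \<le> m * (1 / real (Suc n))" for n
    proof -
      have "(norm (Z (x n) - m *\<^sub>R x n))\<^sup>2 = (norm (Z (x n)))\<^sup>2 - 2 * m * (Z (x n) \<bullet> x n) + m\<^sup>2 * (norm (x n))\<^sup>2"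
        unfolding power2_norm_eq_inner
        by (simp add: inner_diff inner_commute power2_eq_square[of m] algebra_simps)
      also have "\<dots> \<le> m * (Z (x n) \<bullet> x n) - 2 * m * (Z (x n) \<bullet> x n) + m\<^sup>2"
        using posop_norm_sq_le[OF Z le_m, of "x n"] x(1) by simp
      also have "\<dots> = m * (m - Z (x n) \<bullet> x n)" by (simp add: power2_eq_square algebra_simps)
      also have "\<dots> \<le> m * (1 / real (Suc n))" using x(2)[of n] m by (intro mult_left_mono) auto
      finally show ?thesis .
    qed
    have "(\<lambda>n. m * (1 / real (Suc n))) \<longlonglongrightarrow> m * 0"
      using LIMSEQ_inverse_real_of_nat by (intro tendsto_mult tendsto_const) (simp add: inverse_eq_divide)
    then have lim: "(\<lambda>n. m * (1 / real (Suc n))) \<longlonglongrightarrow> 0" by simp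
    have "(\<lambda>n. (norm (Z (x n) - m *\<^sub>R x n))\<^sup>2) \<longlonglongrightarrow> 0"
    proof (rule tendsto_sandwich[OF always_eventually always_eventually tendsto_const lim])
      show "\<forall>n. 0 \<le> (norm (Z (x n) - m *\<^sub>R x n))\<^sup>2" by simp
      show "\<forall>n. (norm (Z (x n) - m *\<^sub>R x n))\<^sup>2 \<le> m * (1 / real (Suc n))" using sq by blast
    qed
    then have "(\<lambda>n. sqrt ((norm (Z (x n) - m *\<^sub>R x n))\<^sup>2)) \<longlonglongrightarrow> sqrt 0" by (rule tendsto_real_sqrt)
    then show ?thesis by (simp add: tendsto_norm_zero_iff)
  qed
  have "((\<lambda>n. Z (x n) - m *\<^sub>R x n) \<circ> r) \<longlonglongrightarrow> 0" by (rule LIMSEQ_subseq_LIMSEQ[OF approx y(1)])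
  from tendsto_diff[OF y(2) this] have mx: "(\<lambda>n. m *\<^sub>R x (r n)) \<longlonglongrightarrow> y" by (simp add: o_def)
  then have "(\<lambda>n. Z (m *\<^sub>R x (r n))) \<longlonglongrightarrow> Z y" by (intro tendsto_intros)
  moreover have "(\<lambda>n. m *\<^sub>R Z (x (r n))) \<longlonglongrightarrow> m *\<^sub>R y" using y(2) by (intro tendsto_intros) (simp add: o_def)
  ultimately have "Z y = m *\<^sub>R y" by (simp add: blinfun.scaleR_right LIMSEQ_unique)
  moreover have "y \<noteq> 0"
  proof
    have "(\<lambda>n. norm (m *\<^sub>R x (r n))) \<longlonglongrightarrow> norm y" by (intro tendsto_norm mx)
    then have "norm y = m" using m x(1) by (simp add: LIMSEQ_const_iff)
    moreover assume "y = 0"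
    ultimately show False using m by simp
  qed
  ultimately show thesis using that by (simp add: m_def)
qed

text \<open>For \<open>x\<close> and \<open>y\<close> in the unit ball, \<open>norm (T x - T y) ^ 2 \<le> 2 * norm T * norm (X x - X y)\<close>; so the image
  of the ball under \<open>T\<close> inherits total boundedness from that under \<open>X\<close>.\<close>

lemma compact_op_dominated:
  assumes T: "T \<in> Bplus" and X: "compact_op X" and le: "\<And>x. T x \<bullet> x \<le> X x \<bullet> x"
  shows "compact_op T"
proof -
  have lin: "clinear_op T" using T by (rule BplusD)
  have sq: "(norm (T x - T y))\<^sup>2 \<le> norm T * (norm (X x - X y) * 2)" if "norm x \<le> 1" "norm y \<le> 1" for x y
  proof -
    have "(norm (T (x - y)))\<^sup>2 \<le> norm T * (T (x - y) \<bullet> (x - y))"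
      by (rule posop_norm_sq_le[OF BplusD(2)[OF T] inner_le_norm_op])
    also have "\<dots> \<le> norm T * (norm (X (x - y)) * 2)"
    proof (intro mult_left_mono norm_ge_zero)
      have "T (x - y) \<bullet> (x - y) \<le> norm (X (x - y)) * norm (x - y)"
        using le norm_cauchy_schwarz order_trans by blast
      also have "\<dots> \<le> norm (X (x - y)) * 2"
        using norm_triangle_ineq4[of x y] that by (intro mult_left_mono) auto
      finally show "T (x - y) \<bullet> (x - y) \<le> norm (X (x - y)) * 2" .
    qed
    finally show ?thesis by (simp add: blinfun.diff_right)
  qed
  have "seq_compact (closure (T ` cball 0 1))"
  proof -
    have "\<exists>k. finite k \<and> closure (T ` cball 0 1) \<subseteq> (\<Union>x\<in>k. ball x e)" if e: "0 < e" for e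
    proof -
      define d where "d = (e / 2)\<^sup>2 / (2 * (norm T + 1))"
      have d: "0 < d" using e by (simp add: d_def add_nonneg_pos)
      have "compact (closure (X ` cball 0 1))" using X by (simp add: compact_op_def)
      then obtain k where k: "finite k" "closure (X ` cball 0 1) \<subseteq> (\<Union>x\<in>k. ball x (d / 2))"
        using d unfolding compact_eq_totally_bounded by (metis half_gt_zero)
      define pick where "pick z = (SOME x. x \<in> cball 0 1 \<and> dist z (X x) < d / 2)" for z
      have "T ` cball 0 1 \<subseteq> (\<Union>z\<in>(\<lambda>z. T (pick z)) ` k. cball z (e / 2))"
      proof
        fix v assume "v \<in> T ` cball 0 1"
        then obtain x where x: "v = T x" "x \<in> cball 0 1" by blast
        then have "X x \<in> closure (X ` cball 0 1)" by (intro subsetD[OF closure_subset] imageI)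
        then obtain z where z: "z \<in> k" "dist z (X x) < d / 2" using k(2) by auto
        then have p: "pick z \<in> cball 0 1" "dist z (X (pick z)) < d / 2"
          using someI[of "\<lambda>x. x \<in> cball 0 1 \<and> dist z (X x) < d / 2" x] x(2) by (auto simp: pick_def)
        have "dist (X (pick z)) (X x) < d"
          using z(2) p(2) dist_triangle[of "X (pick z)" "X x" z] dist_commute[of z "X (pick z)"] by linarith
        then have Xd: "norm (X (pick z) - X x) * 2 \<le> d * 2" by (simp add: dist_norm)
        have "(norm (T (pick z) - T x))\<^sup>2 \<le> norm T * (norm (X (pick z) - X x) * 2)"
          using p(1) x(2) by (intro sq) auto
        also have "\<dots> \<le> norm T * (d * 2)" using Xd by (rule mult_left_mono) simp
        also have "\<dots> \<le> (norm T + 1) * (d * 2)" using d by (intro mult_right_mono) auto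
        also have "\<dots> = (e / 2)\<^sup>2"
        proof -
          have "a * (b / (2 * a) * 2) = b" if "a \<noteq> 0" for a b :: real using that by simp
          moreover have "norm T + 1 \<noteq> 0" by (smt (verit) norm_ge_zero)
          ultimately show ?thesis unfolding d_def by blast
        qed
        finally have "norm (T (pick z) - T x) \<le> e / 2" by (rule power2_le_imp_le) (use e in simp)
        then show "v \<in> (\<Union>z\<in>(\<lambda>z. T (pick z)) ` k. cball z (e / 2))"
          using z(1) by (auto simp: x(1) dist_norm)
      qed
      moreover have "closed (\<Union>z\<in>(\<lambda>z. T (pick z)) ` k. cball z (e / 2))"
        using k(1) by (intro closed_UN) auto
      ultimately have "closure (T ` cball 0 1) \<subseteq> (\<Union>z\<in>(\<lambda>z. T (pick z)) ` k. cball z (e / 2))"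
        by (rule closure_minimal)
      also have "\<dots> \<subseteq> (\<Union>z\<in>(\<lambda>z. T (pick z)) ` k. ball z e)" using e by (intro UN_mono) auto
      finally show ?thesis using k(1) by (intro exI[of _ "(\<lambda>z. T (pick z)) ` k"]) simp
    qed
    moreover have "complete (closure (T ` cball 0 1))" by (simp add: complete_eq_closed)
    ultimately show ?thesis using compact_eq_totally_bounded compact_eq_seq_compact_metric by blast
  qed
  then show ?thesis using lin by (simp add: compact_op_def compact_eq_seq_compact_metric)
qed

section \<open>Schatten classes\<close>

lemma bernoulli_powr:
  fixes x p :: real
  assumes "0 \<le> x" "1 \<le> p"
  shows "1 + p * (x - 1) \<le> x powr p"
proof (cases "x = 0")
  case False
  then have x: "0 < x" using assms by simp
  have "(x powr p) powr (1/p) * 1 powr (1 - 1/p) \<le> (1/p) * (x powr p) + (1 - 1/p) * 1"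
    using assms x by (intro Youngs_inequality_0) auto
  then have "x \<le> (1/p) * (x powr p) + (1 - 1/p)" using assms x by (simp add: powr_powr)
  then have "p * x \<le> p * ((1/p) * (x powr p) + (1 - 1/p))" using assms by (intro mult_left_mono) auto
  also have "\<dots> = x powr p + (p - 1)" using assms by (simp add: algebra_simps)
  finally show ?thesis by (simp add: algebra_simps)
qed (use assms in simp)

text \<open>Jensen's inequality for weights of total mass at most \<open>1\<close>, from the tangent of \<open>l \<mapsto> l powr p\<close> at the
  mean \<open>t\<close>. The missing mass does no harm because \<open>p \<ge> 1\<close>.\<close>

lemma powr_subconvex_sum:
  fixes w l :: "'i \<Rightarrow> real"
  assumes fin: "finite I" and w: "\<And>i. i \<in> I \<Longrightarrow> 0 \<le> w i" and w1: "(\<Sum>i\<in>I. w i) \<le> 1"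
    and l: "\<And>i. i \<in> I \<Longrightarrow> 0 \<le> l i" and p: "1 \<le> p"
  shows "(\<Sum>i\<in>I. w i * l i) powr p \<le> (\<Sum>i\<in>I. w i * l i powr p)"
proof -
  define t where "t = (\<Sum>i\<in>I. w i * l i)"
  have t0: "0 \<le> t" unfolding t_def using w l by (intro sum_nonneg) simp
  show ?thesis
  proof (cases "t = 0")
    case True
    then show ?thesis unfolding t_def[symmetric] using w by (simp add: sum_nonneg)
  next
    case False
    then have t: "0 < t" using t0 by simp
    have tangent: "w i * (t powr p * (1 + p * (l i / t - 1))) \<le> w i * l i powr p" if i: "i \<in> I" for i
    proof (rule mult_left_mono[OF _ w[OF i]])
      have "t powr p * (1 + p * (l i / t - 1)) \<le> t powr p * (l i / t) powr p"
        using l[OF i] t p by (intro mult_left_mono bernoulli_powr) auto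
      also have "\<dots> = l i powr p" using l[OF i] t by (simp add: powr_divide)
      finally show "t powr p * (1 + p * (l i / t - 1)) \<le> l i powr p" .
    qed
    let ?s = "\<Sum>i\<in>I. w i"
    have "t powr p * 1 \<le> t powr p * (?s + p * (1 - ?s))"
    proof (rule mult_left_mono)
      have "1 * (1 - ?s) \<le> p * (1 - ?s)" using p w1 by (intro mult_right_mono) auto
      then show "1 \<le> ?s + p * (1 - ?s)" by simp
    qed simp
    also have "?s + p * (1 - ?s) = (\<Sum>i\<in>I. w i * (1 + p * (l i / t - 1)))"
    proof -
      have "(\<Sum>i\<in>I. w i * (1 + p * (l i / t - 1))) = (\<Sum>i\<in>I. w i + (p * (w i * l i / t) - p * w i))"
        by (intro sum.cong refl) (simp add: algebra_simps)
      also have "\<dots> = ?s + (p * ((\<Sum>i\<in>I. w i * l i) / t) - p * ?s)"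
        by (simp add: sum.distrib sum_subtractf sum_distrib_left sum_divide_distrib)
      also have "(\<Sum>i\<in>I. w i * l i) / t = 1" using t by (simp add: t_def)
      finally show ?thesis by (simp add: algebra_simps)
    qed
    also have "t powr p * (\<Sum>i\<in>I. w i * (1 + p * (l i / t - 1))) =
        (\<Sum>i\<in>I. w i * (t powr p * (1 + p * (l i / t - 1))))"
      unfolding sum_distrib_left by (intro sum.cong refl) (simp only: mult.left_commute)
    also have "\<dots> \<le> (\<Sum>i\<in>I. w i * l i powr p)" by (rule sum_mono[OF tangent])
    finally show ?thesis by (simp add: t_def)
  qed
qed

definition eigen_basis :: "('a::chilbert_space \<Rightarrow>\<^sub>L 'a) \<Rightarrow> real \<Rightarrow> 'a set"
  where "eigen_basis X s = (SOME B. finite B \<and> corthonormal B \<and> B \<subseteq> eigenspace X s \<and>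
    (\<forall>x\<in>eigenspace X s. fourier_sum B x = x) \<and> vector_space.dim scaleC (eigenspace X s) = card B)"

abbreviation eigen_bases :: "('a::chilbert_space \<Rightarrow>\<^sub>L 'a) \<Rightarrow> real set \<Rightarrow> 'a set"
  where "eigen_bases X F \<equiv> \<Union>s\<in>F. eigen_basis X s"

lemma fourier_sum_combination:
  "fourier_sum B (c *\<^sub>C x + y) = c *\<^sub>C fourier_sum B x + fourier_sum B y"
  by (simp add: fourier_sum_def cinner_add_left cinner_scaleC_left scaleC_add_left scaleC_sum_right
      scaleC_scaleC sum.distrib)

context
  fixes X :: "'a::chilbert_space \<Rightarrow>\<^sub>L 'a"
  assumes X: "X \<in> Bplus" and compact: "compact_op X"
begin

lemma eigen_basis:
  assumes "0 < s"
  shows "finite (eigen_basis X s)" "corthonormal (eigen_basis X s)" "eigen_basis X s \<subseteq> eigenspace X s"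
    "\<And>x. x \<in> eigenspace X s \<Longrightarrow> fourier_sum (eigen_basis X s) x = x"
    "vector_space.dim scaleC (eigenspace X s) = card (eigen_basis X s)"
proof -
  obtain N where N: "\<And>B. finite B \<Longrightarrow> corthonormal B \<Longrightarrow> B \<subseteq> eigenspace X s \<Longrightarrow> card B \<le> N"
    using compact_op_orthonormal_bound[OF compact assms] by blast
  have "csubspace (eigenspace X s)" by (rule csubspace_eigenspace[OF BplusD(1)[OF X]])
  then have "\<exists>B. finite B \<and> corthonormal B \<and> B \<subseteq> eigenspace X s \<and>
    (\<forall>x\<in>eigenspace X s. fourier_sum B x = x) \<and> vector_space.dim scaleC (eigenspace X s) = card B"
    by (rule ex_orthonormal_basis[OF _ N]) blast+
  from someI_ex[OF this] show "finite (eigen_basis X s)" "corthonormal (eigen_basis X s)"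
    "eigen_basis X s \<subseteq> eigenspace X s"
    "\<And>x. x \<in> eigenspace X s \<Longrightarrow> fourier_sum (eigen_basis X s) x = x"
    "vector_space.dim scaleC (eigenspace X s) = card (eigen_basis X s)"
    unfolding eigen_basis_def[symmetric] by auto
qed

lemma eigen_basis_norm:
  assumes "0 < s" "f \<in> eigen_basis X s"
  shows "norm f = 1" "X f = s *\<^sub>R f" "X f \<bullet> f = s"
proof -
  have "cinner f f = 1" using eigen_basis(2)[OF assms(1)] assms(2) by (simp add: corthonormal_def)
  then have ff: "f \<bullet> f = 1" by (simp add: inner_via_cinner)
  then show "norm f = 1" by (simp add: norm_eq_sqrt_inner)
  show "X f = s *\<^sub>R f" using eigen_basis(3)[OF assms(1)] assms(2) by (auto simp: eigenspace_def)
  then show "X f \<bullet> f = s" by (simp add: ff)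
qed

lemma eigen_basis_orth:
  assumes "0 < s" "0 < t" "s \<noteq> t" "x \<in> eigenspace X s" "f \<in> eigen_basis X t"
  shows "cinner x f = 0"
  using eigenspaces_orthogonal[OF BplusD(3)[OF X] BplusD(1)[OF X] assms(4) _ assms(3)]
    eigen_basis(3)[OF assms(2)] assms(5) by blast

lemma eigen_bases:
  assumes "finite F" "F \<subseteq> {0<..}"
  shows "finite (eigen_bases X F)" "corthonormal (eigen_bases X F)"
    and eigen_bases_sum: "(\<Sum>f\<in>eigen_bases X F. h f) = (\<Sum>s\<in>F. \<Sum>f\<in>eigen_basis X s. h f :: real)"
    and eigen_bases_fourier: "s \<in> F \<Longrightarrow> x \<in> eigenspace X s \<Longrightarrow> fourier_sum (eigen_bases X F) x = x"
proof -
  have pos: "0 < s" if "s \<in> F" for s using assms(2) that by auto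
  have orth: "cinner e f = 0" if "s \<in> F" "t \<in> F" "s \<noteq> t" "e \<in> eigen_basis X s" "f \<in> eigen_basis X t" for s t e f
    using eigen_basis_orth[OF pos pos that(3)] that eigen_basis(3)[OF pos] by blast
  show fin: "finite (eigen_bases X F)" using assms eigen_basis(1)[OF pos] by blast
  show "corthonormal (eigen_bases X F)" unfolding corthonormal_def
  proof (intro ballI)
    fix e f assume "e \<in> eigen_bases X F" "f \<in> eigen_bases X F"
    then obtain s t where st: "s \<in> F" "e \<in> eigen_basis X s" "t \<in> F" "f \<in> eigen_basis X t" by blast
    show "cinner e f = (if e = f then 1 else 0)"
    proof (cases "s = t")
      case True
      then show ?thesis using eigen_basis(2)[OF pos[OF st(1)]] st by (simp add: corthonormal_def)
    next
      case False
      then have z: "cinner e f = 0" using orth st by blast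
      moreover have "cinner e e = 1"
        using eigen_basis(2)[OF pos[OF st(1)]] st by (simp add: corthonormal_def)
      ultimately show ?thesis by auto
    qed
  qed
  have disj: "eigen_basis X s \<inter> eigen_basis X t = {}" if "s \<in> F" "t \<in> F" "s \<noteq> t" for s t
  proof -
    have "e \<notin> eigen_basis X t" if e: "e \<in> eigen_basis X s" for e
    proof
      assume "e \<in> eigen_basis X t"
      then have "cinner e e = 0" using orth \<open>s \<in> F\<close> \<open>t \<in> F\<close> \<open>s \<noteq> t\<close> e by blast
      then have "norm e = 0" by (simp add: cinner_self)
      then show False using eigen_basis_norm(1)[OF pos[OF \<open>s \<in> F\<close>] e] by simp
    qed
    then show ?thesis by blast
  qed
  show "(\<Sum>f\<in>eigen_bases X F. h f) = (\<Sum>s\<in>F. \<Sum>f\<in>eigen_basis X s. h f :: real)"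
    using assms(1) eigen_basis(1)[OF pos] disj by (intro sum.UNION_disjoint) auto
  show "fourier_sum (eigen_bases X F) x = x" if "s \<in> F" "x \<in> eigenspace X s"
  proof -
    have "fourier_sum (eigen_bases X F) x = fourier_sum (eigen_basis X s) x"
      unfolding fourier_sum_def
    proof (rule sum.mono_neutral_right[OF fin])
      show "eigen_basis X s \<subseteq> eigen_bases X F" using that by blast
      show "\<forall>e\<in>eigen_bases X F - eigen_basis X s. cinner x e *\<^sub>C e = 0"
      proof
        fix e assume e: "e \<in> eigen_bases X F - eigen_basis X s"
        then obtain t where t: "t \<in> F" "e \<in> eigen_basis X t" by blast
        then have "s \<noteq> t" using e by blast
        then have "cinner x e = 0" using eigen_basis_orth[OF pos pos] that t by blast
        then show "cinner x e *\<^sub>C e = 0" using scaleC_add_left[of 0 0 e] by simp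
      qed
    qed
    then show ?thesis using eigen_basis(4)[OF pos] that by simp
  qed
qed

text \<open>Compressing to the orthogonal complement of all eigenvectors with positive eigenvalue
  leaves a compact positive operator without such eigenvectors, which has to vanish.\<close>

lemma orthogonal_to_eigenspaces:
  assumes x: "x \<in> ocomp (\<Union>s\<in>{0<..}. eigenspace X s)"
  shows "X x = 0"
proof -
  let ?K = "ocomp (\<Union>s\<in>{0<..}. eigenspace X s)"
  note K = csubspace_ocomp[of "\<Union>s\<in>{0<..}. eigenspace X s"] closed_ocomp[of "\<Union>s\<in>{0<..}. eigenspace X s"]
  define P where "P = proj ?K"
  define Z where "Z = P o\<^sub>L X o\<^sub>L P"
  have PB: "P \<in> Bplus" unfolding P_def by (rule proj_Bplus[OF K])
  have ZB: "Z \<in> Bplus" unfolding Z_def using X PB by (rule Bplus_sandwich)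
  have inv: "X y \<in> ?K" if y: "y \<in> ?K" for y
    unfolding ocomp_def
  proof (intro CollectI ballI)
    fix u assume "u \<in> (\<Union>s\<in>{0<..}. eigenspace X s)"
    then obtain s where s: "0 < s" "X u = s *\<^sub>R u" and u: "u \<in> (\<Union>s\<in>{0<..}. eigenspace X s)"
      by (auto simp: eigenspace_def)
    have "cinner (X y) u = cinner y (X u)"
      using BplusD[OF X] by (intro cinner_transpose symopD)
    also have "\<dots> = of_real s * cinner y u" by (simp add: s scaleR_scaleC cinner_scaleC_right)
    also have "cinner y u = 0" using y u unfolding ocomp_def by blast
    finally show "cinner (X y) u = 0" by simp
  qed
  have "compact_op Z" unfolding compact_op_def
  proof
    show "clinear_op Z" using ZB by (rule BplusD)
    let ?C = "P ` closure (X ` cball 0 1)"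
    have C: "compact ?C"
      using compact unfolding compact_op_def
      by (intro compact_continuous_image continuous_intros) auto
    have "Z ` cball 0 1 \<subseteq> ?C"
    proof
      fix v assume "v \<in> Z ` cball 0 1"
      then obtain y where y: "v = P (X (P y))" "norm y \<le> 1" by (auto simp: Z_def)
      have "norm (P y) \<le> 1" using norm_proj_le[OF K, of y] y(2) by (simp add: P_def)
      then have "X (P y) \<in> X ` cball 0 1" by simp
      then have "X (P y) \<in> closure (X ` cball 0 1)" by (rule subsetD[OF closure_subset])
      then show "v \<in> ?C" unfolding y(1) by (rule imageI)
    qed
    then have "closure (Z ` cball 0 1) \<subseteq> ?C" using C by (intro closure_minimal compact_imp_closed)
    then have "closure (Z ` cball 0 1) = ?C \<inter> closure (Z ` cball 0 1)" by (rule Int_absorb1[symmetric])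
    also have "compact \<dots>" using C by (intro compact_Int_closed closed_closure)
    finally show "compact (closure (Z ` cball 0 1))" .
  qed
  have "Z = 0"
  proof (rule ccontr)
    assume ne: "Z \<noteq> 0"
    obtain y where y: "y \<noteq> 0" "Z y = norm Z *\<^sub>R y"
      using compact_posop_eigenvector[OF BplusD(2)[OF ZB] \<open>compact_op Z\<close> ne] by blast
    have m: "0 < norm Z" using ne by simp
    have "P (X (P y)) \<in> ?K" unfolding P_def by (rule proj_in[OF K])
    then have "(1 / norm Z) *\<^sub>R Z y \<in> ?K"
      using K(1) by (simp add: Z_def csubspace_def subspace_scale)
    then have yK: "y \<in> ?K" using m by (simp add: y(2))
    have "P y = y" unfolding P_def by (rule proj_same[OF K yK])
    moreover have "P (X y) = X y" unfolding P_def by (rule proj_same[OF K inv[OF yK]])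
    ultimately have "X y = norm Z *\<^sub>R y" using y(2) by (simp add: Z_def)
    then have "y \<in> (\<Union>s\<in>{0<..}. eigenspace X s)" using m by (auto simp: eigenspace_def)
    then have "cinner y y = 0" using yK unfolding ocomp_def by blast
    then show False using y(1) by (simp add: cinner_self)
  qed
  moreover have "P x = x" unfolding P_def by (rule proj_same[OF K x])
  moreover have "P (X x) = X x" unfolding P_def by (rule proj_same[OF K inv[OF x]])
  moreover have "Z x = P (X (P x))" by (simp add: Z_def)
  ultimately show "X x = 0" by simp
qed

lemma span_eigenspaces_fourier:
  assumes "w \<in> cvs.span (\<Union>s\<in>{0<..}. eigenspace X s)"
  shows "\<exists>F. finite F \<and> F \<subseteq> {0<..} \<and>
    (\<forall>F'. finite F' \<longrightarrow> F \<subseteq> F' \<longrightarrow> F' \<subseteq> {0<..} \<longrightarrow> fourier_sum (eigen_bases X F') w = w)"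
  using assms
proof (induction rule: cvs.span_induct_alt)
  case base
  have "fourier_sum B 0 = 0" for B :: "'a set" using fourier_sum_combination[of B 1 0 0] by simp
  then show ?case by (intro exI[of _ "{}"]) simp
next
  case (step c x y)
  then obtain s F where s: "0 < s" "x \<in> eigenspace X s" and F: "finite F" "F \<subseteq> {0<..}"
    "\<And>F'. finite F' \<Longrightarrow> F \<subseteq> F' \<Longrightarrow> F' \<subseteq> {0<..} \<Longrightarrow> fourier_sum (eigen_bases X F') y = y" by auto
  have "fourier_sum (eigen_bases X F') (c *\<^sub>C x + y) = c *\<^sub>C x + y"
    if F': "finite F'" "insert s F \<subseteq> F'" "F' \<subseteq> {0<..}" for F'
    using eigen_bases_fourier[OF F'(1,3) _ s(2)] F(3)[OF F'(1) _ F'(3)] F'(2)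
    by (simp add: fourier_sum_combination)
  then show ?case using F s by (intro exI[of _ "insert s F"]) simp
qed

text \<open>The component of \<open>e\<close> orthogonal to all eigenvectors lies in the kernel of \<open>X\<close>; the rest is
  approximated by finite Fourier sums \<open>v\<close>. As \<open>X v\<close> is orthogonal to the residual, the error in the
  form is only quadratic in it.\<close>

lemma form_le_eigen_sum:
  assumes d: "0 < d"
  shows "\<exists>F. finite F \<and> F \<subseteq> {0<..} \<and> (\<forall>F'. finite F' \<longrightarrow> F \<subseteq> F' \<longrightarrow> F' \<subseteq> {0<..} \<longrightarrow>
    X e \<bullet> e \<le> d + (\<Sum>f\<in>eigen_bases X F'. (cmod (cinner e f))\<^sup>2 * (X f \<bullet> f)))"
proof -
  let ?U = "\<Union>s\<in>{0<..}. eigenspace X s"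
  let ?V = "cvs.span ?U"
  have V: "csubspace ?V"
    unfolding csubspace_def subspace_def
    by (auto simp: scaleR_scaleC intro: cvs.span_add cvs.span_scale cvs.span_zero)
  note K = csubspace_ocomp[of ?V] closed_ocomp[of ?V]
  define k where "k = proj (ocomp ?V) e"
  define u where "u = e - k"
  have kK: "k \<in> ocomp ?V" unfolding k_def by (rule proj_in[OF K])
  then have "k \<in> ocomp ?U" using cvs.span_superset[of ?U] by (auto simp: ocomp_def)
  then have Xk: "X k = 0" by (rule orthogonal_to_eigenspaces)
  have "u \<in> ocomp (ocomp ?V)" unfolding u_def k_def by (rule proj_diff[OF K])
  then have "u \<in> closure ?V" by (simp add: closure_eq_ocomp_ocomp[OF V])
  \<comment> \<open>Chosen so that \<open>norm X * \<eta>\<^sup>2 \<le> d\<close>.\<close>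
  define \<eta> where "\<eta> = sqrt (d / (norm X + 1))"
  have nX: "0 < norm X + 1" by (simp add: add_nonneg_pos)
  have \<eta>: "0 < \<eta>" "norm X * \<eta>\<^sup>2 \<le> d"
    using d nX by (simp_all add: \<eta>_def field_simps)
  obtain w where w: "w \<in> ?V" "dist w u < \<eta>" using \<open>u \<in> closure ?V\<close> \<eta>(1) by (auto simp: closure_approachable)
  obtain F where F: "finite F" "F \<subseteq> {0<..}"
    "\<And>F'. finite F' \<Longrightarrow> F \<subseteq> F' \<Longrightarrow> F' \<subseteq> {0<..} \<Longrightarrow> fourier_sum (eigen_bases X F') w = w"
    using span_eigenspaces_fourier[OF w(1)] by blast
  have "X e \<bullet> e \<le> d + (\<Sum>f\<in>eigen_bases X F'. (cmod (cinner e f))\<^sup>2 * (X f \<bullet> f))"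
    if F': "finite F'" "F \<subseteq> F'" "F' \<subseteq> {0<..}" for F'
  proof -
    let ?O = "eigen_bases X F'"
    note O = eigen_bases(1,2)[OF F'(1,3)]
    define v where "v = fourier_sum ?O u"
    have "norm (u - v) \<le> norm (u - w)"
    proof -
      have eq: "u - v = (u - w) - fourier_sum ?O (u - w)"
        unfolding fourier_sum_diff[OF O] v_def F(3)[OF F'] by simp
      show ?thesis unfolding eq by (rule norm_fourier_residual_le[OF O])
    qed
    then have uv: "norm (u - v) \<le> \<eta>" using w(2) by (simp add: dist_norm norm_minus_commute)
    have Xv: "X v = (\<Sum>f\<in>?O. (cinner u f * of_real (X f \<bullet> f)) *\<^sub>C f)"
    proof -
      have "X v = (\<Sum>f\<in>?O. cinner u f *\<^sub>C X f)"
        unfolding v_def fourier_sum_def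
        by (simp add: blinfun.sum_right clinear_opD[OF BplusD(1)[OF X]])
      also have "\<dots> = (\<Sum>f\<in>?O. (cinner u f * of_real (X f \<bullet> f)) *\<^sub>C f)"
      proof (rule sum.cong[OF refl])
        fix f assume "f \<in> ?O"
        then obtain s where "0 < s" "f \<in> eigen_basis X s" using F'(3) by auto
        then have "X f = (X f \<bullet> f) *\<^sub>R f" using eigen_basis_norm(2,3) by metis
        then show "cinner u f *\<^sub>C X f = (cinner u f * of_real (X f \<bullet> f)) *\<^sub>C f"
          by (metis scaleC_scaleC scaleR_scaleC)
      qed
      finally show ?thesis .
    qed
    have "cinner (u - v) f = 0" if "f \<in> ?O" for f
      unfolding v_def by (rule fourier_residual_orth[OF O that])
    then have vd: "X v \<bullet> (u - v) = 0" unfolding Xv by (rule inner_combination_orth[OF O])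
    have "cinner (X v) u = (\<Sum>f\<in>?O. of_real ((cmod (cinner u f))\<^sup>2 * (X f \<bullet> f)))"
      unfolding Xv cinner_sum_left
    proof (rule sum.cong[OF refl])
      fix f
      have "cinner f u = cnj (cinner u f)" by (rule cinner_commute)
      then show "cinner ((cinner u f * of_real (X f \<bullet> f)) *\<^sub>C f) u = of_real ((cmod (cinner u f))\<^sup>2 * (X f \<bullet> f))"
        using complex_norm_square[of "cinner u f"] by (simp add: cinner_scaleC_left mult_ac)
    qed
    then have "X v \<bullet> u = (\<Sum>f\<in>?O. (cmod (cinner u f))\<^sup>2 * (X f \<bullet> f))"
      unfolding inner_via_cinner[of "X v"] by (simp flip: of_real_sum)
    moreover have "cinner u f = cinner e f" if "f \<in> ?O" for f
    proof -
      obtain s where s: "0 < s" "f \<in> eigen_basis X s" using F'(3) \<open>f \<in> ?O\<close> by auto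
      have "f \<in> ?U" using s(1) subsetD[OF eigen_basis(3)[OF s(1)] s(2)] by auto
      then have "f \<in> ?V" by (rule cvs.span_base)
      then have "cinner k f = 0" using kK unfolding ocomp_def by blast
      then show ?thesis by (simp add: u_def cinner_diff_left)
    qed
    ultimately have Xvu: "X v \<bullet> u = (\<Sum>f\<in>?O. (cmod (cinner e f))\<^sup>2 * (X f \<bullet> f))" by simp
    note symX = symopD[OF BplusD(3)[OF X]]
    have "X e \<bullet> e = X u \<bullet> e" by (simp add: u_def blinfun.diff_right Xk)
    also have "\<dots> = u \<bullet> X e" by (rule symX)
    also have "\<dots> = u \<bullet> X u" by (simp add: u_def blinfun.diff_right Xk)
    also have "\<dots> = X u \<bullet> u" by (rule symX[symmetric])
    also have "\<dots> = X (u - v) \<bullet> (u - v) + X v \<bullet> u"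
    proof -
      have "X u \<bullet> v = X v \<bullet> u" using symX[of u v] by (simp add: inner_commute)
      moreover have "X v \<bullet> v = X v \<bullet> u" using vd by (simp add: inner_diff_right)
      ultimately show ?thesis by (simp add: blinfun.diff_right inner_diff)
    qed
    also have "X (u - v) \<bullet> (u - v) \<le> d"
    proof -
      have "X (u - v) \<bullet> (u - v) \<le> norm X * (norm (u - v))\<^sup>2" by (rule inner_le_norm_op)
      also have "\<dots> \<le> norm X * \<eta>\<^sup>2" using uv by (intro mult_left_mono power_mono) auto
      finally show ?thesis using \<eta>(2) by simp
    qed
    finally show ?thesis unfolding Xvu by simp
  qed
  then show ?thesis using F(1,2) by (intro exI[of _ F]) blast
qed

text \<open>For orthonormal \<open>e\<close> in \<open>D\<close> and eigenvectors \<open>f\<close> of \<open>X\<close>, the numbers \<open>(cmod (cinner e f))\<^sup>2\<close> sum to at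
  most \<open>1\<close> both over \<open>f\<close> and over \<open>e\<close>. The first bound allows Jensen's inequality for each \<open>e\<close>, the
  second leaves the trace of \<open>X powr p\<close>. The error \<open>d\<close> of the finite approximation tends to \<open>0\<close> at
  the end.\<close>

lemma powr_sum_le_trace:
  assumes D: "finite D" "corthonormal D" and p: "1 \<le> p"
    and a: "\<And>e. e \<in> D \<Longrightarrow> 0 < a e" "\<And>e. e \<in> D \<Longrightarrow> a e \<le> X e \<bullet> e"
    and summ: "(\<lambda>s. real (vector_space.dim scaleC (eigenspace X s)) * s powr p) summable_on {0<..}"
  shows "(\<Sum>e\<in>D. a e powr p) \<le>
    (\<Sum>\<^sub>\<infinity>s\<in>{0<..}. real (vector_space.dim scaleC (eigenspace X s)) * s powr p)" (is "_ \<le> ?M")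
proof -
  have step: "(\<Sum>e\<in>D. (max 0 (a e - d)) powr p) \<le> ?M" if d: "0 < d" for d
  proof -
    define good where "good e F \<longleftrightarrow> finite F \<and> F \<subseteq> {0<..} \<and>
        (\<forall>F'. finite F' \<longrightarrow> F \<subseteq> F' \<longrightarrow> F' \<subseteq> {0<..} \<longrightarrow>
          X e \<bullet> e \<le> d + (\<Sum>f\<in>eigen_bases X F'. (cmod (cinner e f))\<^sup>2 * (X f \<bullet> f)))" for e F
    have "\<forall>e. \<exists>F. good e F" unfolding good_def using form_le_eigen_sum[OF d] by blast
    then obtain \<F> where \<F>: "\<And>e. good e (\<F> e)" using choice by blast
    define F where "F = (\<Union>e\<in>D. \<F> e)"
    have F: "finite F" "F \<subseteq> {0<..}" using D(1) \<F> unfolding F_def good_def by auto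
    let ?O = "eigen_bases X F"
    note O = eigen_bases(1,2)[OF F]
    have lam: "0 \<le> X f \<bullet> f" for f using BplusD(2)[OF X] by (rule posop_nonneg)
    have ne: "norm e = 1" if "corthonormal B" "e \<in> B" for e :: 'a and B
    proof -
      have "e \<bullet> e = 1" using that by (simp add: corthonormal_def inner_via_cinner)
      then show ?thesis by (simp add: norm_eq_sqrt_inner)
    qed
    have "(max 0 (a e - d)) powr p \<le> (\<Sum>f\<in>?O. (cmod (cinner e f))\<^sup>2 * (X f \<bullet> f) powr p)" if e: "e \<in> D" for e
    proof -
      let ?b = "\<Sum>f\<in>?O. (cmod (cinner e f))\<^sup>2 * (X f \<bullet> f)"
      have b0: "0 \<le> ?b" using lam by (intro sum_nonneg) simp
      have "X e \<bullet> e \<le> d + ?b" 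
        using \<F>[of e] F e unfolding good_def F_def by blast
      then have "max 0 (a e - d) \<le> ?b" using a(2)[OF e] b0 by simp
      then have "(max 0 (a e - d)) powr p \<le> ?b powr p" using p by (intro powr_mono2) auto
      also have "\<dots> \<le> (\<Sum>f\<in>?O. (cmod (cinner e f))\<^sup>2 * (X f \<bullet> f) powr p)"
      proof (rule powr_subconvex_sum[OF O(1) _ _ lam p])
        show "(\<Sum>f\<in>?O. (cmod (cinner e f))\<^sup>2) \<le> 1" using bessel[OF O, of e] ne[OF D(2) e] by simp
      qed simp
      finally show ?thesis .
    qed
    then have "(\<Sum>e\<in>D. (max 0 (a e - d)) powr p) \<le>
        (\<Sum>e\<in>D. \<Sum>f\<in>?O. (cmod (cinner e f))\<^sup>2 * (X f \<bullet> f) powr p)" by (rule sum_mono)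
    also have "\<dots> = (\<Sum>f\<in>?O. (\<Sum>e\<in>D. (cmod (cinner f e))\<^sup>2) * (X f \<bullet> f) powr p)"
    proof -
      have "cmod (cinner e f) = cmod (cinner f e)" for e f :: 'a
        using cinner_commute[of e f] by simp
      then show ?thesis by (subst sum.swap) (simp add: sum_distrib_right)
    qed
    also have "\<dots> \<le> (\<Sum>f\<in>?O. 1 * (X f \<bullet> f) powr p)"
    proof (intro sum_mono mult_right_mono)
      fix f assume "f \<in> ?O"
      then show "(\<Sum>e\<in>D. (cmod (cinner f e))\<^sup>2) \<le> 1" using bessel[OF D, of f] ne[OF O(2)] by simp
    qed simp
    also have "\<dots> = (\<Sum>s\<in>F. \<Sum>f\<in>eigen_basis X s. (X f \<bullet> f) powr p)"
      using eigen_bases_sum[OF F] by simp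
    also have "\<dots> = (\<Sum>s\<in>F. real (vector_space.dim scaleC (eigenspace X s)) * s powr p)"
    proof (rule sum.cong[OF refl])
      fix s assume "s \<in> F"
      then have s: "0 < s" using F by auto
      have "(\<Sum>f\<in>eigen_basis X s. (X f \<bullet> f) powr p) = (\<Sum>f\<in>eigen_basis X s. s powr p)"
        using eigen_basis_norm(3)[OF s] by (intro sum.cong) auto
      then show "(\<Sum>f\<in>eigen_basis X s. (X f \<bullet> f) powr p) = real (vector_space.dim scaleC (eigenspace X s)) * s powr p"
        by (simp add: eigen_basis(5)[OF s])
    qed
    also have "\<dots> \<le> ?M" using F by (intro finite_sum_le_infsum[OF summ]) auto
    finally show ?thesis .
  qed
  have "(\<lambda>n. \<Sum>e\<in>D. (max 0 (a e - inverse (real (Suc n)))) powr p) \<longlonglongrightarrow> (\<Sum>e\<in>D. (max 0 (a e - 0)) powr p)"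
  proof (rule tendsto_sum)
    fix e assume "e \<in> D"
    then have "max 0 (a e - 0) \<noteq> 0" using a(1) by fastforce
    then show "(\<lambda>n. (max 0 (a e - inverse (real (Suc n)))) powr p) \<longlonglongrightarrow> (max 0 (a e - 0)) powr p"
      by (intro tendsto_powr tendsto_max tendsto_diff tendsto_const LIMSEQ_inverse_real_of_nat)
  qed
  then have "(\<Sum>e\<in>D. (max 0 (a e - 0)) powr p) \<le> ?M"
    by (rule LIMSEQ_le_const2) (use step in auto)
  moreover have "max 0 (a e - 0) = a e" if "e \<in> D" for e using a(1)[OF that] by simp
  ultimately show ?thesis by simp
qed

end

lemma sqrt_op_cadjoint_self: "T \<in> Bplus \<Longrightarrow> sqrt_op (cadjoint T o\<^sub>L T) = T"
proof -
  assume T: "T \<in> Bplus"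
  have "cadjoint T = T" using BplusD[OF T] by (simp add: cadjoint_eq_adj symop_adj)
  moreover have "T o\<^sub>L T \<in> Bplus" using BplusD[OF T] by (simp add: Bplus_iff posop_square clinear_op_arith)
  ultimately show ?thesis using T by (simp add: sqrt_op_eqI)
qed

lemma schatten_Bplus_iff:
  "T \<in> Bplus \<Longrightarrow> schatten p T \<longleftrightarrow> compact_op T \<and>
    (\<lambda>s. real (vector_space.dim scaleC (eigenspace T s)) * s powr p) summable_on {0<..}"
  by (simp add: schatten_def sqrt_op_cadjoint_self eigenspace_def)

text \<open>In an eigenbasis of \<open>T\<close> the numbers \<open>T e \<bullet> e\<close> are the eigenvalues, so \<open>powr_sum_le_trace\<close> bounds
  the finite partial sums.\<close>

lemma schatten_dominated:
  assumes T: "T \<in> Bplus" and X: "X \<in> Bplus" and le: "\<And>x. T x \<bullet> x \<le> X x \<bullet> x"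
    and p: "1 \<le> p" and S: "schatten p X"
  shows "schatten p T"
proof -
  have cX: "compact_op X"
    and summ: "(\<lambda>s. real (vector_space.dim scaleC (eigenspace X s)) * s powr p) summable_on {0<..}"
    using S by (simp_all add: schatten_Bplus_iff[OF X])
  have cT: "compact_op T" by (rule compact_op_dominated[OF T cX le])
  let ?M = "\<Sum>\<^sub>\<infinity>s\<in>{0<..}. real (vector_space.dim scaleC (eigenspace X s)) * s powr p"
  have "(\<Sum>s\<in>F. real (vector_space.dim scaleC (eigenspace T s)) * s powr p) \<le> ?M"
    if F: "F \<subseteq> {0<..}" "finite F" for F
  proof -
    let ?D = "eigen_bases T F"
    have pos: "0 < T e \<bullet> e" if "e \<in> ?D" for e
      using that F(1) eigen_basis_norm(3)[OF T cT] by force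
    have "(\<Sum>s\<in>F. real (vector_space.dim scaleC (eigenspace T s)) * s powr p) =
        (\<Sum>s\<in>F. \<Sum>e\<in>eigen_basis T s. (T e \<bullet> e) powr p)"
    proof (rule sum.cong[OF refl])
      fix s assume "s \<in> F"
      then have s: "0 < s" using F by auto
      have "(\<Sum>e\<in>eigen_basis T s. (T e \<bullet> e) powr p) = (\<Sum>e\<in>eigen_basis T s. s powr p)"
        using eigen_basis_norm(3)[OF T cT s] by (intro sum.cong) auto
      then show "real (vector_space.dim scaleC (eigenspace T s)) * s powr p = (\<Sum>e\<in>eigen_basis T s. (T e \<bullet> e) powr p)"
        by (simp add: eigen_basis(5)[OF T cT s])
    qed
    also have "\<dots> = (\<Sum>e\<in>?D. (T e \<bullet> e) powr p)"
      by (rule eigen_bases_sum[OF T cT F(2,1), symmetric])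
    also have "\<dots> \<le> ?M"
      by (rule powr_sum_le_trace[OF X cX eigen_bases(1,2)[OF T cT F(2,1)] p pos le summ])
    finally show ?thesis .
  qed
  then have "bdd_above (sum (\<lambda>s. real (vector_space.dim scaleC (eigenspace T s)) * s powr p) ` {F. F \<subseteq> {0<..} \<and> finite F})"
    by (intro bdd_aboveI[of _ ?M]) auto
  then have "(\<lambda>s. real (vector_space.dim scaleC (eigenspace T s)) * s powr p) summable_on {0<..}"
    by (intro nonneg_bdd_above_summable_on) auto
  then show ?thesis using cT by (simp add: schatten_Bplus_iff[OF T])
qed

section \<open>Properties of the limit\<close>

lemma iff_conj_of_imp: "(P \<Longrightarrow> Q) \<Longrightarrow> (Q \<Longrightarrow> P \<longleftrightarrow> R) \<Longrightarrow> P \<longleftrightarrow> Q \<and> R"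
  by blast

theorem theorem3p1:
  fixes G :: "'a::chilbert_space \<Rightarrow>\<^sub>L 'a"
  assumes "G \<in> Bplus"
  shows
    \<comment> \<open>(1)\<close>
    "(\<forall>X\<in>Bplus. tau G (mu G X) = tau G X \<and> (\<forall>n. tau G ((mu G ^^ n) X) = tau G X)) \<and>
    \<comment> \<open>(2)\<close>
    (\<forall>X\<in>Bplus. par_sum (tau G X) G = 0) \<and>
    \<comment> \<open>(3)\<close>
    (\<forall>X\<in>Bplus. tau G X \<preceq> X \<and>
       (tau G X = X \<longleftrightarrow> par_sum X G = 0) \<and>
       (par_sum X G = 0 \<longleftrightarrow> range (sqrt_op X) \<inter> range (sqrt_op G) = {0})) \<and>
    \<comment> \<open>(4)\<close>
    (\<forall>X\<in>Bplus. tau G X = tau G (tau G X)) \<and>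
    \<comment> \<open>(5)\<close>
    (\<forall>X\<in>Bplus.
       let M = ocomp (closure {f. sqrt_op (G + X) f \<in> range (sqrt_op G)})
       in tau G X = sqrt_op (G + X) o\<^sub>L proj M o\<^sub>L sqrt_op (G + X)) \<and>
    \<comment> \<open>(6)\<close>
    (\<forall>X\<in>Bplus.
       let T = contr G X; L = ker (id_blinfun - (cadjoint T o\<^sub>L T))
       in range (sqrt_op X) \<subseteq> range (sqrt_op (G + X)) \<and>
          (\<forall>f. T f = inv_sqrt (G + X) (sqrt_op X f)) \<and> clinear_op T \<and> norm T \<le> 1 \<and>
          L = ocomp (closure {g. sqrt_op X g \<in> range (sqrt_op G)}) \<and>
          tau G X = sqrt_op X o\<^sub>L proj L o\<^sub>L sqrt_op X \<and>
          (positive_definite X \<longrightarrow> L = sqrt_op X ` ker G)) \<and>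
    \<comment> \<open>(7)\<close>
    (\<forall>X\<in>Bplus. X o\<^sub>L G = G o\<^sub>L X \<longrightarrow>
       tau G X = sqrt_op X o\<^sub>L proj (ker G \<inter> closure (range X)) o\<^sub>L sqrt_op X) \<and>
    \<comment> \<open>(8)\<close>
    tau G G = 0 \<and>
    \<comment> \<open>(9)\<close>
    (\<forall>X\<in>Bplus. range (sqrt_op X) \<subseteq> range (sqrt_op G) \<longrightarrow> tau G X = 0) \<and>
    (\<forall>X\<in>Bplus. tau G (par_sum X G) = 0) \<and>
    \<comment> \<open>(10)\<close>
    (\<forall>X\<in>Bplus. \<forall>\<alpha><1/2. range (sqrt_op X) = ran_powr G \<alpha> \<longrightarrow> tau G X = 0) \<and>
    \<comment> \<open>(11)\<close>
    (\<forall>X\<in>Bplus. \<forall>l>0. \<forall>\<eta>>0.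
       tau G (l *\<^sub>R G + X) = tau (\<eta> *\<^sub>R G) X \<and> tau (\<eta> *\<^sub>R G) X = tau G X) \<and>
    \<comment> \<open>(12)\<close>
    (\<forall>X\<in>Bplus. \<forall>\<xi>>0. tau G (\<xi> *\<^sub>R X) = \<xi> *\<^sub>R tau G X) \<and>
    \<comment> \<open>(13)\<close>
    (\<forall>G1\<in>Bplus :: ('a \<Rightarrow>\<^sub>L 'a) set. \<forall>G2\<in>Bplus. range (sqrt_op G1) = range (sqrt_op G2) \<longrightarrow>
       (\<forall>X\<in>Bplus. tau G1 X = tau G2 X \<and> tau G2 X = tau G1 (G2 + X) \<and>
          tau G1 (G2 + X) = tau G2 (G1 + X))) \<and>
    \<comment> \<open>(14)\<close>
    (\<forall>G1\<in>Bplus :: ('a \<Rightarrow>\<^sub>L 'a) set. \<forall>G2\<in>Bplus. range (sqrt_op G1) \<subseteq> range (sqrt_op G2) \<longrightarrow>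
       (\<forall>X\<in>Bplus. tau G2 X \<preceq> tau G1 X)) \<and>
    \<comment> \<open>(15)\<close>
    (\<forall>X\<in>Bplus. tau G X \<in> Bplus0 \<longrightarrow> X \<in> Bplus0 \<and> par_sum (X o\<^sub>L X) G = 0) \<and>
    \<comment> \<open>(16)\<close>
    (\<forall>X\<in>Bplus.
       let i = (tau G X \<in> Bplus0);
           ii = (X \<in> Bplus0 \<and>
             range (sqrt_op (G + X)) \<inter> closure (inv_sqrt (G + X) ` range (sqrt_op G)) = {0});
           iii = (X \<in> Bplus0 \<and>
             (\<forall>y l. (\<forall>n. y n \<in> range (sqrt_op G)) \<and> y \<longlonglongrightarrow> l \<and> l \<in> range X \<and> l \<noteq> 0 \<longrightarrow>
                \<not> convergent (\<lambda>n. inv_sqrt (G + X) (y n))));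
           iv = (X \<in> Bplus0 \<and>
             range (sqrt_op X) \<inter>
               closure (inv_sqrt X ` (range (sqrt_op X) \<inter> range (sqrt_op G))) = {0});
           v = (X \<in> Bplus0 \<and>
             (\<forall>z l. (\<forall>n. z n \<in> range (sqrt_op X) \<inter> range (sqrt_op G)) \<and>
                z \<longlonglongrightarrow> l \<and> l \<in> range X \<and> l \<noteq> 0 \<longrightarrow>
                \<not> convergent (\<lambda>n. inv_sqrt X (z n))))
       in (i \<longleftrightarrow> ii) \<and> (i \<longleftrightarrow> iii) \<and> (i \<longleftrightarrow> iv) \<and> (i \<longleftrightarrow> v)) \<and>
    \<comment> \<open>(17)\<close>
    (\<forall>X\<in>Bplus. (compact_op X \<longrightarrow> compact_op (tau G X)) \<and>
       (\<forall>p\<ge>1. schatten p X \<longrightarrow> schatten p (tau G X)))"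
proof (intro conjI)
  show "(\<forall>X\<in>Bplus. tau G (mu G X) = tau G X \<and> (\<forall>n. tau G ((mu G ^^ n) X) = tau G X))"
    using assms by (simp add: tau_mu tau_mu_iterate)
next
  show "(\<forall>X\<in>Bplus. par_sum (tau G X) G = 0)"
    using assms by (simp add: par_sum_tau)
next
  show "(\<forall>X\<in>Bplus. tau G X \<preceq> X \<and>
       (tau G X = X \<longleftrightarrow> par_sum X G = 0) \<and>
       (par_sum X G = 0 \<longleftrightarrow> range (sqrt_op X) \<inter> range (sqrt_op G) = {0}))"
    using tau_le[OF assms] tau_eq_self_iff[OF assms] par_sum_eq_0_iff[OF assms]
    by (simp add: op_le_def qform_eq)
next
  show "(\<forall>X\<in>Bplus. tau G X = tau G (tau G X))"
    using assms by (simp add: tau_tau)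
next
  show "(\<forall>X\<in>Bplus.
       let M = ocomp (closure {f. sqrt_op (G + X) f \<in> range (sqrt_op G)})
       in tau G X = sqrt_op (G + X) o\<^sub>L proj M o\<^sub>L sqrt_op (G + X))"
    using assms by (auto simp: Let_def ocomp_closure csubspace_pre_range Bplus_add tau_eq_sum_form)
next
  show "(\<forall>X\<in>Bplus.
       let T = contr G X; L = ker (id_blinfun - (cadjoint T o\<^sub>L T))
       in range (sqrt_op X) \<subseteq> range (sqrt_op (G + X)) \<and>
          (\<forall>f. T f = inv_sqrt (G + X) (sqrt_op X f)) \<and> clinear_op T \<and> norm T \<le> 1 \<and>
          L = ocomp (closure {g. sqrt_op X g \<in> range (sqrt_op G)}) \<and>
          tau G X = sqrt_op X o\<^sub>L proj L o\<^sub>L sqrt_op X \<and>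
          (positive_definite X \<longrightarrow> L = sqrt_op X ` ker G))"
    unfolding Let_def
  proof
    fix X :: "'a \<Rightarrow>\<^sub>L 'a" assume X: "X \<in> Bplus"
    have L: "ker (id_blinfun - (cadjoint (contr G X) o\<^sub>L contr G X)) = ocomp (pre_range G X)"
      using ker_contr_eq[OF assms X] by (simp add: cadjoint_eq_adj clinear_contr[OF assms X])
    show "range (sqrt_op X) \<subseteq> range (sqrt_op (G + X)) \<and>
      (\<forall>f. contr G X f = inv_sqrt (G + X) (sqrt_op X f)) \<and> clinear_op (contr G X) \<and> norm (contr G X) \<le> 1 \<and>
      ker (id_blinfun - (cadjoint (contr G X) o\<^sub>L contr G X)) = ocomp (closure (pre_range G X)) \<and>
      tau G X = sqrt_op X o\<^sub>L proj (ker (id_blinfun - (cadjoint (contr G X) o\<^sub>L contr G X))) o\<^sub>L sqrt_op X \<and>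
      (positive_definite X \<longrightarrow>
        ker (id_blinfun - (cadjoint (contr G X) o\<^sub>L contr G X)) = sqrt_op X ` ker G)"
      unfolding L ocomp_closure[OF csubspace_pre_range[OF assms X]]
      using range_sqrt_op_sum(2)[OF assms X] contr_apply[OF assms X] clinear_contr[OF assms X]
        norm_contr[OF assms X] tau_eq_form[OF assms X] ocomp_pre_range_positive_definite[OF assms X]
      by simp
  qed
next
  show "(\<forall>X\<in>Bplus. X o\<^sub>L G = G o\<^sub>L X \<longrightarrow>
       tau G X = sqrt_op X o\<^sub>L proj (ker G \<inter> closure (range X)) o\<^sub>L sqrt_op X)"
    using assms by (simp add: tau_eq_form ocomp_pre_range_commuting)
next
  show "tau G G = 0"
    using assms by (simp add: tau_eq_0I)
next
  show "(\<forall>X\<in>Bplus. range (sqrt_op X) \<subseteq> range (sqrt_op G) \<longrightarrow> tau G X = 0)"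
    using assms by (simp add: tau_eq_0I)
next
  show "(\<forall>X\<in>Bplus. tau G (par_sum X G) = 0)"
    using assms by (simp add: tau_eq_0I range_sqrt_op_mono par_sum_Bplus par_sum_le)
next
  show "(\<forall>X\<in>Bplus. \<forall>\<alpha><1/2. range (sqrt_op X) = ran_powr G \<alpha> \<longrightarrow> tau G X = 0)"
    using tau_eq_0_of_range_powr[OF assms] by blast
next
  show "(\<forall>X\<in>Bplus. \<forall>l>0. \<forall>\<eta>>0.
       tau G (l *\<^sub>R G + X) = tau (\<eta> *\<^sub>R G) X \<and> tau (\<eta> *\<^sub>R G) X = tau G X)"
    using assms by (simp add: tau_add_scaled tau_scale_left)
next
  show "(\<forall>X\<in>Bplus. \<forall>\<xi>>0. tau G (\<xi> *\<^sub>R X) = \<xi> *\<^sub>R tau G X)"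
    using assms by (simp add: tau_scale_right)
next
  show "(\<forall>G1\<in>Bplus :: ('a \<Rightarrow>\<^sub>L 'a) set. \<forall>G2\<in>Bplus. range (sqrt_op G1) = range (sqrt_op G2) \<longrightarrow>
       (\<forall>X\<in>Bplus. tau G1 X = tau G2 X \<and> tau G2 X = tau G1 (G2 + X) \<and>
          tau G1 (G2 + X) = tau G2 (G1 + X)))"
  proof (intro ballI impI)
    fix G1 G2 X :: "'a \<Rightarrow>\<^sub>L 'a"
    assume G: "G1 \<in> Bplus" "G2 \<in> Bplus" "range (sqrt_op G1) = range (sqrt_op G2)" and X: "X \<in> Bplus"
    have "tau G1 X = tau G2 X" using G X by (intro tau_cong_range)
    moreover have "tau G1 (G2 + X) = tau G2 X"
      using tau_cong_range[OF G(1,2) Bplus_add[OF G(2) X] G(3)] tau_add_self[OF G(2) X] by simp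
    moreover have "tau G2 (G1 + X) = tau G1 X"
      using tau_cong_range[OF G(1,2) Bplus_add[OF G(1) X] G(3)] tau_add_self[OF G(1) X] by simp
    ultimately show "tau G1 X = tau G2 X \<and> tau G2 X = tau G1 (G2 + X) \<and> tau G1 (G2 + X) = tau G2 (G1 + X)"
      by simp
  qed
next
  show "(\<forall>G1\<in>Bplus :: ('a \<Rightarrow>\<^sub>L 'a) set. \<forall>G2\<in>Bplus. range (sqrt_op G1) \<subseteq> range (sqrt_op G2) \<longrightarrow>
       (\<forall>X\<in>Bplus. tau G2 X \<preceq> tau G1 X))"
    by (simp add: op_le_def qform_eq tau_antimono_range)
next
  show "(\<forall>X\<in>Bplus. tau G X \<in> Bplus0 \<longrightarrow> X \<in> Bplus0 \<and> par_sum (X o\<^sub>L X) G = 0)"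
    using tau_Bplus0_imp[OF assms] par_sum_square_eq_0[OF assms] by blast
next
  show "(\<forall>X\<in>Bplus.
       let i = (tau G X \<in> Bplus0);
           ii = (X \<in> Bplus0 \<and>
             range (sqrt_op (G + X)) \<inter> closure (inv_sqrt (G + X) ` range (sqrt_op G)) = {0});
           iii = (X \<in> Bplus0 \<and>
             (\<forall>y l. (\<forall>n. y n \<in> range (sqrt_op G)) \<and> y \<longlonglongrightarrow> l \<and> l \<in> range X \<and> l \<noteq> 0 \<longrightarrow>
                \<not> convergent (\<lambda>n. inv_sqrt (G + X) (y n))));
           iv = (X \<in> Bplus0 \<and>
             range (sqrt_op X) \<inter>
               closure (inv_sqrt X ` (range (sqrt_op X) \<inter> range (sqrt_op G))) = {0});
           v = (X \<in> Bplus0 \<and>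
             (\<forall>z l. (\<forall>n. z n \<in> range (sqrt_op X) \<inter> range (sqrt_op G)) \<and>
                z \<longlonglongrightarrow> l \<and> l \<in> range X \<and> l \<noteq> 0 \<longrightarrow>
                \<not> convergent (\<lambda>n. inv_sqrt X (z n))))
       in (i \<longleftrightarrow> ii) \<and> (i \<longleftrightarrow> iii) \<and> (i \<longleftrightarrow> iv) \<and> (i \<longleftrightarrow> v))"
    unfolding Let_def
  proof (intro ballI conjI)
    fix X :: "'a \<Rightarrow>\<^sub>L 'a" assume X: "X \<in> Bplus"
    note imp = tau_Bplus0_imp[OF assms X]
    show "tau G X \<in> Bplus0 \<longleftrightarrow> X \<in> Bplus0 \<and>
        range (sqrt_op (G + X)) \<inter> closure (inv_sqrt (G + X) ` range (sqrt_op G)) = {0}"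
      by (rule iff_conj_of_imp[OF imp tau_Bplus0_iff_sum_Int[OF assms]])
    show "tau G X \<in> Bplus0 \<longleftrightarrow> X \<in> Bplus0 \<and>
        (\<forall>y l. (\<forall>n. y n \<in> range (sqrt_op G)) \<and> y \<longlonglongrightarrow> l \<and> l \<in> range X \<and> l \<noteq> 0 \<longrightarrow>
          \<not> convergent (\<lambda>n. inv_sqrt (G + X) (y n)))"
      by (rule iff_conj_of_imp[OF imp tau_Bplus0_iff_sum_divergent[OF assms]])
    show "tau G X \<in> Bplus0 \<longleftrightarrow> X \<in> Bplus0 \<and>
        range (sqrt_op X) \<inter> closure (inv_sqrt X ` (range (sqrt_op X) \<inter> range (sqrt_op G))) = {0}"
      by (rule iff_conj_of_imp[OF imp tau_Bplus0_iff_Int[OF assms]])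
    show "tau G X \<in> Bplus0 \<longleftrightarrow> X \<in> Bplus0 \<and>
        (\<forall>z l. (\<forall>n. z n \<in> range (sqrt_op X) \<inter> range (sqrt_op G)) \<and>
          z \<longlonglongrightarrow> l \<and> l \<in> range X \<and> l \<noteq> 0 \<longrightarrow> \<not> convergent (\<lambda>n. inv_sqrt X (z n)))"
      by (rule iff_conj_of_imp[OF imp tau_Bplus0_iff_divergent[OF assms]])
  qed
next
  show "(\<forall>X\<in>Bplus. (compact_op X \<longrightarrow> compact_op (tau G X)) \<and>
       (\<forall>p\<ge>1. schatten p X \<longrightarrow> schatten p (tau G X)))"
  proof (intro ballI conjI allI impI)
    fix X :: "'a \<Rightarrow>\<^sub>L 'a" assume X: "X \<in> Bplus"
    show "compact_op (tau G X)" if "compact_op X"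
      using that by (rule compact_op_dominated[OF tau_Bplus[OF assms X] _ tau_le[OF assms X]])
    show "schatten p (tau G X)" if "1 \<le> p" "schatten p X" for p
      using that by (rule schatten_dominated[OF tau_Bplus[OF assms X] X tau_le[OF assms X]])
  qed
qed

end
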